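(* Let $u\in H^{1,a}(B_1^+)$, $u\not\equiv0$, be the unique solution of the boundary value problem with datum $g$ described in the context. The perturbed frequency function $\tilde{\mathcal{N}}$ (defined in the context) belongs to $W^{1,1}_{\mathrm{loc}}(0,R_0)$ and is nondecreasing in $(0,R_0)$, i.e. $\tilde{\mathcal{N}}'\ge0$ in $(0,R_0)$ in the distributional sense. In particular, the limit $$k:=\lim_{r\to0^+}\tilde{\mathcal{N}}(r)\in[0,\infty)$$ exists.
   Context: Fix an integer $N\ge1$, $a\in(-1,1)$, $p\ge2$ and constants $\lambda_-,\lambda_+\ge0$. Write $t^+=\max\{t,0\}$, $t^-=\max\{-t,0\}$, $z=(x,y)\in\mathbb{R}^N\times\mathbb{R}$, $\mathbb{R}^{N+1}_+=\mathbb{R}^N\times(0,\infty)$, $B_r^+=\{z\in\mathbb{R}^{N+1}_+:|z|<r\}$, $S_r^+=\{z\in\mathbb{R}^{N+1}_+:|z|=r\}$, $B_r'=\{x\in\mathbb{R}^N:|x|<r\}$ (identified with $B_r'\times\{0\}$). $H^{1,a}(B_r^+)$ is the completion of $C^\infty(\overline{B_r^+})$ in the norm $\left(\int_{B_r^+}y^a(|\nabla u|^2+u^2)\,dx\,dy\right)^{1/2}$, and $H^{1,a}_{0,S_r^+}(B_r^+)$ is the closure of $C_c^\infty(\overline{B_r^+}\setminus\overline{S_r^+})$ in it. Given $g\in H^{1,a}(B_1^+)\cap C(\overline{B_1^+})$, a solution of $$-\mathrm{div}(y^a\nabla u)=0\text{ in }B_1^+,\quad u=g\text{ on }S_1^+,\quad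 -\lim_{y\to0^+}y^a\partial_yu=\lambda_-(u^-)^{p-1}-\lambda_+(u^+)^{p-1}\text{ on }B_1'$$ is a function $u\in H^{1,a}(B_1^+)\cap L^p(B_1')$ (in the sense of traces on $B_1'$) with $u-g\in H^{1,a}_{0,S_1^+}(B_1^+)$ and $\int_{B_1^+}y^a\nabla u\cdot\nabla\varphi\,dx\,dy=\int_{B_1'}(\lambda_-(u^-)^{p-1}-\lambda_+(u^+)^{p-1})\varphi\,dx$ for all $\varphi\in H^{1,a}_{0,S_1^+}(B_1^+)$. The solution exists, is unique, and is bounded and continuous on $B_1^+\cup B_1'$. $R_0\in(0,1/4)$ is a fixed radius for which $\nabla_xu$ and $y^a\partial_yu$ belong to $C^{0,\alpha}(B_{R_0}^+)$ for some $\alpha\in(0,1)\cap(0,1-a)$ (such a radius exists). For $r\in(0,R_0)$ set $D(r)=r^{-(N+a-1)}\int_{B_r^+}y^a|\nabla u|^2\,dx\,dy$, $H(r)=r^{-(N+a)}\int_{S_r^+}y^au^2\,dS$, $G(r)=r^{-(N+a-1)}\int_{B_r'}(\lambda_-(u^-)^p+\lambda_+(u^+)^p)\,dx$, $\tilde D(r)=D(r)+\frac2pG(r)$, and $\tilde{\mathcal{N}}(r)=\tilde D(r)/H(r)$ (for $u\not\equiv0$ one has $H(r)>0$). *)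

theory Defs
  imports "HOL-Analysis.Analysis"
begin

text \<open>Points $z = (x,y)$ of $R^N \times R$ have type \<^typ>\<open>(real^'n) \<times> real\<close>, with
  $N$ = \<open>CARD('n)\<close> and the Euclidean product norm.\<close>

definition half_ball :: "real \<Rightarrow> ((real^'n) \<times> real) set" where
  "half_ball r = {z. norm z < r \<and> 0 < snd z}"

definition half_sphere :: "real \<Rightarrow> ((real^'n) \<times> real) set" where
  "half_sphere r = {z. norm z = r \<and> 0 < snd z}"

definition flat_ball :: "real \<Rightarrow> ((real^'n) \<times> real) set" where
  "flat_ball r = ball 0 r \<times> {0}"

definition grad :: "('a::euclidean_space \<Rightarrow> real) \<Rightarrow> 'a \<Rightarrow> 'a" where
  "grad f z = (THE D. GDERIV f z :> D)"

primrec Ck :: "nat \<Rightarrow> ('a::euclidean_space \<Rightarrow> real) \<Rightarrow> bool" where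
  "Ck 0 f \<longleftrightarrow> continuous_on UNIV f"
| "Ck (Suc k) f \<longleftrightarrow> f differentiable_on UNIV \<and> (\<forall>b\<in>Basis. Ck k (\<lambda>z. grad f z \<bullet> b))"

definition smooth :: "('a::euclidean_space \<Rightarrow> real) \<Rightarrow> bool" where
  "smooth f \<longleftrightarrow> (\<forall>k. Ck k f)"

definition test_function :: "'a::euclidean_space set \<Rightarrow> ('a \<Rightarrow> real) \<Rightarrow> bool" where
  "test_function U f \<longleftrightarrow> smooth f \<and> compact (closure {x. f x \<noteq> 0}) \<and> closure {x. f x \<noteq> 0} \<subseteq> U"

text \<open>The smooth functions on the closed half ball are the restrictions of smooth functions on
  the whole space. Below, \<^const>\<open>smooth\<close> functions serve as such, and only their
  values on the closed half ball matter. In particular the support of \<open>f\<close> in the next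
  definition is taken relative to the closed half ball.\<close>

definition vanishing_near_sphere :: "real \<Rightarrow> ((real^'n) \<times> real \<Rightarrow> real) \<Rightarrow> bool" where
  "vanishing_near_sphere r f \<longleftrightarrow> smooth f \<and>
     (let K = closure {z \<in> closure (half_ball r). f z \<noteq> 0}
      in compact K \<and> K \<subseteq> closure (half_ball r) - closure (half_sphere r))"

text \<open>Square of the $H^{1,a}$ norm of a function \<open>u\<close> with gradient \<open>V\<close>, in $[0,\infty]$.\<close>

definition H1a_sqnorm ::
  "real \<Rightarrow> real \<Rightarrow> ((real^'n) \<times> real \<Rightarrow> real) \<Rightarrow> ((real^'n) \<times> real \<Rightarrow> (real^'n) \<times> real) \<Rightarrow> ennreal" where
  "H1a_sqnorm a r u V =
     (\<integral>\<^sup>+z\<in>half_ball r. ennreal (snd z powr a * ((norm (V z))\<^sup>2 + (u z)\<^sup>2)) \<partial>lborel)"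

text \<open>Convergence in $H^{1,a}$ of smooth functions \<open>\<phi> k\<close> to \<open>u\<close> with gradient \<open>V\<close>. Since
  $L^2(y^a)$ is complete, the elements of the completion are exactly the (almost everywhere
  classes of) pairs \<open>(u, V)\<close> that are such limits; as $|a| < 1$, \<open>V\<close> is determined by \<open>u\<close>
  almost everywhere, being its weak gradient.\<close>

definition H1a_lim ::
  "real \<Rightarrow> real \<Rightarrow> (nat \<Rightarrow> (real^'n) \<times> real \<Rightarrow> real) \<Rightarrow> ((real^'n) \<times> real \<Rightarrow> real)
     \<Rightarrow> ((real^'n) \<times> real \<Rightarrow> (real^'n) \<times> real) \<Rightarrow> bool" where
  "H1a_lim a r \<phi> u V \<longleftrightarrow>
     set_borel_measurable lborel (half_ball r) u \<and> set_borel_measurable lborel (half_ball r) V \<and>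
     (\<lambda>k. H1a_sqnorm a r (\<lambda>z. u z - \<phi> k z) (\<lambda>z. V z - grad (\<phi> k) z)) \<longlonglongrightarrow> 0"

text \<open>\<open>u\<close> is in $H^{1,a}(B_r^+)$ (respectively in the closure of the smooth functions vanishing
  near the half sphere), and \<open>V\<close> is a representative of its gradient.\<close>

definition H1a_grad ::
  "real \<Rightarrow> real \<Rightarrow> ((real^'n) \<times> real \<Rightarrow> real) \<Rightarrow> ((real^'n) \<times> real \<Rightarrow> (real^'n) \<times> real) \<Rightarrow> bool" where
  "H1a_grad a r u V \<longleftrightarrow> (\<exists>\<phi>. (\<forall>k. smooth (\<phi> k)) \<and> H1a_lim a r \<phi> u V)"

definition H1a0_grad ::
  "real \<Rightarrow> real \<Rightarrow> ((real^'n) \<times> real \<Rightarrow> real) \<Rightarrow> ((real^'n) \<times> real \<Rightarrow> (real^'n) \<times> real) \<Rightarrow> bool" where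
  "H1a0_grad a r u V \<longleftrightarrow> (\<exists>\<phi>. (\<forall>k. vanishing_near_sphere r (\<phi> k)) \<and> H1a_lim a r \<phi> u V)"

definition H1a :: "real \<Rightarrow> real \<Rightarrow> ((real^'n) \<times> real \<Rightarrow> real) set" where
  "H1a a r = {u. \<exists>V. H1a_grad a r u V}"

definition H1a0 :: "real \<Rightarrow> real \<Rightarrow> ((real^'n) \<times> real \<Rightarrow> real) set" where
  "H1a0 a r = {u. \<exists>V. H1a0_grad a r u V}"

text \<open>The trace on the flat part of the boundary: the continuous extension of restriction to
  $y = 0$, as an operator from $H^{1,a}(B_r^+)$ to $L^2(B_r')$.\<close>

definition has_trace ::
  "real \<Rightarrow> real \<Rightarrow> ((real^'n) \<times> real \<Rightarrow> real) \<Rightarrow> (real^'n \<Rightarrow> real) \<Rightarrow> bool" where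
  "has_trace a r u t \<longleftrightarrow> set_borel_measurable lborel (ball 0 r) t \<and>
     (\<exists>\<phi> V. (\<forall>k. smooth (\<phi> k)) \<and> H1a_lim a r \<phi> u V \<and>
        (\<lambda>k. \<integral>\<^sup>+x\<in>ball 0 r. ennreal ((t x - \<phi> k (x, 0))\<^sup>2) \<partial>lborel) \<longlonglongrightarrow> 0)"

definition boundary_flux :: "real \<Rightarrow> real \<Rightarrow> real \<Rightarrow> real \<Rightarrow> real" where
  "boundary_flux p lm lp s = lm * (max (- s) 0) powr (p - 1) - lp * (max s 0) powr (p - 1)"

text \<open>In the weak formulation \<open>t\<close> is the trace of \<open>u\<close> and \<open>s\<close> that of the test function \<open>\<phi>\<close>.
  Integrability of the right-hand side is part of the identity, as the Lebesgue integral of a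
  non-integrable function is 0 in the library; the left-hand side always converges.\<close>

definition weak_solution ::
  "real \<Rightarrow> real \<Rightarrow> real \<Rightarrow> real \<Rightarrow> ((real^'n) \<times> real \<Rightarrow> real) \<Rightarrow> ((real^'n) \<times> real \<Rightarrow> real) \<Rightarrow> bool" where
  "weak_solution a p lm lp g u \<longleftrightarrow>
     u \<in> H1a a 1 \<and> (\<lambda>z. u z - g z) \<in> H1a0 a 1 \<and>
     (\<exists>t. has_trace a 1 u t \<and> set_integrable lborel (ball 0 1) (\<lambda>x. \<bar>t x\<bar> powr p) \<and>
        (\<forall>V \<phi> W s. H1a_grad a 1 u V \<longrightarrow> H1a0_grad a 1 \<phi> W \<longrightarrow> has_trace a 1 \<phi> s \<longrightarrow>
           set_integrable lborel (ball 0 1) (\<lambda>x. boundary_flux p lm lp (t x) * s x) \<and>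
           (LINT z:half_ball 1|lborel. snd z powr a * (V z \<bullet> W z)) =
           (LINT x:ball 0 1|lborel. boundary_flux p lm lp (t x) * s x)))"

definition hoelder_on :: "real \<Rightarrow> 'a::metric_space set \<Rightarrow> ('a \<Rightarrow> 'b::metric_space) \<Rightarrow> bool" where
  "hoelder_on \<alpha> S f \<longleftrightarrow> (\<exists>C. \<forall>z\<in>S. \<forall>w\<in>S. dist (f z) (f w) \<le> C * dist z w powr \<alpha>)"

text \<open>Surface measure on the open upper half sphere of radius \<open>r\<close>, which is the graph over
  $B_r'$ of $h(x) = \sqrt{r^2 - |x|^2}$; the density is $\sqrt{1 + |\nabla h(x)|^2}$.\<close>

definition half_sphere_measure :: "real \<Rightarrow> ((real^'n) \<times> real) measure" where
  "half_sphere_measure r =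
     distr
       (density lborel
          (\<lambda>x. indicator (ball 0 r) x *
               ennreal (sqrt (1 + (norm x)\<^sup>2 / (r\<^sup>2 - (norm x)\<^sup>2)))))
       borel
       (\<lambda>x. (x, sqrt (r\<^sup>2 - (norm x)\<^sup>2)))"

definition D_fun :: "real \<Rightarrow> ((real^'n) \<times> real \<Rightarrow> (real^'n) \<times> real) \<Rightarrow> real \<Rightarrow> real" where
  "D_fun a V r = r powr (- (real CARD('n) + a - 1)) *
     (LINT z:half_ball r|lborel. snd z powr a * (norm (V z))\<^sup>2)"

definition H_fun :: "real \<Rightarrow> ((real^'n) \<times> real \<Rightarrow> real) \<Rightarrow> real \<Rightarrow> real" where
  "H_fun a u r = r powr (- (real CARD('n) + a)) *
     (LINT z|half_sphere_measure r. snd z powr a * (u z)\<^sup>2)"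

definition G_fun ::
  "real \<Rightarrow> real \<Rightarrow> real \<Rightarrow> real \<Rightarrow> ((real^'n) \<times> real \<Rightarrow> real) \<Rightarrow> real \<Rightarrow> real" where
  "G_fun a p lm lp u r = r powr (- (real CARD('n) + a - 1)) *
     (LINT x:ball 0 r|lborel. lm * (max (- u (x, 0)) 0) powr p + lp * (max (u (x, 0)) 0) powr p)"

text \<open>The perturbed frequency of \<open>u\<close>, where \<open>V\<close> represents the gradient of \<open>u\<close>.\<close>

definition frequency ::
  "real \<Rightarrow> real \<Rightarrow> real \<Rightarrow> real \<Rightarrow> ((real^'n) \<times> real \<Rightarrow> real)
     \<Rightarrow> ((real^'n) \<times> real \<Rightarrow> (real^'n) \<times> real) \<Rightarrow> real \<Rightarrow> real" where
  "frequency a p lm lp u V r =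
     (D_fun a V r + 2 / p * G_fun a p lm lp u r) / H_fun a u r"

definition L1_loc :: "real set \<Rightarrow> (real \<Rightarrow> real) \<Rightarrow> bool" where
  "L1_loc I f \<longleftrightarrow> (\<forall>K. compact K \<and> K \<subseteq> I \<longrightarrow> set_integrable lborel K f)"

definition W11_loc :: "real set \<Rightarrow> (real \<Rightarrow> real) \<Rightarrow> bool" where
  "W11_loc I f \<longleftrightarrow> L1_loc I f \<and>
     (\<exists>f'. L1_loc I f' \<and>
        (\<forall>\<eta>. test_function I \<eta> \<longrightarrow>
           (LINT r:I|lborel. f r * deriv \<eta> r) = - (LINT r:I|lborel. f' r * \<eta> r)))"

definition distr_deriv_nonneg :: "real set \<Rightarrow> (real \<Rightarrow> real) \<Rightarrow> bool" where
  "distr_deriv_nonneg I f \<longleftrightarrow>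
     (\<forall>\<eta>. test_function I \<eta> \<and> (\<forall>r. 0 \<le> \<eta> r) \<longrightarrow> 0 \<le> - (LINT r:I|lborel. f r * deriv \<eta> r))"

end

theory Submission
  imports Defs
begin

text \<open>Write $u_s(z) = u(s z)$ and let $A(s,t) = \int_{B_1^+} y^a \nabla u_s \cdot \nabla u_t$. Testing the
  weak equation with $u_s$ times cutoffs of the ball gives Green's formula: $A(s,t)$ is the pairing of
  $u_s$ with the flux of $u_t$, that is
  \[ A(s,t) = \int_{S_1^+} y^a u_s \, q_t + t^{1-a} \int_{B_1'} f(u_t) u_s, \qquad q(z) = z \cdot \nabla u(z), \]
  where $f$ is the boundary flux. Here only $u_s$ is differentiated when $s$ varies, and $\partial_s u_s = q_s/s$
  extends continuously to $y = 0$. As $A$ is symmetric, $D(r) = A(r,r)$ has derivative $2\,\partial_1 A(r,r)$,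
  which is the Pohozaev identity, obtained without any second derivative of $u$. The rest is the classical
  argument: with $\Phi = G/p$ one finds $H' = 2I/r$, $I = D + G$ and
  $(D + 2\Phi)' = (2/r)(\int_{S_1^+} y^a q_r^2 + (1-a)\Phi)$, so that the quotient is nondecreasing by the
  Cauchy-Schwarz inequality, $p \ge 2$ and $a < 1$. No unique continuation is needed: either $H$ has no zero, or
  it vanishes identically near 0 and the quotient is 0 (division by 0).\<close>

subsection \<open>Smooth functions and cutoffs\<close>

text \<open>All regularity enters through one function: the Hoelder hypotheses make z . grad u = x .
  grad_x u + y^(1-a) (y^a d_y u) continuous up to y = 0, although d_y u itself may blow up there.
  Three gaps separate this from the Sobolev formulation. The gradient V is only an L^2 limit of
  smooth gradients, so differentiability of u along rays is obtained by averaging over a ball of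
  rays. The equation speaks of L^2 traces while G uses the values u(x,0); the two are matched by
  averaging over thin layers above the flat boundary. And test functions must vanish near the
  sphere: cutoffs that depend on |z|^2 have a radial gradient, so in the limit they leave exactly a
  surface term with z . grad u. The boundary integrals are pulled back to two fixed finite measures,
  the weighted unit half sphere and the flat unit disc. Radii then occur only as parameters of the
  integrand, and one lemma on differentiation under the integral covers H, the potential and the
  first variable of A.\<close>

lemma GDERIV_unique: "GDERIV f z :> D \<Longrightarrow> GDERIV f z :> D' \<Longrightarrow> D = D'"
proof -
  assume "GDERIV f z :> D" "GDERIV f z :> D'"
  then have "(\<lambda>h. h \<bullet> D) = (\<lambda>h. h \<bullet> D')"
    unfolding gderiv_def by (rule has_derivative_unique)
  then have "(D - D') \<bullet> D = (D - D') \<bullet> D'" by meson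
  then show "D = D'" by (metis inner_diff_right inner_eq_zero_iff right_minus_eq)
qed

lemma grad_eqI: "GDERIV f z :> D \<Longrightarrow> grad f z = D"
  unfolding grad_def by (blast intro: the_equality GDERIV_unique)

text \<open>The Riesz representative of the derivative is written out in coordinates; its existence
  makes the definite description in \<open>grad\<close> denote the actual gradient.\<close>

lemma GDERIV_grad:
  fixes f :: "'a::euclidean_space \<Rightarrow> real"
  assumes "f differentiable (at z)" shows "GDERIV f z :> grad f z"
proof -
  obtain f' where f': "(f has_derivative f') (at z)"
    using assms by (auto simp: differentiable_def)
  then interpret f': bounded_linear f' by (rule has_derivative_bounded_linear)
  have "f' h = h \<bullet> (\<Sum>b\<in>Basis. f' b *\<^sub>R b)" for h
  proof -
    have "f' h = f' (\<Sum>b\<in>Basis. (h \<bullet> b) *\<^sub>R b)" by (simp add: euclidean_representation)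
    also have "\<dots> = (\<Sum>b\<in>Basis. (h \<bullet> b) * f' b)" by (simp add: f'.sum f'.scaleR)
    finally show ?thesis by (simp add: inner_sum_right mult.commute)
  qed
  then have "f' = (\<lambda>h. h \<bullet> (\<Sum>b\<in>Basis. f' b *\<^sub>R b))" by blast
  with f' have "GDERIV f z :> (\<Sum>b\<in>Basis. f' b *\<^sub>R b)" by (simp add: gderiv_def)
  then show ?thesis using grad_eqI by metis
qed

lemma GDERIV_imp_differentiable: "GDERIV f z :> D \<Longrightarrow> f differentiable (at z)"
  unfolding gderiv_def differentiable_def by blast

text \<open>An explicit gradient field \<open>D\<close> takes the place of \<open>grad f\<close>, so
  that each closure property of \<open>Ck\<close> reduces to the corresponding differentiation
  formula.\<close>

lemma Ck_SucI:
  fixes f :: "'a::euclidean_space \<Rightarrow> real"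
  assumes "\<And>z. GDERIV f z :> D z" and "\<And>b. b \<in> Basis \<Longrightarrow> Ck k (\<lambda>z. D z \<bullet> b)"
  shows "Ck (Suc k) f"
proof -
  have "grad f = D" using assms(1) grad_eqI by blast
  moreover have "f differentiable_on UNIV"
    using assms(1) GDERIV_imp_differentiable by (auto simp: differentiable_on_def)
  ultimately show ?thesis using assms(2) by simp
qed

lemma Ck_SucD:
  assumes "Ck (Suc k) f"
  shows "GDERIV f z :> grad f z" and "b \<in> Basis \<Longrightarrow> Ck k (\<lambda>z. grad f z \<bullet> b)"
  using assms by (auto simp: differentiable_on_def intro: GDERIV_grad)

lemma Ck_decreasing: "Ck (Suc k) f \<Longrightarrow> Ck k f"
proof (induction k arbitrary: f)
  case 0 then show ?case by (auto intro: differentiable_imp_continuous_on)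
next
  case (Suc k) then show ?case by (metis Ck.simps(2))
qed

lemma Ck_const: "Ck k (\<lambda>z. c)"
proof (induction k arbitrary: c)
  case (Suc k) show ?case by (rule Ck_SucI[OF GDERIV_const]) (simp add: Suc)
qed simp

lemma Ck_add: "Ck k f \<Longrightarrow> Ck k g \<Longrightarrow> Ck k (\<lambda>z. f z + g z)"
proof (induction k arbitrary: f g)
  case 0 then show ?case by (auto intro: continuous_intros)
next
  case (Suc k) show ?case
    by (rule Ck_SucI[OF GDERIV_add[OF Ck_SucD(1)[OF Suc(2)] Ck_SucD(1)[OF Suc(3)]]])
       (simp add: inner_add_left Suc.IH Ck_SucD(2)[OF Suc(2)] Ck_SucD(2)[OF Suc(3)])
qed

lemma Ck_mult: "Ck k f \<Longrightarrow> Ck k g \<Longrightarrow> Ck k (\<lambda>z. f z * g z)"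
proof (induction k arbitrary: f g)
  case 0 then show ?case by (auto intro: continuous_intros)
next
  case (Suc k) show ?case
    by (rule Ck_SucI[OF GDERIV_mult[OF Ck_SucD(1)[OF Suc(2)] Ck_SucD(1)[OF Suc(3)]]])
       (simp add: inner_add_left Suc.IH Ck_add Ck_SucD(2)[OF Suc(2)] Ck_SucD(2)[OF Suc(3)]
         Ck_decreasing[OF Suc(2)] Ck_decreasing[OF Suc(3)])
qed

lemma Ck_minus: "Ck k f \<Longrightarrow> Ck k (\<lambda>z. - f z)"
  using Ck_mult[OF Ck_const[of k "-1"]] by simp

text \<open>The gradient of 1/f is -(1/f)^2 grad f. It contains 1/f again, but only to order k,
  which the induction hypothesis supplies.\<close>

lemma Ck_inverse: "Ck k f \<Longrightarrow> (\<And>z. f z \<noteq> 0) \<Longrightarrow> Ck k (\<lambda>z. inverse (f z))"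
proof (induction k arbitrary: f)
  case 0 then show ?case by (auto intro: continuous_intros)
next
  case (Suc k)
  have "Ck k (\<lambda>z. inverse (f z))"
    by (rule Suc.IH[OF Ck_decreasing[OF Suc.prems(1)] Suc.prems(2)])
  then show ?case
    by (intro Ck_SucI[OF GDERIV_inverse[OF Ck_SucD(1)[OF Suc.prems(1)] Suc.prems(2)]])
       (simp only: inner_scaleR_left inner_minus_left scaleR_minus_left power2_eq_square,
        intro Ck_minus Ck_mult Ck_SucD(2)[OF Suc.prems(1)])
qed

text \<open>The induction varies the outer function only: in the chain rule the factor
  \<open>grad h (P z)\<close> has the same form with \<open>grad h\<close> in place of
  \<open>h\<close>, while \<open>P\<close> stays fixed.\<close>

lemma Ck_compose:
  fixes h :: "real \<Rightarrow> real" and P :: "'a::euclidean_space \<Rightarrow> real"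
  shows "Ck k h \<Longrightarrow> Ck k P \<Longrightarrow> Ck k (\<lambda>z. h (P z))"
proof (induction k arbitrary: h)
  case 0
  then show ?case by (auto intro: continuous_on_compose2)
next
  case (Suc k)
  have h: "DERIV h x :> grad h x" for x
    using Ck_SucD(1)[OF Suc(2)] by simp
  have "Ck k (\<lambda>x. grad h x)" using Ck_SucD(2)[OF Suc(2), of 1] by simp
  then have "Ck k (\<lambda>z. grad h (P z))" by (rule Suc.IH[OF _ Ck_decreasing[OF Suc(3)]])
  then show ?case
    by (intro Ck_SucI[OF GDERIV_DERIV_compose[OF Ck_SucD(1)[OF Suc(3)] h]])
       (simp add: Ck_mult Ck_SucD(2)[OF Suc(3)])
qed

lemma Ck_inner: "Ck k (\<lambda>z. z \<bullet> c)"
proof (cases k)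
  case (Suc j)
  have "GDERIV (\<lambda>z. z \<bullet> c) z :> c" for z unfolding gderiv_def by (auto intro!: derivative_eq_intros)
  then show ?thesis unfolding Suc by (rule Ck_SucI) (rule Ck_const)
qed (auto intro: continuous_intros)

lemma Ck_inner_self: "Ck k (\<lambda>z. z \<bullet> z)"
proof (cases k)
  case (Suc j)
  have "GDERIV (\<lambda>z. z \<bullet> z) z :> 2 *\<^sub>R z" for z :: 'a unfolding gderiv_def
    by (rule has_derivative_eq_rhs, (rule derivative_intros)+) (auto simp: inner_commute)
  then show ?thesis unfolding Suc by (rule Ck_SucI) (auto intro: Ck_mult Ck_const Ck_inner)
qed (auto intro: continuous_intros)

lemma GDERIV_dilation:
  fixes f :: "'a::real_inner \<Rightarrow> real"
  assumes "GDERIV f (c *\<^sub>R z) :> D" shows "GDERIV (\<lambda>z. f (c *\<^sub>R z)) z :> c *\<^sub>R D"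
proof -
  have "((\<lambda>z. f (c *\<^sub>R z)) has_derivative (\<lambda>h. (c *\<^sub>R h) \<bullet> D)) (at z)"
    using assms unfolding gderiv_def
    by (intro has_derivative_compose[where f="\<lambda>z. c *\<^sub>R z" and g=f]) (auto intro!: derivative_eq_intros)
  then show ?thesis by (simp add: gderiv_def)
qed

lemma Ck_dilation: "Ck k f \<Longrightarrow> Ck k (\<lambda>z. f (c *\<^sub>R z))"
proof (induction k arbitrary: f)
  case 0 then show ?case by (auto intro!: continuous_intros continuous_on_compose2[of UNIV f])
next
  case (Suc k)
  show ?case by (rule Ck_SucI[OF GDERIV_dilation[OF Ck_SucD(1)[OF Suc(2)]]])
    (use Ck_mult[OF Ck_const Suc.IH[OF Ck_SucD(2)[OF Suc(2)]]] in simp)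
qed

lemma smoothD:
  assumes "smooth f"
  shows "continuous_on UNIV f" and "GDERIV f z :> grad f z" and "continuous_on UNIV (grad f)"
proof -
  show "continuous_on UNIV f" using assms Ck.simps(1) smooth_def by blast
  have 1: "Ck (Suc 0) f" using assms unfolding smooth_def by blast
  from Ck_SucD(1)[OF this] show "GDERIV f z :> grad f z" .
  have "\<And>b. b \<in> Basis \<Longrightarrow> continuous_on UNIV (\<lambda>z. grad f z \<bullet> b)"
    using Ck_SucD(2)[OF 1] by simp
  then show "continuous_on UNIV (grad f)" using continuous_on_componentwise by blast
qed

lemma grad_mult: "smooth f \<Longrightarrow> smooth g \<Longrightarrow>
    grad (\<lambda>z. f z * g z) z = f z *\<^sub>R grad g z + g z *\<^sub>R grad f z"
  by (intro grad_eqI GDERIV_mult smoothD)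

lemma grad_dilation: "smooth f \<Longrightarrow> grad (\<lambda>z. f (c *\<^sub>R z)) z = c *\<^sub>R grad f (c *\<^sub>R z)"
  by (intro grad_eqI GDERIV_dilation smoothD)

lemma smooth_mult: "smooth f \<Longrightarrow> smooth g \<Longrightarrow> smooth (\<lambda>z. f z * g z)"
  by (simp add: smooth_def Ck_mult)

lemma smooth_dilation: "smooth f \<Longrightarrow> smooth (\<lambda>z. f (c *\<^sub>R z))"
  by (simp add: smooth_def Ck_dilation)

text \<open>The functions \<open>p (1/t) exp (-1/t)\<close>, extended by 0, are closed under differentiation.\<close>

definition flat_exp :: "real poly \<Rightarrow> real \<Rightarrow> real" where
  "flat_exp p t = (if t \<le> 0 then 0 else poly p (inverse t) * exp (- inverse t))"

lemma flat_exp_tendsto_0: "((\<lambda>t. poly p (inverse t) * exp (- inverse t)) \<longlongrightarrow> (0::real)) (at_right 0)"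
proof -
  have "((\<lambda>x. poly p x * exp (- x)) \<longlongrightarrow> 0) at_top"
  proof -
    have "((\<lambda>x. \<Sum>i\<le>degree p. coeff p i * (x ^ i / exp x)) \<longlongrightarrow> (\<Sum>i\<le>degree p. coeff p i * 0)) at_top"
      by (intro tendsto_intros tendsto_power_div_exp_0)
    then show ?thesis
      by (simp add: poly_altdef sum_distrib_right exp_minus divide_inverse mult.assoc)
  qed
  from filterlim_compose[OF this filterlim_inverse_at_top_right] show ?thesis .
qed

text \<open>With x = 1/t, the derivative of p(x) exp(-x) in t is x^2 (p(x) - p'(x)) exp(-x), again a
  polynomial in 1/t times the exponential. Only the gluing point t = 0 needs a limit.\<close>

lemma flat_exp_deriv:
  "(flat_exp p has_real_derivative flat_exp (monom 1 2 * (p - pderiv p)) t) (at t)"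
proof -
  consider "t < 0" | "t > 0" | "t = 0" by linarith
  then show ?thesis
  proof cases
    case 1
    have "((\<lambda>t. 0) has_real_derivative 0) (at t)" by simp
    then have "(flat_exp p has_real_derivative 0) (at t)"
      by (rule has_field_derivative_transform_within_open[where S="{..<0}"])
         (use 1 in \<open>auto simp: flat_exp_def\<close>)
    with 1 show ?thesis by (simp add: flat_exp_def)
  next
    case 2
    have "((\<lambda>t. poly p (inverse t) * exp (- inverse t)) has_real_derivative
        flat_exp (monom 1 2 * (p - pderiv p)) t) (at t)"
      using 2 by (auto intro!: derivative_eq_intros simp: flat_exp_def poly_monom
        power2_eq_square algebra_simps)
    then show ?thesis
      by (rule has_field_derivative_transform_within_open[where S="{0<..}"])
         (use 2 in \<open>auto simp: flat_exp_def\<close>)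
  next
    case 3
    have "((\<lambda>t. (flat_exp p t - flat_exp p 0) / (t - 0)) \<longlongrightarrow> 0) (at 0)"
    proof (rule filterlim_split_at)
      show "((\<lambda>t. (flat_exp p t - flat_exp p 0) / (t - 0)) \<longlongrightarrow> 0) (at_left 0)"
        by (rule tendsto_eventually) (auto simp: eventually_at_filter flat_exp_def)
      \<comment> \<open>The difference quotient at 0 from the right is x p(x) exp(-x) with x = 1/t,
        so it is covered by the same limit with the polynomial x p(x).\<close>
      have "((\<lambda>t. poly (monom 1 1 * p) (inverse t) * exp (- inverse t)) \<longlongrightarrow> 0) (at_right 0)"
        by (rule flat_exp_tendsto_0)
      then show "((\<lambda>t. (flat_exp p t - flat_exp p 0) / (t - 0)) \<longlongrightarrow> 0) (at_right 0)"
        by (rule Lim_transform_eventually)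
           (auto simp: eventually_at_filter flat_exp_def poly_monom field_simps)
    qed
    then show ?thesis using 3 by (simp add: has_field_derivative_iff flat_exp_def)
  qed
qed

lemma Ck_flat_exp: "Ck k (flat_exp p)"
proof (induction k arbitrary: p)
  case 0
  show ?case using DERIV_continuous_on[OF DERIV_subset[OF flat_exp_deriv subset_UNIV]] by simp
next
  case (Suc k)
  show ?case by (rule Ck_SucI[OF flat_exp_deriv[folded gderiv_deriv]]) (simp add: Suc)
qed

text \<open>The standard smooth transition from 0 to 1 on [0,1]: the two summands of the denominator
  are never zero together, and for t at least 1 the second one vanishes.\<close>

definition smooth_step :: "real \<Rightarrow> real" where
  "smooth_step t = flat_exp 1 t * inverse (flat_exp 1 t + flat_exp 1 (1 - t))"

lemma flat_exp_one: "flat_exp 1 t \<ge> 0" "t > 0 \<Longrightarrow> flat_exp 1 t > 0" "t \<le> 0 \<Longrightarrow> flat_exp 1 t = 0"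
  by (auto simp: flat_exp_def)

lemma flat_exp_one_mono: "s \<le> t \<Longrightarrow> flat_exp 1 s \<le> flat_exp 1 t"
  by (auto simp: flat_exp_def)

lemma smooth_step_denominator: "flat_exp 1 t + flat_exp 1 (1 - t) > 0"
  using flat_exp_one[of t] flat_exp_one[of "1 - t"] by (cases "t > 0") (auto intro: add_pos_nonneg)

lemma smooth_step_0: "t \<le> 0 \<Longrightarrow> smooth_step t = 0"
  by (simp add: smooth_step_def flat_exp_one)

lemma smooth_step_1: "1 \<le> t \<Longrightarrow> smooth_step t = 1"
  by (simp add: smooth_step_def flat_exp_one less_imp_neq[OF flat_exp_one(2), symmetric])

lemma smooth_step_nonneg: "0 \<le> smooth_step t"
  using smooth_step_denominator[of t] by (simp add: smooth_step_def flat_exp_one)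

text \<open>After cross-multiplication the product of the values at s and t appears on both sides
  and cancels. What remains compares two products of values of the increasing function
  \<open>flat_exp 1\<close>, one of them reflected.\<close>

lemma smooth_step_mono: "s \<le> t \<Longrightarrow> smooth_step s \<le> smooth_step t"
proof -
  assume st: "s \<le> t"
  have "flat_exp 1 s * flat_exp 1 (1 - t) \<le> flat_exp 1 t * flat_exp 1 (1 - s)"
    using st by (intro mult_mono flat_exp_one_mono flat_exp_one) auto
  then show ?thesis
    using smooth_step_denominator[of s] smooth_step_denominator[of t]
    unfolding smooth_step_def divide_inverse[symmetric]
    by (simp add: pos_le_divide_eq pos_divide_le_eq times_divide_eq_left algebra_simps)
qed

lemma smooth_step_le_1: "smooth_step t \<le> 1"
  using smooth_step_mono[of t "max t 1"] by (simp add: smooth_step_1)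

lemma Ck_smooth_step: "Ck k smooth_step"
proof -
  have "Ck k (\<lambda>t::real. 1 + (-1) * (t \<bullet> 1))"
    by (intro Ck_add Ck_const Ck_mult Ck_inner)
  from Ck_compose[OF Ck_flat_exp this, of 1] have "Ck k (\<lambda>t. flat_exp 1 (1 - t))" by simp
  then show ?thesis unfolding smooth_step_def[abs_def]
    using less_imp_neq[OF smooth_step_denominator, symmetric]
    by (intro Ck_mult Ck_inverse Ck_add Ck_flat_exp)
qed

text \<open>The squared norm keeps the function smooth at the origin. It is 1 where |z|^2 is at most
  t^2 - \<epsilon> and 0 outside the ball of radius t.\<close>

definition cutoff :: "real \<Rightarrow> real \<Rightarrow> 'a::euclidean_space \<Rightarrow> real" where
  "cutoff t \<epsilon> z = smooth_step ((t\<^sup>2 - z \<bullet> z) / \<epsilon>)"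

lemma smooth_cutoff: "smooth (cutoff t \<epsilon>)"
proof -
  have "Ck k (\<lambda>z::'a. t\<^sup>2 * inverse \<epsilon> + (- inverse \<epsilon>) * (z \<bullet> z))" for k
    by (intro Ck_add Ck_const Ck_mult Ck_inner_self)
  from Ck_compose[OF Ck_smooth_step this] show ?thesis
    unfolding smooth_def cutoff_def[abs_def]
    by (simp add: divide_inverse algebra_simps)
qed

lemma smooth_step_deriv: "(smooth_step has_real_derivative deriv smooth_step x) (at x)"
  using Ck_SucD(1)[OF Ck_smooth_step[of "Suc 0"], of x] by (simp add: DERIV_imp_deriv)

lemma continuous_on_deriv_smooth_step: "continuous_on S (deriv smooth_step)"
proof -
  have "grad smooth_step = deriv smooth_step"
    using smooth_step_deriv grad_eqI gderiv_deriv by (metis ext)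
  moreover have "continuous_on UNIV (grad smooth_step)"
    using smoothD(3)[of smooth_step] Ck_smooth_step by (simp add: smooth_def)
  ultimately show ?thesis by (metis continuous_on_subset subset_UNIV)
qed

text \<open>The gradient is a multiple of z. This is why testing with a cutoff sees the gradient of
  the solution only through its inner product with z.\<close>

lemma grad_cutoff:
  assumes "\<epsilon> > 0"
  shows "grad (cutoff t \<epsilon>) z = (- (2 / \<epsilon>) * deriv smooth_step ((t\<^sup>2 - z \<bullet> z) / \<epsilon>)) *\<^sub>R z"
proof -
  have "GDERIV (\<lambda>z. (t\<^sup>2 - z \<bullet> z) / \<epsilon>) z :> (- (2 / \<epsilon>)) *\<^sub>R z" unfolding gderiv_def
    by (rule has_derivative_eq_rhs, (rule derivative_intros)+) (use assms in \<open>auto simp: inner_commute field_simps\<close>)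
  from grad_eqI[OF GDERIV_DERIV_compose[OF this smooth_step_deriv]] show ?thesis
    unfolding cutoff_def[abs_def] by (simp add: mult.commute)
qed

subsection \<open>Polar coordinates on the half space\<close>

lemma nn_integral_lborel_scale:
  fixes f :: "'a::euclidean_space \<Rightarrow> ennreal"
  assumes [measurable]: "f \<in> borel_measurable borel" and c: "c > 0"
  shows "(\<integral>\<^sup>+x. f x \<partial>lborel) = ennreal (c ^ DIM('a)) * (\<integral>\<^sup>+x. f (c *\<^sub>R x) \<partial>lborel)"
  using c by (subst lborel_affine[of c 0])
    (simp_all add: nn_integral_density nn_integral_distr nn_integral_cmult)

lemma lborel_integral_scale:
  fixes f :: "'a::euclidean_space \<Rightarrow> real"
  assumes c: "c > 0"
  shows "(LINT x|lborel. f (c *\<^sub>R x)) = inverse (c ^ DIM('a)) * (LINT x|lborel. f x)"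
proof -
  have inv: "lborel = density (distr lborel borel (\<lambda>x::'a. 0 + c *\<^sub>R x)) (\<lambda>_. \<bar>c\<bar> ^ DIM('a))"
    by (rule lborel_affine) (use c in simp)
  show ?thesis
  proof (cases "f \<in> borel_measurable borel")
    case [measurable]: True
    show ?thesis using c by (subst (2) inv) (simp add: integral_density integral_distr)
  next
    \<comment> \<open>If f is not measurable then neither is its dilate, since a dilation can be
      undone. Both integrals then have the default value 0.\<close>
    case False
    have "(\<lambda>x. f (c *\<^sub>R x)) \<notin> borel_measurable borel"
    proof
      assume "(\<lambda>x. f (c *\<^sub>R x)) \<in> borel_measurable borel"
      then have "(\<lambda>x. f (c *\<^sub>R (inverse c *\<^sub>R x))) \<in> borel_measurable borel" by measurable
      with c False show False by simp
    qed
    then have "\<not> integrable lborel (\<lambda>x. f (c *\<^sub>R x))" "\<not> integrable lborel f"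
      using False borel_measurable_integrable by auto
    then show ?thesis by (simp add: not_integrable_integral_eq)
  qed
qed

text \<open>Substitution y = sqrt(s^2 - c^2). The Jacobian s / y is singular at s = c and the domain
  is unbounded, so the substitution is made on compact intervals [1/(k+1), k+1] in y and passed to
  the limit by continuity of measures from below.\<close>

lemma nn_integral_sqrt_substitution:
  fixes f :: "real \<Rightarrow> ennreal"
  assumes [measurable]: "f \<in> borel_measurable borel" and c: "c \<ge> 0"
  shows "(\<integral>\<^sup>+y. f y * indicator {0<..} y \<partial>lborel)
       = (\<integral>\<^sup>+s. f (sqrt (s\<^sup>2 - c\<^sup>2)) * ennreal (s / sqrt (s\<^sup>2 - c\<^sup>2)) * indicator {c<..} s \<partial>lborel)"
proof -
  define l where "l k = inverse (real (Suc k))" for k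
  define u where "u k = real (Suc k)" for k
  define L where "L k = sqrt (c\<^sup>2 + (l k)\<^sup>2)" for k
  define U where "U k = sqrt (c\<^sup>2 + (u k)\<^sup>2)" for k
  define g where "g s = sqrt (s\<^sup>2 - c\<^sup>2)" for s
  define h where "h s = f (g s) * ennreal (s / g s)" for s
  have l: "l k > 0" "l k \<le> u k" for k
    by (simp_all add: l_def u_def field_simps)
  have Lc: "c < L k" for k
    unfolding L_def by (rule real_less_rsqrt) (use l[of k] in simp)
  have LU: "L k \<le> U k" for k
    unfolding L_def U_def using l[of k] by (simp add: power_mono)
  have gL: "g (L k) = l k" "g (U k) = u k" for k
    using l[of k] by (simp_all add: g_def L_def U_def)
  have gpos: "g s > 0" if "s > c" for s
    using that c unfolding g_def by (simp add: power_strict_mono)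
  have [measurable]: "h \<in> borel_measurable borel" unfolding h_def g_def by measurable
  have step: "(\<integral>\<^sup>+y. f y * indicator {l k..u k} y \<partial>lborel) = (\<integral>\<^sup>+s. h s * indicator {L k..U k} s \<partial>lborel)" for k
  proof (cases "k = 0")
    \<comment> \<open>For k = 0 both intervals shrink to a point and both integrals vanish; the
      substitution rule is applied to nondegenerate intervals only.\<close>
    case True
    then have "l k = 1" "u k = 1" "L k = U k" by (simp_all add: l_def u_def L_def U_def)
    then show ?thesis
      by (simp add: nn_integral_null_delta[of "{1::real}" lborel] nn_integral_null_set)
  next
    case False
    have "1 < u k" using False by (simp add: u_def)
    then have "l k < u k" unfolding l_def u_def[symmetric] by (metis inverse_less_1_iff less_trans)
    then have "L k < U k" unfolding L_def U_def using l[of k] by (simp add: power_strict_mono)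
    then show ?thesis unfolding gL[symmetric] h_def
    proof (rule nn_integral_substitution_aux[rotated -1])
      fix x assume "x \<in> {L k..U k}"
      then have x: "x > c" using Lc[of k] by auto
      show "(g has_real_derivative x / g x) (at x)"
        using gpos[OF x] unfolding g_def by (auto intro!: derivative_eq_intros simp: field_simps)
      show "0 \<le> x / g x" using gpos[OF x] x c by simp
    next
      have "\<forall>x\<in>{L k..U k}. g x \<noteq> 0" using gpos Lc[of k] by (metis atLeastAtMost_iff less_irrefl less_le_trans)
      then show "continuous_on {L k..U k} (\<lambda>x. x / g x)"
        unfolding g_def by (intro continuous_intros) auto
    qed auto
  qed
  have Un1: "(\<Union>k. {l k..u k}) = {0<..}"
  proof safe
    fix y :: real assume "y > 0"
    obtain k where k: "max y (inverse y) < real k" using reals_Archimedean2 by blast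
    then have "inverse y < real (Suc k)" by simp
    then have "inverse (real (Suc k)) < y" using \<open>y > 0\<close>
      by (metis inverse_inverse_eq inverse_less_imp_less inverse_positive_iff_positive less_imp_inverse_less)
    with k show "y \<in> (\<Union>k. {l k..u k})" by (auto simp: l_def u_def intro!: exI[of _ k])
  next
    fix y k assume "y \<in> {l k..u k}" then show "0 < y" using l[of k] by auto
  qed
  have Un2: "(\<Union>k. {L k..U k}) = {c<..}"
  proof safe
    fix s assume s: "c < s"
    then obtain k where "g s \<in> {l k..u k}" using gpos[OF s] Un1 by blast
    then have "(l k)\<^sup>2 \<le> (g s)\<^sup>2" "(g s)\<^sup>2 \<le> (u k)\<^sup>2" using l[of k] by (auto intro: power_mono)
    moreover have "(g s)\<^sup>2 = s\<^sup>2 - c\<^sup>2" using s c by (simp add: g_def power_mono)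
    ultimately have "L k \<le> s" "s \<le> U k" using s c unfolding L_def U_def
      by (auto intro: real_le_lsqrt real_le_rsqrt)
    then show "s \<in> (\<Union>k. {L k..U k})" by auto
  next
    fix y k assume "y \<in> {L k..U k}" then show "c < y" using Lc[of k] by auto
  qed
  have lm: "l (Suc k) \<le> l k" "u k \<le> u (Suc k)" for k by (simp_all add: l_def u_def field_simps)
  have inc1: "incseq (\<lambda>k. {l k..u k})"
    using lm by (intro incseq_SucI) auto
  have "L (Suc k) \<le> L k" "U k \<le> U (Suc k)" for k
    unfolding L_def U_def using lm[of k] l[of "Suc k"] l[of k] by (simp_all add: power_mono)
  then have inc2: "incseq (\<lambda>k. {L k..U k})"
    by (intro incseq_SucI) auto
  have "(\<integral>\<^sup>+y. f y * indicator {0<..} y \<partial>lborel) = emeasure (density lborel f) {0<..}"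
    by (simp add: emeasure_density)
  also have "\<dots> = (SUP k. emeasure (density lborel f) {l k..u k})"
    unfolding Un1[symmetric] by (rule SUP_emeasure_incseq[symmetric]) (use inc1 in auto)
  also have "\<dots> = (SUP k. emeasure (density lborel h) {L k..U k})"
    using step by (simp add: emeasure_density)
  also have "\<dots> = emeasure (density lborel h) {c<..}"
    unfolding Un2[symmetric] by (rule SUP_emeasure_incseq) (use inc2 in auto)
  also have "\<dots> = (\<integral>\<^sup>+s. h s * indicator {c<..} s \<partial>lborel)" by (simp add: emeasure_density)
  finally show ?thesis unfolding h_def g_def .
qed

text \<open>This identifies the area density of the graph with the Jacobian of the substitution y =
  sqrt(s^2 - |x|^2), which is what turns Tonelli's theorem into polar coordinates.\<close>

lemma half_sphere_density:
  assumes "r > 0" "x \<in> ball 0 r"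
  shows "sqrt (1 + (norm x)\<^sup>2 / (r\<^sup>2 - (norm x)\<^sup>2)) = r / sqrt (r\<^sup>2 - (norm x)\<^sup>2)"
proof -
  have "(norm x)\<^sup>2 < r\<^sup>2" using assms by (simp add: power_strict_mono)
  then have "1 + (norm x)\<^sup>2 / (r\<^sup>2 - (norm x)\<^sup>2) = r\<^sup>2 / (r\<^sup>2 - (norm x)\<^sup>2)"
    by (simp add: field_simps)
  then show ?thesis using assms by (simp add: real_sqrt_divide)
qed

lemma borel_measurable_half_sphere_graph:
  "(\<lambda>x::real^'n. (x, sqrt (r\<^sup>2 - (norm x)\<^sup>2))) \<in> borel \<rightarrow>\<^sub>M borel"
  by (intro borel_measurable_Pair) measurable

lemma nn_integral_half_sphere:
  fixes f :: "(real^'n) \<times> real \<Rightarrow> ennreal"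
  assumes [measurable]: "f \<in> borel_measurable borel" and r: "r > 0"
  shows "(\<integral>\<^sup>+z. f z \<partial>half_sphere_measure r)
     = (\<integral>\<^sup>+x. indicator (ball 0 r) x * ennreal (r / sqrt (r\<^sup>2 - (norm x)\<^sup>2)) * f (x, sqrt (r\<^sup>2 - (norm x)\<^sup>2)) \<partial>lborel)"
proof -
  note [measurable] = borel_measurable_half_sphere_graph[of r]
    measurable_compose[OF borel_measurable_half_sphere_graph assms(1)]
  have [measurable]: "(indicator (ball 0 r) :: real^'n \<Rightarrow> ennreal) \<in> borel_measurable borel"
    by (intro borel_measurable_indicator borel_open open_ball)
  have "(\<integral>\<^sup>+z. f z \<partial>half_sphere_measure r) = (\<integral>\<^sup>+x. indicator (ball 0 r) x *
      ennreal (sqrt (1 + (norm x)\<^sup>2 / (r\<^sup>2 - (norm x)\<^sup>2))) * f (x, sqrt (r\<^sup>2 - (norm x)\<^sup>2)) \<partial>lborel)"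
    unfolding half_sphere_measure_def
    by (subst nn_integral_distr) (simp_all add: nn_integral_density)
  also have "\<dots> = (\<integral>\<^sup>+x. indicator (ball 0 r) x * ennreal (r / sqrt (r\<^sup>2 - (norm x)\<^sup>2)) *
      f (x, sqrt (r\<^sup>2 - (norm x)\<^sup>2)) \<partial>lborel)"
  proof (rule nn_integral_cong)
    fix x :: "real^'n"
    show "indicator (ball 0 r) x * ennreal (sqrt (1 + (norm x)\<^sup>2 / (r\<^sup>2 - (norm x)\<^sup>2))) *
        f (x, sqrt (r\<^sup>2 - (norm x)\<^sup>2)) =
      indicator (ball 0 r) x * ennreal (r / sqrt (r\<^sup>2 - (norm x)\<^sup>2)) * f (x, sqrt (r\<^sup>2 - (norm x)\<^sup>2))"
      using half_sphere_density[OF r, of x] by (cases "x \<in> ball 0 r") simp_all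
  qed
  finally show ?thesis .
qed

lemma sets_half_sphere_measure[measurable_cong]: "sets (half_sphere_measure r) = sets borel"
  by (simp add: half_sphere_measure_def)

lemma space_half_sphere_measure[simp]: "space (half_sphere_measure r) = UNIV"
  by (simp add: half_sphere_measure_def)

text \<open>In the chart over the flat ball the density r / sqrt(r^2 - |x|^2) is invariant under x =
  r x', so only Lebesgue measure on the base contributes, with the factor r^N.\<close>

lemma half_sphere_measure_scale:
  assumes r: "r > 0"
  shows "(half_sphere_measure r :: ((real^'n) \<times> real) measure)
     = density (distr (half_sphere_measure 1) borel (\<lambda>z. r *\<^sub>R z)) (\<lambda>_. ennreal (r ^ CARD('n)))"
    (is "?L = ?R")
proof (rule measure_eqI)
  show "sets ?L = sets ?R" by (simp add: sets_half_sphere_measure)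
  fix A :: "((real^'n) \<times> real) set" assume "A \<in> sets ?L"
  then have [measurable]: "A \<in> sets borel" by (simp add: sets_half_sphere_measure)
  have ind: "(indicator (ball 0 r) :: real^'n \<Rightarrow> ennreal) \<in> borel_measurable borel"
    by (intro borel_measurable_indicator borel_open open_ball)
  have mA: "(\<lambda>x::real^'n. indicator (ball 0 r) x * ennreal (r / sqrt (r\<^sup>2 - (norm x)\<^sup>2)) *
         indicator A (x, sqrt (r\<^sup>2 - (norm x)\<^sup>2))) \<in> borel_measurable borel"
    by (intro borel_measurable_times_ennreal ind
          measurable_compose[OF borel_measurable_half_sphere_graph borel_measurable_indicator]
          measurable_compose[OF _ measurable_ennreal]) measurable
  have "emeasure ?L A = (\<integral>\<^sup>+z. indicator A z \<partial>?L)"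
    by (simp add: sets_half_sphere_measure)
  also have "\<dots> = ennreal (r ^ CARD('n)) * (\<integral>\<^sup>+x. indicator (ball 0 r) (r *\<^sub>R x :: real^'n) *
      ennreal (r / sqrt (r\<^sup>2 - (norm (r *\<^sub>R x))\<^sup>2)) *
      indicator A (r *\<^sub>R x, sqrt (r\<^sup>2 - (norm (r *\<^sub>R x))\<^sup>2)) \<partial>lborel)"
    by (subst nn_integral_half_sphere, measurable, rule r,
        subst nn_integral_lborel_scale[OF mA r]) simp
  also have "(\<integral>\<^sup>+x. indicator (ball 0 r) (r *\<^sub>R x :: real^'n) *
      ennreal (r / sqrt (r\<^sup>2 - (norm (r *\<^sub>R x))\<^sup>2)) *
      indicator A (r *\<^sub>R x, sqrt (r\<^sup>2 - (norm (r *\<^sub>R x))\<^sup>2)) \<partial>lborel)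
    = (\<integral>\<^sup>+x. indicator (ball 0 1) (x :: real^'n) * ennreal (1 / sqrt (1\<^sup>2 - (norm x)\<^sup>2)) *
      indicator A (r *\<^sub>R (x, sqrt (1\<^sup>2 - (norm x)\<^sup>2))) \<partial>lborel)"
  proof (rule nn_integral_cong)
    fix x :: "real^'n"
    have "r\<^sup>2 - (norm (r *\<^sub>R x))\<^sup>2 = r\<^sup>2 * (1 - (norm x)\<^sup>2)"
      by (simp add: power_mult_distrib algebra_simps)
    then have "sqrt (r\<^sup>2 - (norm (r *\<^sub>R x))\<^sup>2) = r * sqrt (1\<^sup>2 - (norm x)\<^sup>2)"
      using r by (simp add: real_sqrt_mult)
    then show "indicator (ball 0 r) (r *\<^sub>R x :: real^'n) *
      ennreal (r / sqrt (r\<^sup>2 - (norm (r *\<^sub>R x))\<^sup>2)) *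
      indicator A (r *\<^sub>R x, sqrt (r\<^sup>2 - (norm (r *\<^sub>R x))\<^sup>2))
      = indicator (ball 0 1) (x :: real^'n) * ennreal (1 / sqrt (1\<^sup>2 - (norm x)\<^sup>2)) *
      indicator A (r *\<^sub>R (x, sqrt (1\<^sup>2 - (norm x)\<^sup>2)))"
      using r by (auto simp: scaleR_prod_def split: split_indicator)
  qed
  also have "\<dots> = (\<integral>\<^sup>+z. indicator A (r *\<^sub>R z) \<partial>half_sphere_measure 1)"
    by (subst nn_integral_half_sphere) auto
  also have "ennreal (r ^ CARD('n)) * \<dots> = emeasure ?R A"
  proof -
    have "emeasure ?R A = ennreal (r ^ CARD('n)) * emeasure (distr (half_sphere_measure 1) borel ((*\<^sub>R) r)) A"
      by (simp add: emeasure_density nn_integral_cmult)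
    also have "emeasure (distr (half_sphere_measure 1) borel ((*\<^sub>R) r)) A
      = (\<integral>\<^sup>+z. indicator A z \<partial>distr (half_sphere_measure 1) borel ((*\<^sub>R) r))"
      by simp
    also have "\<dots> = (\<integral>\<^sup>+z. indicator A (r *\<^sub>R z) \<partial>half_sphere_measure 1)"
      by (rule nn_integral_distr) simp_all
    finally show ?thesis by simp
  qed
  finally show "emeasure ?L A = emeasure ?R A" .
qed

text \<open>For fixed x the height y is replaced by the distance s = |(x,y)|. Exchanging the
  integrals, the inner one runs over |x| < s and is the surface integral over the half sphere of
  radius s.\<close>

lemma nn_integral_half_space_polar:
  fixes f :: "(real^'n) \<times> real \<Rightarrow> ennreal"
  assumes [measurable]: "f \<in> borel_measurable borel"
  shows "(\<integral>\<^sup>+z. f z * indicator {z. 0 < snd z} z \<partial>lborel)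
    = (\<integral>\<^sup>+s. indicator {0<..} s * ennreal (s ^ CARD('n)) * (\<integral>\<^sup>+z. f (s *\<^sub>R z) \<partial>half_sphere_measure 1) \<partial>lborel)"
proof -
  have mf: "(\<lambda>z. f z * indicator {z. 0 < snd z} z) \<in> borel_measurable borel"
    by (intro borel_measurable_times_ennreal borel_measurable_indicator assms borel_open open_Collect_less continuous_intros)
  have "(\<integral>\<^sup>+z. f z * indicator {z. 0 < snd z} z \<partial>lborel)
      = (\<integral>\<^sup>+x. \<integral>\<^sup>+y. f (x, y) * indicator {0<..} y \<partial>lborel \<partial>lborel)"
    using lborel.nn_integral_fst[of "\<lambda>z. f z * indicator {z. 0 < snd z} z" "lborel :: (real^'n) measure"] mf
    by (simp add: lborel_prod indicator_def)
  also have "\<dots> = (\<integral>\<^sup>+x. \<integral>\<^sup>+s. f (x, sqrt (s\<^sup>2 - (norm x)\<^sup>2)) * ennreal (s / sqrt (s\<^sup>2 - (norm x)\<^sup>2)) *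
      indicator {norm x<..} s \<partial>lborel \<partial>lborel)"
    by (intro nn_integral_cong nn_integral_sqrt_substitution) auto
  also have "\<dots> = (\<integral>\<^sup>+s. \<integral>\<^sup>+x. f (x, sqrt (s\<^sup>2 - (norm x)\<^sup>2)) * ennreal (s / sqrt (s\<^sup>2 - (norm x)\<^sup>2)) *
      indicator {norm x<..} s \<partial>lborel \<partial>lborel)"
  proof (rule lborel_pair.Fubini'[symmetric])
    have [measurable]: "{p::(real^'n) \<times> real. norm (fst p) < snd p} \<in> sets borel"
      by (intro borel_open open_Collect_less continuous_intros)
    have [measurable]: "(\<lambda>p::(real^'n) \<times> real. (fst p, sqrt ((snd p)\<^sup>2 - (norm (fst p))\<^sup>2))) \<in> borel \<rightarrow>\<^sub>M borel"
      by (intro borel_measurable_Pair borel_measurable_continuous_onI continuous_intros)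
    have [measurable]: "(\<lambda>p::(real^'n) \<times> real. snd p / sqrt ((snd p)\<^sup>2 - (norm (fst p))\<^sup>2)) \<in> borel_measurable borel"
      by (intro borel_measurable_divide borel_measurable_continuous_onI continuous_intros)
    have "(\<lambda>p. f (fst p, sqrt ((snd p)\<^sup>2 - (norm (fst p))\<^sup>2)) * ennreal (snd p / sqrt ((snd p)\<^sup>2 - (norm (fst p))\<^sup>2)) *
      indicator {p. norm (fst p) < snd p} p) \<in> borel_measurable borel"
      by (intro borel_measurable_times_ennreal borel_measurable_indicator measurable_compose[OF _ assms]
          measurable_compose[OF _ measurable_ennreal]) measurable
    then have "(\<lambda>p. f (fst p, sqrt ((snd p)\<^sup>2 - (norm (fst p))\<^sup>2)) * ennreal (snd p / sqrt ((snd p)\<^sup>2 - (norm (fst p))\<^sup>2)) *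
      indicator {p. norm (fst p) < snd p} p) \<in> borel_measurable (lborel \<Otimes>\<^sub>M lborel)"
      by (simp add: lborel_prod)
    also have "(\<lambda>p. f (fst p, sqrt ((snd p)\<^sup>2 - (norm (fst p))\<^sup>2)) * ennreal (snd p / sqrt ((snd p)\<^sup>2 - (norm (fst p))\<^sup>2)) *
      indicator {p. norm (fst p) < snd p} p) = (\<lambda>(x, s). f (x, sqrt (s\<^sup>2 - (norm x)\<^sup>2)) *
      ennreal (s / sqrt (s\<^sup>2 - (norm x)\<^sup>2)) * indicator {norm x<..} s)"
      by (auto simp: fun_eq_iff split: split_indicator)
    finally show "(\<lambda>(x, s). f (x, sqrt (s\<^sup>2 - (norm x)\<^sup>2)) * ennreal (s / sqrt (s\<^sup>2 - (norm x)\<^sup>2)) *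
      indicator {norm x<..} s) \<in> borel_measurable (lborel \<Otimes>\<^sub>M lborel)" .
  qed
  also have "\<dots> = (\<integral>\<^sup>+s. indicator {0<..} s * (\<integral>\<^sup>+z. f z \<partial>half_sphere_measure s) \<partial>lborel)"
  proof (rule nn_integral_cong)
    fix s :: real
    show "(\<integral>\<^sup>+x. f (x, sqrt (s\<^sup>2 - (norm x)\<^sup>2)) * ennreal (s / sqrt (s\<^sup>2 - (norm x)\<^sup>2)) *
      indicator {norm x<..} s \<partial>lborel) = indicator {0<..} s * (\<integral>\<^sup>+z. f z \<partial>half_sphere_measure s)"
    proof (cases "s > 0")
      case True
      have "f (x, sqrt (s\<^sup>2 - (norm x)\<^sup>2)) * ennreal (s / sqrt (s\<^sup>2 - (norm x)\<^sup>2)) * indicator {norm x<..} s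
        = indicator (ball 0 s) x * ennreal (s / sqrt (s\<^sup>2 - (norm x)\<^sup>2)) * f (x, sqrt (s\<^sup>2 - (norm x)\<^sup>2))"
        for x by (cases "norm x < s") (simp_all add: mult.commute)
      with True show ?thesis by (simp add: nn_integral_half_sphere[OF assms True])
    next
      case False
      then have "\<not> norm x < s" for x :: "real^'n" using norm_ge_zero[of x] by linarith
      then show ?thesis using False by simp
    qed
  qed
  also have "\<dots> = (\<integral>\<^sup>+s. indicator {0<..} s * ennreal (s ^ CARD('n)) * (\<integral>\<^sup>+z. f (s *\<^sub>R z) \<partial>half_sphere_measure 1) \<partial>lborel)"
  proof (rule nn_integral_cong)
    fix s :: real
    show "indicator {0<..} s * (\<integral>\<^sup>+z. f z \<partial>half_sphere_measure s) =
      indicator {0<..} s * ennreal (s ^ CARD('n)) * (\<integral>\<^sup>+z. f (s *\<^sub>R z) \<partial>half_sphere_measure 1)"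
    proof (cases "s > 0")
      case True
      have "(\<integral>\<^sup>+z. f z \<partial>half_sphere_measure s) = ennreal (s ^ CARD('n)) * (\<integral>\<^sup>+z. f (s *\<^sub>R z) \<partial>half_sphere_measure 1)"
        by (subst half_sphere_measure_scale[OF True])
           (simp add: nn_integral_density nn_integral_distr nn_integral_cmult)
      then show ?thesis by (simp add: mult.assoc)
    qed simp
  qed
  finally show ?thesis .
qed

section \<open>The weighted surface measure on the unit half sphere\<close>

definition hemisphere :: "real \<Rightarrow> ((real^'n) \<times> real) measure" where
  "hemisphere a = density (half_sphere_measure 1) (\<lambda>z. ennreal (snd z powr a))"

lemma borel_measurable_snd_pair [measurable]:
  "snd \<in> borel_measurable (borel :: ('a::euclidean_space \<times> real) measure)"
  by (intro borel_measurable_continuous_onI continuous_intros)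

lemma sets_hemisphere [measurable_cong, simp]: "sets (hemisphere a) = sets borel"
  by (simp add: hemisphere_def half_sphere_measure_def)

lemma space_hemisphere [simp]: "space (hemisphere a) = UNIV"
  by (simp add: hemisphere_def)

lemma AE_half_sphere_measure:
  assumes r: "r > 0"
  shows "AE z in (half_sphere_measure r :: ((real^'n) \<times> real) measure). norm z = r \<and> 0 < snd z"
proof -
  have 1: "norm (x, sqrt (r\<^sup>2 - (norm x)\<^sup>2)) = r \<and> 0 < sqrt (r\<^sup>2 - (norm x)\<^sup>2)" if "norm x < r" for x :: "real^'n"
  proof -
    have "(norm x)\<^sup>2 < r\<^sup>2" using r that by (simp add: power_strict_mono)
    then have "(sqrt (r\<^sup>2 - (norm x)\<^sup>2))\<^sup>2 = r\<^sup>2 - (norm x)\<^sup>2" "0 < r\<^sup>2 - (norm x)\<^sup>2" by simp_all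
    then show ?thesis using r by (simp only: norm_Pair) simp
  qed
  have meas: "{z :: (real^'n) \<times> real. norm z = r \<and> 0 < snd z} \<in> sets borel"
  proof -
    have "{z :: (real^'n) \<times> real. norm z = r \<and> 0 < snd z} = {z. norm z = r} \<inter> {z. 0 < snd z}" by blast
    then show ?thesis by (simp only:)
        (intro sets.Int borel_open open_Collect_less borel_closed closed_Collect_eq continuous_intros)
  qed
  have [measurable]: "(indicator (ball 0 r) :: real^'n \<Rightarrow> ennreal) \<in> borel_measurable borel"
    by (intro borel_measurable_indicator borel_open open_ball)
  let ?w = "\<lambda>x::real^'n. indicator (ball 0 r) x * ennreal (sqrt (1 + (norm x)\<^sup>2 / (r\<^sup>2 - (norm x)\<^sup>2)))"
  have "AE x in density lborel ?w. norm (x, sqrt (r\<^sup>2 - (norm x)\<^sup>2)) = r \<and> 0 < sqrt (r\<^sup>2 - (norm x)\<^sup>2)"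
    by (subst AE_density, measurable) (rule AE_I2, use 1 in \<open>auto split: split_indicator_asm\<close>)
  moreover have "(AE z in half_sphere_measure r. norm (z :: (real^'n) \<times> real) = r \<and> 0 < snd z) \<longleftrightarrow>
    (AE x in density lborel ?w. norm (x, sqrt (r\<^sup>2 - (norm x)\<^sup>2)) = r \<and> 0 < snd (x, sqrt (r\<^sup>2 - (norm x)\<^sup>2)))"
    unfolding half_sphere_measure_def
  proof (rule AE_distr_iff)
    show "(\<lambda>x::real^'n. (x, sqrt (r\<^sup>2 - (norm x)\<^sup>2))) \<in> density lborel ?w \<rightarrow>\<^sub>M borel"
      using borel_measurable_half_sphere_graph[of r, where 'n='n] unfolding measurable_def by simp
    show "{z \<in> space borel. norm (z :: (real^'n) \<times> real) = r \<and> 0 < snd z} \<in> sets borel"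
      using meas by simp
  qed
  ultimately show ?thesis by (simp only: snd_conv)
qed

lemma AE_hemisphere: "AE z in (hemisphere a :: ((real^'n) \<times> real) measure). norm z = 1 \<and> 0 < snd z"
  unfolding hemisphere_def
  by (subst AE_density) (use AE_half_sphere_measure[of 1] in \<open>auto simp: sets_half_sphere_measure\<close>)

lemma nn_integral_hemisphere:
  assumes [measurable]: "f \<in> borel_measurable borel"
  shows "(\<integral>\<^sup>+z. f z \<partial>hemisphere a) = (\<integral>\<^sup>+z. ennreal (snd z powr a) * f z \<partial>half_sphere_measure 1)"
  unfolding hemisphere_def by (rule nn_integral_density) measurable

text \<open>On the half sphere y > 0, so (s y)^a = s^a y^a. The power s^a joins the Jacobian s^N,
  and the remaining weight is absorbed in a measure that does not depend on s.\<close>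

lemma nn_integral_weighted_polar:
  fixes f :: "(real^'n) \<times> real \<Rightarrow> ennreal"
  assumes [measurable]: "f \<in> borel_measurable borel"
  shows "(\<integral>\<^sup>+z. ennreal (snd z powr a) * f z * indicator {z. 0 < snd z} z \<partial>lborel)
    = (\<integral>\<^sup>+s. indicator {0<..} s * ennreal (s powr (real CARD('n) + a)) * (\<integral>\<^sup>+z. f (s *\<^sub>R z) \<partial>hemisphere a) \<partial>lborel)"
proof -
  have "(\<integral>\<^sup>+z. ennreal (snd z powr a) * f z * indicator {z. 0 < snd z} z \<partial>lborel)
    = (\<integral>\<^sup>+s. indicator {0<..} s * ennreal (s ^ CARD('n)) *
        (\<integral>\<^sup>+z. ennreal (snd (s *\<^sub>R z) powr a) * f (s *\<^sub>R z) \<partial>half_sphere_measure 1) \<partial>lborel)"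
    by (rule nn_integral_half_space_polar) measurable
  also have "\<dots> = (\<integral>\<^sup>+s. indicator {0<..} s * ennreal (s powr (real CARD('n) + a)) * (\<integral>\<^sup>+z. f (s *\<^sub>R z) \<partial>hemisphere a) \<partial>lborel)"
  proof (rule nn_integral_cong)
    fix s :: real
    show "indicator {0<..} s * ennreal (s ^ CARD('n)) *
        (\<integral>\<^sup>+z. ennreal (snd (s *\<^sub>R z) powr a) * f (s *\<^sub>R z) \<partial>half_sphere_measure 1)
      = indicator {0<..} s * ennreal (s powr (real CARD('n) + a)) * (\<integral>\<^sup>+z. f (s *\<^sub>R z) \<partial>hemisphere a)"
    proof (cases "s > 0")
      case True
      have "(\<integral>\<^sup>+z. ennreal (snd (s *\<^sub>R z) powr a) * f (s *\<^sub>R z) \<partial>half_sphere_measure 1)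
         = (\<integral>\<^sup>+z. ennreal (s powr a) * (ennreal (snd z powr a) * f (s *\<^sub>R z)) \<partial>half_sphere_measure 1)"
      proof (rule nn_integral_cong_AE)
        show "AE z in half_sphere_measure 1. ennreal (snd (s *\<^sub>R z) powr a) * f (s *\<^sub>R z) =
           ennreal (s powr a) * (ennreal (snd z powr a) * f (s *\<^sub>R z))"
          using AE_half_sphere_measure[where 'n='n, OF zero_less_one]
          by eventually_elim (use True in \<open>simp add: powr_mult ennreal_mult mult.assoc\<close>)
      qed
      also have "\<dots> = ennreal (s powr a) * (\<integral>\<^sup>+z. f (s *\<^sub>R z) \<partial>hemisphere a)"
        by (subst nn_integral_hemisphere, measurable) (rule nn_integral_cmult, measurable)
      finally show ?thesis
        using True by (simp add: powr_add ennreal_mult powr_realpow mult.assoc)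
    qed simp
  qed
  finally show ?thesis .
qed

lemma half_ball_measurable [measurable]: "half_ball r \<in> sets borel"
proof -
  have eq: "half_ball r = ball 0 r \<inter> {z. 0 < snd z}" by (auto simp: half_ball_def)
  have "open (ball 0 r \<inter> {z :: (real^'a) \<times> real. 0 < snd z})"
    by (intro open_Int open_ball open_Collect_less continuous_intros)
  then show ?thesis unfolding eq by (rule borel_open)
qed

lemma nn_integral_powr_from_0:
  assumes "a > -1" "Y \<ge> 0"
  shows "(\<integral>\<^sup>+y. indicator {0..Y} y * ennreal (y powr a) \<partial>lborel) = ennreal (Y powr (a + 1) / (a + 1))"
proof -
  have "((\<lambda>y. indicator {0..Y} y * y powr a) has_integral (Y powr (a + 1) / (a + 1))) UNIV"
    using has_integral_powr_from_0[OF assms] by (subst (asm) has_integral_restrict_UNIV[symmetric])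
      (simp add: indicator_def if_distrib[of "\<lambda>c. c * _"] of_bool_def if_distribR cong: if_cong)
  from nn_integral_has_integral_lborel[OF _ _ this] show ?thesis
    by (simp add: ennreal_mult' ennreal_indicator)
qed

lemma nn_integral_weight_fun:
  fixes h :: "real^'n \<Rightarrow> ennreal"
  assumes a: "a > -1" and Y: "Y \<ge> 0" and [measurable]: "h \<in> borel_measurable borel"
  shows "(\<integral>\<^sup>+z. ennreal (snd z powr a) * indicator {0..Y} (snd z) * h (fst z) \<partial>lborel)
    = ennreal (Y powr (a + 1) / (a + 1)) * (\<integral>\<^sup>+x. h x \<partial>lborel)"
proof -
  have [measurable]: "(\<lambda>z::(real^'n) \<times> real. h (fst z)) \<in> borel_measurable borel"
    by (rule measurable_compose[OF _ assms(3)]) (intro borel_measurable_continuous_onI continuous_intros)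
  have "(\<integral>\<^sup>+z. ennreal (snd z powr a) * indicator {0..Y} (snd z) * h (fst z) \<partial>(lborel :: ((real^'n) \<times> real) measure))
     = (\<integral>\<^sup>+x. \<integral>\<^sup>+y. ennreal (y powr a) * indicator {0..Y} y * h x \<partial>lborel \<partial>lborel)"
    unfolding lborel_prod[symmetric]
    by (subst lborel.nn_integral_fst[symmetric]) (auto simp: lborel_prod)
  also have "\<dots> = (\<integral>\<^sup>+x. (\<integral>\<^sup>+y. indicator {0..Y} y * ennreal (y powr a) \<partial>lborel) * h x \<partial>lborel)"
    by (intro nn_integral_cong) (simp add: nn_integral_multc mult.commute[of "indicator {0..Y} _"])
  also have "(\<integral>\<^sup>+y. indicator {0..Y} y * ennreal (y powr a) \<partial>lborel) = ennreal (Y powr (a + 1) / (a + 1))"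
    by (rule nn_integral_powr_from_0[OF a Y])
  finally show ?thesis by (simp add: nn_integral_cmult)
qed

lemma nn_integral_weight_strip:
  fixes A :: "(real^'n) set"
  assumes a: "a > -1" and Y: "Y \<ge> 0" and [measurable]: "A \<in> sets borel"
  shows "(\<integral>\<^sup>+z. ennreal (snd z powr a) * indicator (A \<times> {0..Y}) z \<partial>lborel) = emeasure lborel A * ennreal (Y powr (a + 1) / (a + 1))"
proof -
  have "(\<integral>\<^sup>+z. ennreal (snd z powr a) * indicator (A \<times> {0..Y}) z \<partial>lborel)
    = (\<integral>\<^sup>+z. ennreal (snd z powr a) * indicator {0..Y} (snd z) * indicator A (fst z) \<partial>lborel)"
    by (intro nn_integral_cong) (auto split: split_indicator)
  also have "\<dots> = ennreal (Y powr (a + 1) / (a + 1)) * (\<integral>\<^sup>+x. indicator A x \<partial>lborel)"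
    by (rule nn_integral_weight_fun[OF a Y]) measurable
  finally show ?thesis by (simp add: mult.commute)
qed

lemma nn_integral_weight_half_ball:
  fixes r :: real
  assumes a: "a > -1"
  shows "(\<integral>\<^sup>+z. ennreal (snd z powr a) * indicator (half_ball r) z \<partial>(lborel :: ((real^'n) \<times> real) measure)) < \<infinity>"
proof -
  have "(\<integral>\<^sup>+z. ennreal (snd z powr a) * indicator (half_ball r) z \<partial>(lborel :: ((real^'n) \<times> real) measure))
     \<le> (\<integral>\<^sup>+z. ennreal (snd z powr a) * indicator (cball 0 \<bar>r\<bar> \<times> {0..\<bar>r\<bar>}) z \<partial>(lborel :: ((real^'n) \<times> real) measure))"
  proof (rule nn_integral_mono)
    fix z :: "(real^'n) \<times> real"
    have "norm (fst z) \<le> norm z" "\<bar>snd z\<bar> \<le> norm z" using norm_fst_le[of "fst z" "snd z"] norm_snd_le[of "snd z" "fst z"] by auto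
    then show "ennreal (snd z powr a) * indicator (half_ball r) z \<le> ennreal (snd z powr a) * indicator (cball 0 \<bar>r\<bar> \<times> {0..\<bar>r\<bar>}) z"
      by (cases z) (auto simp: half_ball_def split: split_indicator)
  qed
  also have "\<dots> = emeasure lborel (cball (0::real^'n) \<bar>r\<bar>) * ennreal (\<bar>r\<bar> powr (a + 1) / (a + 1))"
    by (rule nn_integral_weight_strip[OF a]) auto
  also have "\<dots> < \<infinity>" using emeasure_lborel_cball_finite[of "0::real^'n" "\<bar>r\<bar>"] by (simp add: ennreal_mult_less_top)
  finally show ?thesis .
qed

text \<open>The total mass is read off from polar coordinates for the unit half ball: the finite
  weighted volume equals the mass times a radial integral, so it suffices that the radial integral
  is not 0.\<close>

lemma finite_measure_hemisphere:
  assumes a: "a > -1"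
  shows "finite_measure (hemisphere a :: ((real^'n) \<times> real) measure)"
proof
  let ?M = "hemisphere a :: ((real^'n) \<times> real) measure"
  let ?c = "\<integral>\<^sup>+s. indicator {0<..<1} s * ennreal (s powr (real CARD('n) + a)) \<partial>lborel"
  have "?c * emeasure ?M UNIV = (\<integral>\<^sup>+s. indicator {0<..} s * ennreal (s powr (real CARD('n) + a)) *
     (\<integral>\<^sup>+z. indicator (half_ball 1) (s *\<^sub>R z) \<partial>?M) \<partial>lborel)"
  proof -
    have "indicator {0<..} s * ennreal (s powr (real CARD('n) + a)) *
     (\<integral>\<^sup>+z. indicator (half_ball 1) (s *\<^sub>R z) \<partial>?M) = indicator {0<..<1} s * ennreal (s powr (real CARD('n) + a)) * emeasure ?M UNIV" for s
    proof (cases "s > 0")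
      case True
      have "(\<integral>\<^sup>+z. indicator (half_ball 1) (s *\<^sub>R z) \<partial>?M) = (\<integral>\<^sup>+z. indicator {0<..<1} s \<partial>?M)"
      proof (rule nn_integral_cong_AE)
        show "AE z in ?M. indicator (half_ball 1) (s *\<^sub>R z) = (indicator {0<..<1} s :: ennreal)"
          using AE_hemisphere by eventually_elim (use True in \<open>auto simp: half_ball_def zero_less_mult_iff split: split_indicator\<close>)
      qed
      then show ?thesis using True by (auto split: split_indicator)
    qed simp
    then show ?thesis by (simp add: nn_integral_multc)
  qed
  also have "\<dots> = (\<integral>\<^sup>+z. ennreal (snd z powr a) * indicator (half_ball 1) z * indicator {z. 0 < snd z} z
      \<partial>(lborel :: ((real^'n) \<times> real) measure))"
    by (rule nn_integral_weighted_polar[symmetric]) measurable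
  also have "\<dots> = (\<integral>\<^sup>+z. ennreal (snd z powr a) * indicator (half_ball 1) z \<partial>(lborel :: ((real^'n) \<times> real) measure))"
    by (intro nn_integral_cong) (auto simp: half_ball_def split: split_indicator)
  also have "\<dots> < \<infinity>" by (rule nn_integral_weight_half_ball[OF a])
  finally have fin: "?c * emeasure ?M UNIV < \<infinity>" .
  have "?c \<noteq> 0"
  proof
    assume "?c = 0"
    then have "AE s in lborel. indicator {0<..<1} s * ennreal (s powr (real CARD('n) + a)) = 0"
      by (subst (asm) nn_integral_0_iff_AE) auto
    then have "AE s in lborel. s \<notin> {0<..<1::real}"
      by eventually_elim (auto simp: ennreal_eq_0_iff split: split_indicator_asm)
    then have "{0<..<1::real} \<in> null_sets lborel" by (subst AE_iff_null_sets) auto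
    then have "emeasure lborel {0<..<1::real} = 0" by (rule null_setsD1)
    then show False by simp
  qed
  with fin show "emeasure ?M (space ?M) \<noteq> \<infinity>" by (auto simp: ennreal_mult_less_top)
qed

text \<open>The polar formula as an equality of measures. In this form it transfers to signed
  integrands through the integral rules for densities and image measures.\<close>

lemma weighted_polar_measure:
  assumes a: "a > -1"
  shows "density lborel (\<lambda>z. ennreal (snd z powr a) * indicator {z. 0 < snd z} z)
    = distr (density (lborel \<Otimes>\<^sub>M hemisphere a) (\<lambda>(s, z). indicator {0<..} s * ennreal (s powr (real CARD('n) + a))))
        borel (\<lambda>(s, z :: (real^'n) \<times> real). s *\<^sub>R z)"
    (is "?L = distr (density ?P ?w) borel ?m")
proof (rule measure_eqI)
  interpret M: finite_measure "hemisphere a :: ((real^'n) \<times> real) measure" by (rule finite_measure_hemisphere[OF a])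
  show "sets ?L = sets (distr (density ?P ?w) borel ?m)" by simp
  fix A assume "A \<in> sets ?L"
  then have [measurable]: "A \<in> sets borel" by simp
  have [measurable]: "?m \<in> ?P \<rightarrow>\<^sub>M borel" by measurable
  have "emeasure ?L A = (\<integral>\<^sup>+z. ennreal (snd z powr a) * indicator A z * indicator {z. 0 < snd z} z \<partial>lborel)"
    by (subst emeasure_density) (auto simp: mult_ac)
  also have "\<dots> = (\<integral>\<^sup>+s. indicator {0<..} s * ennreal (s powr (real CARD('n) + a)) * (\<integral>\<^sup>+z. indicator A (s *\<^sub>R z) \<partial>hemisphere a) \<partial>lborel)"
    by (rule nn_integral_weighted_polar) measurable
  also have "\<dots> = (\<integral>\<^sup>+s. \<integral>\<^sup>+z. ?w (s, z) * indicator A (?m (s, z)) \<partial>hemisphere a \<partial>lborel)"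
    by (simp add: nn_integral_cmult)
  also have "\<dots> = (\<integral>\<^sup>+p. ?w p * indicator A (?m p) \<partial>?P)"
    by (rule M.nn_integral_fst) measurable
  also have "\<dots> = emeasure (distr (density ?P ?w) borel ?m) A"
    by (subst nn_integral_indicator[symmetric], simp, subst nn_integral_distr, simp, simp,
        subst nn_integral_density) (auto simp: split_beta)
  finally show "emeasure ?L A = emeasure (distr (density ?P ?w) borel ?m) A" .
qed

lemma integral_weighted_polar:
  fixes f :: "(real^'n) \<times> real \<Rightarrow> real"
  assumes a: "a > -1" and [measurable]: "f \<in> borel_measurable borel"
    and int: "integrable lborel (\<lambda>z. indicator {z. 0 < snd z} z * (snd z powr a * f z))"
  shows "(LINT z|lborel. indicator {z. 0 < snd z} z * (snd z powr a * f z))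
    = (LINT s|lborel. indicator {0<..} s * (s powr (real CARD('n) + a) * (LINT z|hemisphere a. f (s *\<^sub>R z))))"
proof -
  interpret M: finite_measure "hemisphere a :: ((real^'n) \<times> real) measure" by (rule finite_measure_hemisphere[OF a])
  interpret P: pair_sigma_finite lborel "hemisphere a :: ((real^'n) \<times> real) measure" ..
  let ?P = "lborel \<Otimes>\<^sub>M hemisphere a :: (real \<times> ((real^'n) \<times> real)) measure"
  let ?v = "\<lambda>z::(real^'n) \<times> real. snd z powr a * indicator {z. 0 < snd z} z"
  let ?w = "\<lambda>(s::real, z::(real^'n) \<times> real). indicator {0<..} s * s powr (real CARD('n) + a)"
  have [measurable]: "(\<lambda>(s, z :: (real^'n) \<times> real). s *\<^sub>R z) \<in> ?P \<rightarrow>\<^sub>M borel" by measurable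
  have eq: "density lborel (\<lambda>z. ennreal (?v z)) = distr (density ?P (\<lambda>p. ennreal (?w p))) borel (\<lambda>(s, z). s *\<^sub>R z)"
    using weighted_polar_measure[OF a, where 'n='n]
    by (simp add: ennreal_mult' ennreal_indicator split_beta')
  have "integrable (density lborel (\<lambda>z. ennreal (?v z))) f"
    using int by (subst integrable_density) (auto simp: mult_ac)
  then have "integrable (density ?P (\<lambda>p. ennreal (?w p))) (\<lambda>p. f (fst p *\<^sub>R snd p))"
    unfolding eq by (subst (asm) integrable_distr_eq) (auto simp: split_beta)
  then have int2: "integrable ?P (\<lambda>p. ?w p *\<^sub>R f (fst p *\<^sub>R snd p))"
    by (subst (asm) integrable_density) (auto simp: split_beta)
  have "(LINT z|lborel. indicator {z. 0 < snd z} z * (snd z powr a * f z)) = (LINT z|density lborel (\<lambda>z. ennreal (?v z)). f z)"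
    by (subst integral_density) (auto simp: mult_ac)
  also have "\<dots> = (LINT p|density ?P (\<lambda>p. ennreal (?w p)). f (fst p *\<^sub>R snd p))"
    unfolding eq by (subst integral_distr) (auto simp: split_beta)
  also have "\<dots> = (LINT p|?P. ?w p *\<^sub>R f (fst p *\<^sub>R snd p))"
    by (subst integral_density) (auto simp: split_beta)
  also have "\<dots> = (LINT s|lborel. LINT z|hemisphere a. ?w (s, z) *\<^sub>R f (s *\<^sub>R z))"
    using P.integral_fst'[OF int2] by simp
  also have "\<dots> = (LINT s|lborel. indicator {0<..} s * (s powr (real CARD('n) + a) * (LINT z|hemisphere a. f (s *\<^sub>R z))))"
    by (simp add: mult.assoc)
  finally show ?thesis .
qed

text \<open>The normalisation r^(-(N+a)) cancels the factor r^N from the surface measure and r^a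
  from the weight.\<close>

lemma H_fun_eq_hemisphere:
  fixes u :: "(real^'n) \<times> real \<Rightarrow> real"
  assumes [measurable]: "u \<in> borel_measurable borel" and r: "r > 0"
  shows "H_fun a u r = (LINT z|hemisphere a. (u (r *\<^sub>R z))\<^sup>2)"
proof -
  have "(LINT z|half_sphere_measure r. snd z powr a * (u z)\<^sup>2)
      = r ^ CARD('n) * (LINT z|half_sphere_measure 1. snd (r *\<^sub>R z) powr a * (u (r *\<^sub>R z))\<^sup>2)"
    using r by (subst half_sphere_measure_scale[OF r]) (simp add: integral_density integral_distr)
  also have "(LINT z|half_sphere_measure 1. snd (r *\<^sub>R z) powr a * (u (r *\<^sub>R z))\<^sup>2)
      = (LINT z|half_sphere_measure 1. r powr a * (snd z powr a * (u (r *\<^sub>R z))\<^sup>2))"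
  proof (rule integral_cong_AE)
    show "AE z in half_sphere_measure 1. snd (r *\<^sub>R z) powr a * (u (r *\<^sub>R z))\<^sup>2 = r powr a * (snd z powr a * (u (r *\<^sub>R z))\<^sup>2)"
      using AE_half_sphere_measure[where 'n='n, OF zero_less_one] by eventually_elim (use r in \<open>simp add: powr_mult\<close>)
  qed measurable
  also have "\<dots> = r powr a * (LINT z|hemisphere a. (u (r *\<^sub>R z))\<^sup>2)"
    unfolding hemisphere_def by (subst integral_density) auto
  finally show ?thesis
    using r by (simp add: H_fun_def powr_realpow[symmetric] mult.assoc[symmetric] powr_add[symmetric])
qed

subsection \<open>Smooth approximation in the weighted Sobolev space\<close>

lemma ennreal_tendsto_0I:
  fixes f :: "nat \<Rightarrow> ennreal"
  assumes "\<And>e::real. e > 0 \<Longrightarrow> \<forall>\<^sub>F k in sequentially. f k \<le> ennreal e"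
  shows "f \<longlonglongrightarrow> 0"
proof (rule order_tendstoI)
  fix x :: ennreal assume "0 < x"
  then obtain y where y: "0 < y" "y < x" using dense by blast
  then have "y < top" using less_top by (metis less_trans top.not_eq_extremum)
  then have "0 < enn2real y" "ennreal (enn2real y) = y" using y by (auto simp: enn2real_positive_iff less_top)
  with assms[of "enn2real y"] have "\<forall>\<^sub>F k in sequentially. f k \<le> y" by simp
  then show "\<forall>\<^sub>F k in sequentially. f k < x" by eventually_elim (use y in simp)
qed simp

lemma ennreal_tendsto_0D:
  fixes f :: "nat \<Rightarrow> ennreal"
  assumes "f \<longlonglongrightarrow> 0" "e > 0"
  shows "\<forall>\<^sub>F k in sequentially. f k \<le> ennreal e"
  using order_tendstoD(2)[OF assms(1), of "ennreal e"] assms(2)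
  by (auto elim!: eventually_mono)

text \<open>With values in [0,\<infinity>] the product of 0 and \<infinity> has to be treated apart:
  if one factor is 0, then f g = 0 almost everywhere. If both are positive and finite, Young's
  inequality with a balancing weight is integrated.\<close>

lemma nn_integral_Cauchy_Schwarz:
  fixes f g :: "'a \<Rightarrow> real"
  assumes [measurable]: "f \<in> borel_measurable M" "g \<in> borel_measurable M"
  shows "(\<integral>\<^sup>+x. ennreal \<bar>f x * g x\<bar> \<partial>M)\<^sup>2 \<le> (\<integral>\<^sup>+x. ennreal ((f x)\<^sup>2) \<partial>M) * (\<integral>\<^sup>+x. ennreal ((g x)\<^sup>2) \<partial>M)"
    (is "?I\<^sup>2 \<le> ?A * ?B")
proof -
  have zero: "?I = 0" if "?A = 0 \<or> ?B = 0"
  proof -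
    have "AE x in M. f x * g x = 0"
      using that
    proof
      assume "?A = 0"
      then have "AE x in M. ennreal ((f x)\<^sup>2) = 0" by (subst (asm) nn_integral_0_iff_AE) auto
      then show ?thesis by eventually_elim auto
    next
      assume "?B = 0"
      then have "AE x in M. ennreal ((g x)\<^sup>2) = 0" by (subst (asm) nn_integral_0_iff_AE) auto
      then show ?thesis by eventually_elim auto
    qed
    then have "AE x in M. ennreal \<bar>f x * g x\<bar> = 0" by eventually_elim simp
    then show ?thesis by (subst nn_integral_0_iff_AE) auto
  qed
  show ?thesis
  proof (cases "?A = 0 \<or> ?B = 0")
    case True
    then show ?thesis using zero by simp
  next
    case nz: False
    show ?thesis
    proof (cases "?A = top \<or> ?B = top")
      case True
      then show ?thesis using nz by (auto simp: ennreal_top_mult ennreal_mult_top)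
    next
      case False
      define A where "A = enn2real ?A"
      define B where "B = enn2real ?B"
      have A: "?A = ennreal A" "A > 0" and B: "?B = ennreal B" "B > 0"
        using nz False by (auto simp: A_def B_def less_top enn2real_positive_iff zero_less_iff_neq_zero)
      \<comment> \<open>The weight that balances Young's inequality: \<theta> A and B / \<theta> are
        both sqrt(A B).\<close>
      define \<theta> where "\<theta> = sqrt (B / A)"
      have \<theta>: "\<theta> > 0" using A B by (simp add: \<theta>_def)
      have "2 * ?I = (\<integral>\<^sup>+x. ennreal (2 * \<bar>f x * g x\<bar>) \<partial>M)"
        by (subst nn_integral_cmult[symmetric]) (auto simp: ennreal_mult)
      also have "\<dots> \<le> (\<integral>\<^sup>+x. ennreal (\<theta> * (f x)\<^sup>2 + inverse \<theta> * (g x)\<^sup>2) \<partial>M)"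
      proof (intro nn_integral_mono ennreal_leI)
        fix x
        have "0 \<le> (sqrt \<theta> * \<bar>f x\<bar> - sqrt (inverse \<theta>) * \<bar>g x\<bar>)\<^sup>2" by simp
        also have "\<dots> = \<theta> * (f x)\<^sup>2 + inverse \<theta> * (g x)\<^sup>2 - 2 * (sqrt \<theta> * sqrt (inverse \<theta>)) * \<bar>f x * g x\<bar>"
          using \<theta> by (simp add: power2_diff power_mult_distrib abs_mult)
        also have "sqrt \<theta> * sqrt (inverse \<theta>) = 1" using \<theta> by (simp add: real_sqrt_mult[symmetric])
        finally show "2 * \<bar>f x * g x\<bar> \<le> \<theta> * (f x)\<^sup>2 + inverse \<theta> * (g x)\<^sup>2" by simp
      qed
      also have "\<dots> = ennreal \<theta> * ?A + ennreal (inverse \<theta>) * ?B"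
        using \<theta> by (simp add: nn_integral_add nn_integral_cmult ennreal_mult ennreal_plus)
      also have "\<dots> = ennreal (\<theta> * A + inverse \<theta> * B)" using A B \<theta> by (simp add: ennreal_mult ennreal_plus)
      also have "\<theta> * A + inverse \<theta> * B = 2 * sqrt (A * B)"
        using A B by (simp add: \<theta>_def real_sqrt_divide real_sqrt_mult real_div_sqrt field_simps)
      finally have le: "2 * ?I \<le> ennreal (2 * sqrt (A * B))" .
      then have "?I < top" by (metis ennreal_less_top ennreal_mult_eq_top_iff le_less_trans less_top zero_neq_numeral not_le top.not_eq_extremum)
      then obtain i where i: "?I = ennreal i" "i \<ge> 0" by (metis enn2real_nonneg ennreal_enn2real)
      from le have "ennreal (2 * i) \<le> ennreal (2 * sqrt (A * B))" unfolding i by (simp add: ennreal_mult i)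
      then have "i \<le> sqrt (A * B)" using A B by (simp add: ennreal_le_iff)
      then have "i\<^sup>2 \<le> A * B" using i A B by (metis power_mono real_sqrt_pow2 mult_nonneg_nonneg less_imp_le)
      then show ?thesis unfolding i A B using A B i by (simp add: ennreal_power ennreal_mult[symmetric] ennreal_leI)
    qed
  qed
qed

lemma nn_integral_FTC_bound:
  fixes f f' :: "real \<Rightarrow> real"
  assumes "\<alpha> \<le> \<beta>" and d: "\<And>s. s \<in> {\<alpha>..\<beta>} \<Longrightarrow> (f has_real_derivative f' s) (at s)"
    and c: "continuous_on {\<alpha>..\<beta>} f'"
  shows "ennreal \<bar>f \<beta> - f \<alpha>\<bar> \<le> (\<integral>\<^sup>+s. ennreal \<bar>f' s\<bar> * indicator {\<alpha>..\<beta>} s \<partial>lborel)"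
proof -
  have "has_bochner_integral lborel (\<lambda>x. indicator {\<alpha>..\<beta>} x *\<^sub>R f' x) (f \<beta> - f \<alpha>)"
    using assms
    by (intro has_bochner_integral_FTC_Icc) (auto simp: has_real_derivative_iff_has_vector_derivative
        intro: has_vector_derivative_at_within)
  then have "ennreal (norm (f \<beta> - f \<alpha>)) \<le> (\<integral>\<^sup>+s. ennreal (norm (indicator {\<alpha>..\<beta>} s *\<^sub>R f' s)) \<partial>lborel)"
    by (metis has_bochner_integral_iff integral_norm_bound_ennreal)
  also have "\<dots> = (\<integral>\<^sup>+s. ennreal \<bar>f' s\<bar> * indicator {\<alpha>..\<beta>} s \<partial>lborel)"
    by (intro nn_integral_cong) (auto split: split_indicator)
  finally show ?thesis by simp
qed

lemma smooth_line_deriv: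
  assumes "smooth f"
  shows "((\<lambda>s. f (p + s *\<^sub>R v)) has_real_derivative grad f (p + s *\<^sub>R v) \<bullet> v) (at s)"
proof -
  have "((\<lambda>s. f (p + s *\<^sub>R v)) has_derivative (\<lambda>h. (h *\<^sub>R v) \<bullet> grad f (p + s *\<^sub>R v))) (at s)"
    using smoothD(2)[OF assms, of "p + s *\<^sub>R v"] unfolding gderiv_def
    by (intro has_derivative_compose[where f="\<lambda>s. p + s *\<^sub>R v" and g=f]) (auto intro!: derivative_eq_intros)
  then show ?thesis
    unfolding has_field_derivative_def
    by (rule has_derivative_eq_rhs) (auto simp: inner_commute mult.commute)
qed

lemma borel_measurable_smooth:
  assumes "smooth f"
  shows "f \<in> borel_measurable borel" and "grad f \<in> borel_measurable borel"
  using smoothD[OF assms] by (auto intro: borel_measurable_continuous_onI)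

section \<open>Representatives and finiteness in the weighted space\<close>

lemma H1a_lim_cong:
  assumes "\<And>z. z \<in> half_ball r \<Longrightarrow> u z = u' z \<and> V z = V' z"
  shows "H1a_lim a r \<phi> u V \<longleftrightarrow> H1a_lim a r \<phi> u' V'"
proof -
  have "(\<lambda>z. indicator (half_ball r) z *\<^sub>R u z) = (\<lambda>z. indicator (half_ball r) z *\<^sub>R u' z)"
    "(\<lambda>z. indicator (half_ball r) z *\<^sub>R V z) = (\<lambda>z. indicator (half_ball r) z *\<^sub>R V' z)"
    using assms by (auto simp: fun_eq_iff split: split_indicator)
  moreover have "H1a_sqnorm a r (\<lambda>z. u z - \<phi> k z) (\<lambda>z. V z - grad (\<phi> k) z)
      = H1a_sqnorm a r (\<lambda>z. u' z - \<phi> k z) (\<lambda>z. V' z - grad (\<phi> k) z)" for k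
    unfolding H1a_sqnorm_def using assms by (intro nn_integral_cong) (auto split: split_indicator)
  ultimately show ?thesis by (simp add: H1a_lim_def set_borel_measurable_def)
qed

text \<open>Elements of the space are measurable on the half ball only and arbitrary elsewhere.
  Extending them by 0 gives Borel representatives with the same limit, for which the integral
  calculus on the whole space is available.\<close>

lemma H1a_lim_borel:
  assumes "H1a_lim a r \<phi> u V"
  obtains u' V' where "u' \<in> borel_measurable borel" "V' \<in> borel_measurable borel"
    "H1a_lim a r \<phi> u' V'" "\<And>z. z \<in> half_ball r \<Longrightarrow> u' z = u z \<and> V' z = V z"
proof
  let ?u = "\<lambda>z. indicator (half_ball r) z *\<^sub>R u z" and ?V = "\<lambda>z. indicator (half_ball r) z *\<^sub>R V z"
  show "?u \<in> borel_measurable borel" "?V \<in> borel_measurable borel"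
    using assms by (auto simp: H1a_lim_def set_borel_measurable_def)
  show "H1a_lim a r \<phi> ?u ?V"
    using assms by (subst H1a_lim_cong[where u'=u and V'=V]) auto
qed auto

lemma H1a_sqnorm_mono:
  assumes "r \<le> R"
  shows "H1a_sqnorm a r u V \<le> H1a_sqnorm a R u V"
  unfolding H1a_sqnorm_def using assms
  by (intro nn_integral_mono) (auto simp: half_ball_def split: split_indicator)

lemma H1a_lim_subset:
  assumes "r \<le> R" "H1a_lim a R \<phi> u V"
  shows "H1a_lim a r \<phi> u V"
proof -
  obtain u' V' where uV [measurable]: "u' \<in> borel_measurable borel" "V' \<in> borel_measurable borel"
    and lim: "H1a_lim a R \<phi> u' V'" and eq: "\<And>z. z \<in> half_ball R \<Longrightarrow> u' z = u z \<and> V' z = V z"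
    using H1a_lim_borel[OF assms(2)] by blast
  have "(\<lambda>k. H1a_sqnorm a r (\<lambda>z. u' z - \<phi> k z) (\<lambda>z. V' z - grad (\<phi> k) z)) \<longlonglongrightarrow> 0"
  proof (rule tendsto_sandwich[OF _ _ tendsto_const])
    show "(\<lambda>k. H1a_sqnorm a R (\<lambda>z. u' z - \<phi> k z) (\<lambda>z. V' z - grad (\<phi> k) z)) \<longlonglongrightarrow> 0"
      using lim by (simp add: H1a_lim_def)
  qed (auto intro!: always_eventually H1a_sqnorm_mono[OF assms(1)])
  then have "H1a_lim a r \<phi> u' V'" by (simp add: H1a_lim_def set_borel_measurable_def)
  then show ?thesis using eq assms(1) by (subst H1a_lim_cong[where u'=u' and V'=V']) (auto simp: half_ball_def)
qed

lemma bounded_half_ball: "z \<in> half_ball r \<Longrightarrow> z \<in> cball 0 r"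
  by (auto simp: half_ball_def)

lemma smooth_bounded:
  assumes "smooth f"
  obtains C where "C > 0" "\<And>z. z \<in> cball 0 r \<Longrightarrow> \<bar>f z\<bar> \<le> C" "\<And>z. z \<in> cball 0 r \<Longrightarrow> norm (grad f z) \<le> C"
proof -
  have "bounded (f ` cball 0 r)" "bounded (grad f ` cball 0 r)"
    using smoothD[OF assms] by (meson compact_cball compact_continuous_image compact_imp_bounded continuous_on_subset subset_UNIV)+
  then obtain C1 C2 where "\<And>z. z \<in> cball 0 r \<Longrightarrow> \<bar>f z\<bar> \<le> C1" "\<And>z. z \<in> cball 0 r \<Longrightarrow> norm (grad f z) \<le> C2"
    by (force simp: bounded_iff)
  then show ?thesis by (intro that[of "max 1 (max C1 C2)"]) (auto simp: le_max_iff_disj)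
qed

lemma norm_diff_square_le: "(norm (x - y))\<^sup>2 \<le> 2 * (norm x)\<^sup>2 + 2 * (norm (y::'a::real_inner))\<^sup>2"
proof -
  have "(norm (x - y))\<^sup>2 + (norm (x + y))\<^sup>2 = 2 * (norm x)\<^sup>2 + 2 * (norm y)\<^sup>2"
    by (simp add: power2_norm_eq_inner inner_diff inner_add inner_commute algebra_simps)
  then show ?thesis by (smt (verit) zero_le_power2)
qed

lemma H1a_sqnorm_diff:
  assumes [measurable]: "u \<in> borel_measurable borel" "V \<in> borel_measurable borel"
    "v \<in> borel_measurable borel" "W \<in> borel_measurable borel"
  shows "H1a_sqnorm a r (\<lambda>z. u z - v z) (\<lambda>z. V z - W z) \<le> 2 * H1a_sqnorm a r u V + 2 * H1a_sqnorm a r v W"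
proof -
  have "H1a_sqnorm a r (\<lambda>z. u z - v z) (\<lambda>z. V z - W z) \<le>
    (\<integral>\<^sup>+z. 2 * (ennreal (snd z powr a * ((norm (V z))\<^sup>2 + (u z)\<^sup>2)) * indicator (half_ball r) z) +
       2 * (ennreal (snd z powr a * ((norm (W z))\<^sup>2 + (v z)\<^sup>2)) * indicator (half_ball r) z) \<partial>lborel)"
    unfolding H1a_sqnorm_def
  proof (rule nn_integral_mono)
    fix z
    have "(norm (V z - W z))\<^sup>2 + (u z - v z)\<^sup>2 \<le> 2 * ((norm (V z))\<^sup>2 + (u z)\<^sup>2) + 2 * ((norm (W z))\<^sup>2 + (v z)\<^sup>2)"
      using norm_diff_square_le[of "V z" "W z"] norm_diff_square_le[of "u z" "v z"] by simp
    then have "snd z powr a * ((norm (V z - W z))\<^sup>2 + (u z - v z)\<^sup>2) \<le>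
      snd z powr a * (2 * ((norm (V z))\<^sup>2 + (u z)\<^sup>2) + 2 * ((norm (W z))\<^sup>2 + (v z)\<^sup>2))"
      by (rule mult_left_mono) simp
    also have "\<dots> = 2 * (snd z powr a * ((norm (V z))\<^sup>2 + (u z)\<^sup>2)) + 2 * (snd z powr a * ((norm (W z))\<^sup>2 + (v z)\<^sup>2))"
      by (simp add: algebra_simps)
    finally have "ennreal (snd z powr a * ((norm (V z - W z))\<^sup>2 + (u z - v z)\<^sup>2)) \<le>
      2 * ennreal (snd z powr a * ((norm (V z))\<^sup>2 + (u z)\<^sup>2)) + 2 * ennreal (snd z powr a * ((norm (W z))\<^sup>2 + (v z)\<^sup>2))"
      by (subst (asm) ennreal_le_iff[symmetric]) (auto simp: ennreal_plus ennreal_mult simp del: ennreal_le_iff)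
    then show "ennreal (snd z powr a * ((norm (V z - W z))\<^sup>2 + (u z - v z)\<^sup>2)) * indicator (half_ball r) z \<le>
      2 * (ennreal (snd z powr a * ((norm (V z))\<^sup>2 + (u z)\<^sup>2)) * indicator (half_ball r) z) +
      2 * (ennreal (snd z powr a * ((norm (W z))\<^sup>2 + (v z)\<^sup>2)) * indicator (half_ball r) z)"
      by (auto split: split_indicator)
  qed
  also have "\<dots> = 2 * H1a_sqnorm a r u V + 2 * H1a_sqnorm a r v W"
    unfolding H1a_sqnorm_def by (simp add: nn_integral_add nn_integral_cmult)
  finally show ?thesis .
qed

lemma H1a_sqnorm_smooth_finite:
  fixes f :: "(real^'n) \<times> real \<Rightarrow> real"
  assumes a: "a > -1" and "smooth f"
  shows "H1a_sqnorm a r f (grad f) < \<infinity>"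
proof -
  obtain C where C: "C > 0" "\<And>z. z \<in> cball 0 r \<Longrightarrow> \<bar>f z\<bar> \<le> C" "\<And>z. z \<in> cball 0 r \<Longrightarrow> norm (grad f z) \<le> C"
    using smooth_bounded[OF assms(2)] by blast
  have "H1a_sqnorm a r f (grad f) \<le> (\<integral>\<^sup>+z. ennreal (2 * C\<^sup>2) * (ennreal (snd z powr a) * indicator (half_ball r) z) \<partial>(lborel :: ((real^'n) \<times> real) measure))"
    unfolding H1a_sqnorm_def
  proof (rule nn_integral_mono)
    fix z :: "(real^'n) \<times> real"
    show "ennreal (snd z powr a * ((norm (grad f z))\<^sup>2 + (f z)\<^sup>2)) * indicator (half_ball r) z \<le>
      ennreal (2 * C\<^sup>2) * (ennreal (snd z powr a) * indicator (half_ball r) z)"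
    proof (cases "z \<in> half_ball r")
      case True
      have "(norm (grad f z))\<^sup>2 \<le> C\<^sup>2" "(f z)\<^sup>2 \<le> C\<^sup>2"
        using C bounded_half_ball[OF True] by (auto intro: power_mono simp: abs_le_square_iff[symmetric])
      then have "snd z powr a * ((norm (grad f z))\<^sup>2 + (f z)\<^sup>2) \<le> snd z powr a * (2 * C\<^sup>2)"
        by (intro mult_left_mono) auto
      then show ?thesis using True C by (simp add: ennreal_mult'[symmetric] ennreal_leI mult.commute)
    qed simp
  qed
  also have "\<dots> < \<infinity>"
    using nn_integral_weight_half_ball[OF a, of r, where 'n='n] by (simp add: nn_integral_cmult ennreal_mult_less_top)
  finally show ?thesis .
qed

text \<open>Some smooth approximant is at squared distance at most 1, and a smooth function has
  finite norm because the weight is integrable on the half ball for a > -1.\<close>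

lemma H1a_lim_finite:
  assumes a: "a > -1" and \<phi>: "\<And>k. smooth (\<phi> k)" and lim: "H1a_lim a r \<phi> u V"
  shows "H1a_sqnorm a r u V < \<infinity>"
proof -
  obtain u' V' where uV [measurable]: "u' \<in> borel_measurable borel" "V' \<in> borel_measurable borel"
    and lim': "H1a_lim a r \<phi> u' V'" and eq: "\<And>z. z \<in> half_ball r \<Longrightarrow> u' z = u z \<and> V' z = V z"
    using H1a_lim_borel[OF lim] by blast
  note [measurable] = borel_measurable_smooth[OF \<phi>]
  have "\<forall>\<^sub>F k in sequentially. H1a_sqnorm a r (\<lambda>z. u' z - \<phi> k z) (\<lambda>z. V' z - grad (\<phi> k) z) \<le> ennreal 1"
    using lim' by (intro ennreal_tendsto_0D) (auto simp: H1a_lim_def)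
  then obtain k where k: "H1a_sqnorm a r (\<lambda>z. u' z - \<phi> k z) (\<lambda>z. V' z - grad (\<phi> k) z) \<le> ennreal 1"
    by (auto simp: eventually_sequentially)
  have "H1a_sqnorm a r u V = H1a_sqnorm a r u' V'"
    unfolding H1a_sqnorm_def using eq by (intro nn_integral_cong) (auto split: split_indicator)
  also have "\<dots> = H1a_sqnorm a r (\<lambda>z. (u' z - \<phi> k z) - (- \<phi> k z)) (\<lambda>z. (V' z - grad (\<phi> k) z) - (- grad (\<phi> k) z))"
    by simp
  also have "\<dots> \<le> 2 * H1a_sqnorm a r (\<lambda>z. u' z - \<phi> k z) (\<lambda>z. V' z - grad (\<phi> k) z)
      + 2 * H1a_sqnorm a r (\<lambda>z. - \<phi> k z) (\<lambda>z. - grad (\<phi> k) z)"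
    by (rule H1a_sqnorm_diff) measurable
  also have "H1a_sqnorm a r (\<lambda>z. - \<phi> k z) (\<lambda>z. - grad (\<phi> k) z) = H1a_sqnorm a r (\<phi> k) (grad (\<phi> k))"
    by (simp add: H1a_sqnorm_def)
  also have "2 * H1a_sqnorm a r (\<lambda>z. u' z - \<phi> k z) (\<lambda>z. V' z - grad (\<phi> k) z) + 2 * H1a_sqnorm a r (\<phi> k) (grad (\<phi> k)) < \<infinity>"
    using le_less_trans[OF k ennreal_less_top] H1a_sqnorm_smooth_finite[OF a \<phi>] by (simp add: ennreal_mult_less_top)
  finally show ?thesis .
qed

text \<open>Write the difference as a vertical integral of the gradient and apply Cauchy-Schwarz to
  s^(-a/2) times s^(a/2) |grad f|. The first factor contributes the integral of s^(-a), finite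
  because a < 1. This is the estimate behind the existence of traces.\<close>

lemma vertical_difference_bound:
  fixes f :: "(real^'n) \<times> real \<Rightarrow> real"
  assumes a: "a < 1" and f: "smooth f" and y: "0 \<le> y" "y \<le> Y"
  shows "ennreal ((f (x, y) - f (x, 0))\<^sup>2) \<le> ennreal (Y powr (1 - a) / (1 - a)) *
    (\<integral>\<^sup>+s. ennreal (s powr a * (norm (grad f (x, s)))\<^sup>2) * indicator {0..Y} s \<partial>lborel)"
proof -
  define g where "g s = norm (grad f (x, s))" for s
  have cg: "continuous_on UNIV g" unfolding g_def
    by (intro continuous_intros continuous_on_compose2[OF smoothD(3)[OF f]]) auto
  then have [measurable]: "g \<in> borel_measurable borel" by (rule borel_measurable_continuous_onI)
  define I where "I s = (indicator {0..Y} s :: real)" for s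
  have [measurable]: "I \<in> borel_measurable borel" by (simp add: I_def[abs_def])
  have d: "((\<lambda>s. f (x, s)) has_real_derivative grad f (x, s) \<bullet> (0, 1)) (at s)" for s
    using smooth_line_deriv[OF f, of "(x, 0)" "(0, 1)" s] by simp
  have bd: "\<bar>grad f (x, s) \<bullet> (0, 1)\<bar> \<le> g s" for s
    using Cauchy_Schwarz_ineq2[of "grad f (x, s)" "(0, 1)"] by (simp add: g_def norm_Pair)
  have "ennreal \<bar>f (x, y) - f (x, 0)\<bar> \<le> (\<integral>\<^sup>+s. ennreal \<bar>grad f (x, s) \<bullet> (0, 1)\<bar> * indicator {0..y} s \<partial>lborel)"
    using y(1) d by (rule nn_integral_FTC_bound)
      (intro continuous_intros continuous_on_compose2[OF smoothD(3)[OF f]], auto)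
  also have "\<dots> \<le> (\<integral>\<^sup>+s. ennreal \<bar>(I s * s powr (- a / 2)) * (I s * (s powr (a / 2) * g s))\<bar> \<partial>lborel)"
  \<comment> \<open>At s = 0 both powers are 0 by the convention for \<open>powr\<close>, so the two
    weights do not cancel there; the point is discarded as a null set.\<close>
  proof (rule nn_integral_mono_AE, rule AE_mp[OF AE_lborel_singleton[of 0]], rule AE_I2, rule impI)
    fix s :: real assume "s \<noteq> 0"
    then have "s > 0 \<Longrightarrow> s powr (- a / 2) * s powr (a / 2) = 1" by (simp add: powr_add[symmetric])
    then have "s \<in> {0..y} \<Longrightarrow> (I s * s powr (- a / 2)) * (I s * (s powr (a / 2) * g s)) = g s"
      using y \<open>s \<noteq> 0\<close> by (simp add: I_def mult.assoc[symmetric])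
    then have le: "s \<in> {0..y} \<Longrightarrow> \<bar>grad f (x, s) \<bullet> (0, 1)\<bar> \<le> \<bar>(I s * s powr (- a / 2)) * (I s * (s powr (a / 2) * g s))\<bar>"
      using bd[of s] by linarith
    show "ennreal \<bar>grad f (x, s) \<bullet> (0, 1)\<bar> * indicator {0..y} s \<le>
      ennreal \<bar>(I s * s powr (- a / 2)) * (I s * (s powr (a / 2) * g s))\<bar>"
    proof (cases "s \<in> {0..y}")
      case True
      then show ?thesis using ennreal_leI[OF le[OF True]] by simp
    qed simp
  qed
  finally have 1: "ennreal \<bar>f (x, y) - f (x, 0)\<bar> \<le> (\<integral>\<^sup>+s. ennreal \<bar>(I s * s powr (- a / 2)) * (I s * (s powr (a / 2) * g s))\<bar> \<partial>lborel)" .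
  have "ennreal ((f (x, y) - f (x, 0))\<^sup>2) = (ennreal \<bar>f (x, y) - f (x, 0)\<bar>)\<^sup>2"
    by (simp add: ennreal_power)
  also have "\<dots> \<le> (\<integral>\<^sup>+s. ennreal \<bar>(I s * s powr (- a / 2)) * (I s * (s powr (a / 2) * g s))\<bar> \<partial>lborel)\<^sup>2"
    using 1 by (intro power_mono) auto
  also have "\<dots> \<le> (\<integral>\<^sup>+s. ennreal ((I s * s powr (- a / 2))\<^sup>2) \<partial>lborel) * (\<integral>\<^sup>+s. ennreal ((I s * (s powr (a / 2) * g s))\<^sup>2) \<partial>lborel)"
    by (rule nn_integral_Cauchy_Schwarz) measurable
  also have "(\<integral>\<^sup>+s. ennreal ((I s * s powr (- a / 2))\<^sup>2) \<partial>lborel) = ennreal (Y powr (1 - a) / (1 - a))"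
  proof -
    have "(I s * s powr (- a / 2))\<^sup>2 = indicator {0..Y} s * s powr (- a)" for s
      by (auto simp: I_def power2_eq_square powr_add[symmetric] split: split_indicator)
    then show ?thesis
      using nn_integral_powr_from_0[of "- a" Y] a y by (simp add: ennreal_mult' ennreal_indicator)
  qed
  also have "(\<integral>\<^sup>+s. ennreal ((I s * (s powr (a / 2) * g s))\<^sup>2) \<partial>lborel) =
    (\<integral>\<^sup>+s. ennreal (s powr a * (norm (grad f (x, s)))\<^sup>2) * indicator {0..Y} s \<partial>lborel)"
    by (intro nn_integral_cong)
       (auto simp: I_def g_def power_mult_distrib power2_eq_square[of "_ powr _"] powr_add[symmetric] split: split_indicator)
  finally show ?thesis .
qed

lemma H1a_sqnorm_cong:
  assumes "\<And>z. z \<in> half_ball r \<Longrightarrow> u z = u' z \<and> V z = V' z"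
  shows "H1a_sqnorm a r u V = H1a_sqnorm a r u' V'"
  unfolding H1a_sqnorm_def using assms by (intro nn_integral_cong) (auto split: split_indicator)

lemma cylinder_subset_half_ball:
  assumes "0 < \<rho>" "\<rho> < 1"
    and "norm x \<le> \<rho>" "0 < y" "y \<le> (1 - \<rho>) / 2"
  shows "(x, y) \<in> half_ball 1"
proof -
  have "norm (x, y) \<le> norm x + y" using norm_triangle_ineq[of "(x, 0)" "(0, y)"] assms by (simp add: norm_Pair)
  also have "\<dots> < 1" using assms by simp
  finally show ?thesis using assms by (simp add: half_ball_def)
qed

lemma AE_lborel_snd_nonzero:
  "AE z in (lborel :: ((real^'n) \<times> real) measure). snd z \<noteq> 0"
proof -
  have "open {z :: (real^'n) \<times> real. snd z \<noteq> 0}"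
    by (intro open_Collect_neq continuous_intros)
  then have "{z \<in> space (lborel \<Otimes>\<^sub>M lborel). snd (z :: (real^'n) \<times> real) \<noteq> 0} \<in> sets (lborel \<Otimes>\<^sub>M lborel)"
    unfolding lborel_prod by simp
  moreover have "AE x in (lborel :: (real^'n) measure). AE y in (lborel :: real measure). snd (x, y) \<noteq> 0"
    using AE_lborel_singleton[of "0::real"] by simp
  ultimately have "AE z in (lborel :: (real^'n) measure) \<Otimes>\<^sub>M (lborel :: real measure). snd z \<noteq> 0"
    by (intro lborel_pair.AE_pair_measure)
  then show ?thesis by (simp only: lborel_prod)
qed

text \<open>For a height y above x, compare u(x,0) with u(x,y), then u(x,y) with \<phi>_k(x,y), then
  \<phi>_k(x,y) with \<phi>_k(x,0). Averaging the squares over 0 < y < Y with weight y^a bounds the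
  three parts by the modulus of continuity of u, by the approximation error, and by the vertical
  difference estimate. The height Y is fixed before k.\<close>

lemma H1a_lim_trace:
  fixes u :: "(real^'n) \<times> real \<Rightarrow> real"
  assumes a: "-1 < a" "a < 1" and \<phi>: "\<And>k. smooth (\<phi> k)" and lim: "H1a_lim a 1 \<phi> u V"
    and cont: "continuous_on (half_ball 1 \<union> flat_ball 1) u" and \<rho>: "0 < \<rho>" "\<rho> < 1"
  shows "(\<lambda>k. \<integral>\<^sup>+x\<in>ball 0 \<rho>. ennreal ((u (x, 0) - \<phi> k (x, 0))\<^sup>2) \<partial>lborel) \<longlonglongrightarrow> 0"
proof (rule ennreal_tendsto_0I)
  fix e :: real assume e: "e > 0"
  obtain u' V' where uV [measurable]: "u' \<in> borel_measurable borel" "V' \<in> borel_measurable borel"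
    and lim': "H1a_lim a 1 \<phi> u' V'" and eq: "\<And>z. z \<in> half_ball 1 \<Longrightarrow> u' z = u z \<and> V' z = V z"
    using H1a_lim_borel[OF lim] by blast
  note [measurable] = borel_measurable_smooth[OF \<phi>]
  \<comment> \<open>The cylinder over the closed ball of radius \<rho> with this height has points
    of norm at most \<rho> + (1 - \<rho>)/2 < 1, so apart from its base it lies in the half
    ball.\<close>
  define Y0 where "Y0 = (1 - \<rho>) / 2"
  have Y0: "Y0 > 0" using \<rho> by (simp add: Y0_def)
  define K where "K = cball (0::real^'n) \<rho> \<times> {0..Y0}"
  have "compact K" by (simp add: K_def compact_Times)
  have inK: "(x, y) \<in> half_ball 1 \<union> flat_ball 1" if "(x, y) \<in> K" for x y
    using that cylinder_subset_half_ball[OF \<rho>, of x y] \<rho> by (cases "y = 0") (auto simp: K_def Y0_def flat_ball_def)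
  then have "continuous_on K u" by (intro continuous_on_subset[OF cont]) auto
  then have uc: "uniformly_continuous_on K u" using \<open>compact K\<close> by (rule compact_uniformly_continuous)
  define B where "B = measure lborel (ball (0::real^'n) \<rho>)"
  have B: "emeasure lborel (ball (0::real^'n) \<rho>) = ennreal B" "B \<ge> 0"
    using emeasure_lborel_ball_finite[of "0::real^'n" \<rho>] by (auto simp: B_def emeasure_eq_ennreal_measure)
  define M where "M = enn2real (H1a_sqnorm a 1 u' V')"
  have M: "H1a_sqnorm a 1 u' V' = ennreal M" "M \<ge> 0"
    using H1a_lim_finite[OF a(1) \<phi> lim'] by (auto simp: M_def)
  \<comment> \<open>The oscillation term contributes 3 \<omega>^2 B, to be at most e/3; B + 1 in the
    denominator avoids a division by 0.\<close>
  define \<omega> where "\<omega> = sqrt (e / (9 * (B + 1)))"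
  have \<omega>: "\<omega> > 0" "3 * \<omega>\<^sup>2 * B \<le> e / 3"
    using e B by (auto simp: \<omega>_def field_simps)
  obtain \<delta> where \<delta>: "\<delta> > 0" "\<And>z w. z \<in> K \<Longrightarrow> w \<in> K \<Longrightarrow> dist w z < \<delta> \<Longrightarrow> dist (u w) (u z) < \<omega>"
    using uc \<omega>(1) unfolding uniformly_continuous_on_def by blast
  \<comment> \<open>The factor 6 is 3 from squaring a sum of three terms times 2 from bounding the
    energy of \<phi>_k by 2 M + 2 \<sigma>. The part with M is made smaller than e/3 by taking Y
    small.\<close>
  have "((\<lambda>y. 6 * (y powr (1 - a) / (1 - a)) * M) \<longlongrightarrow> 6 * (0 / (1 - a)) * M) (at_right 0)"
    using a by (intro tendsto_intros tendsto_zero_powrI[where b="1 - a"]) (auto simp: eventually_at_filter intro: tendsto_ident_at)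
  then have "\<forall>\<^sub>F y in at_right 0. 6 * (y powr (1 - a) / (1 - a)) * M < e / 3"
    using e by (intro order_tendstoD(2)) auto
  moreover have "\<forall>\<^sub>F y in at_right 0. y < min Y0 \<delta>" using Y0 \<delta>(1) eventually_at_right_real[of 0 "min Y0 \<delta>"] by (auto elim: eventually_mono)
  moreover have "\<forall>\<^sub>F y::real in at_right 0. 0 < y" by (simp add: eventually_at_filter)
  ultimately have "\<forall>\<^sub>F y in at_right 0. 0 < y \<and> y < min Y0 \<delta> \<and> 6 * (y powr (1 - a) / (1 - a)) * M < e / 3"
    by eventually_elim auto
  then obtain Y where Y: "0 < Y" "Y < Y0" "Y < \<delta>" "6 * (Y powr (1 - a) / (1 - a)) * M < e / 3"
    using eventually_happens'[of "at_right (0::real)"] by auto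
  define C where "C = Y powr (1 - a) / (1 - a)"
  define c where "c = Y powr (a + 1) / (a + 1)"
  have Cc: "C > 0" "c > 0" using Y a by (auto simp: C_def c_def)
  \<comment> \<open>The approximation error enters twice, as 3 \<sigma> / c directly and as 6 C
    \<sigma> through the energy of \<phi>_k; this \<sigma> makes the two together equal to
    e/3.\<close>
  define \<sigma> where "\<sigma> = e / (3 * (3 / c + 6 * C))"
  have "3 / c + 6 * C > 0" using Cc by (simp add: add_pos_pos)
  then have "X > 0 \<Longrightarrow> X * (e / (3 * X)) = e / 3" "0 < e / (3 * (3 / c + 6 * C))" for X :: real
    using e by simp_all
  then have \<sigma>: "\<sigma> > 0" "(3 / c + 6 * C) * \<sigma> = e / 3" using \<open>3 / c + 6 * C > 0\<close> unfolding \<sigma>_def by blast+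
  have "\<forall>\<^sub>F k in sequentially. H1a_sqnorm a 1 (\<lambda>z. u' z - \<phi> k z) (\<lambda>z. V' z - grad (\<phi> k) z) \<le> ennreal \<sigma>"
    using lim' \<sigma> by (intro ennreal_tendsto_0D) (auto simp: H1a_lim_def)
  then show "\<forall>\<^sub>F k in sequentially. (\<integral>\<^sup>+x\<in>ball 0 \<rho>. ennreal ((u (x, 0) - \<phi> k (x, 0))\<^sup>2) \<partial>lborel) \<le> ennreal e"
  proof eventually_elim
    fix k
    assume S: "H1a_sqnorm a 1 (\<lambda>z. u' z - \<phi> k z) (\<lambda>z. V' z - grad (\<phi> k) z) \<le> ennreal \<sigma>"
    have F: "H1a_sqnorm a 1 (\<phi> k) (grad (\<phi> k)) \<le> ennreal (2 * M + 2 * \<sigma>)"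
    proof -
      have "H1a_sqnorm a 1 (\<phi> k) (grad (\<phi> k)) = H1a_sqnorm a 1 (\<lambda>z. u' z - (u' z - \<phi> k z)) (\<lambda>z. V' z - (V' z - grad (\<phi> k) z))"
        by simp
      also have "\<dots> \<le> 2 * ennreal M + 2 * ennreal \<sigma>"
        unfolding M(1)[symmetric]
        by (rule order_trans[OF H1a_sqnorm_diff]) (use S in \<open>auto intro!: add_left_mono mult_left_mono\<close>)
      finally show ?thesis using M \<sigma> by (simp add: ennreal_plus ennreal_mult)
    qed
    define b where "b x = (indicator (ball (0::real^'n) \<rho>) x :: ennreal)" for x
    have [measurable]: "b \<in> borel_measurable borel" unfolding b_def[abs_def]
      by (intro borel_measurable_indicator borel_open open_ball)
    define w where "w x = (if x \<in> ball 0 \<rho> then u (x, 0) else 0)" for x :: "real^'n"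
    have cw: "continuous_on (ball 0 \<rho>) (\<lambda>x. u (x, 0))"
      by (intro continuous_on_compose2[OF cont] continuous_intros) (use \<rho> in \<open>auto simp: flat_ball_def\<close>)
    have [measurable]: "w \<in> borel_measurable borel" unfolding w_def[abs_def]
      by (rule borel_measurable_continuous_on_if[OF _ cw]) auto
    have pair0 [measurable]: "(\<lambda>x::real^'n. (x, 0::real)) \<in> borel \<rightarrow>\<^sub>M borel"
      by (intro borel_measurable_continuous_onI continuous_intros)
    define h where "h x = b x * ennreal ((w x - \<phi> k (x, 0))\<^sup>2)" for x
    have [measurable]: "h \<in> borel_measurable borel" unfolding h_def by measurable
    define J where "J z = (indicator {0..Y} (snd z) :: ennreal)" for z :: "(real^'n) \<times> real"
    define G where "G x = (\<integral>\<^sup>+s. ennreal (s powr a * (norm (grad (\<phi> k) (x, s)))\<^sup>2) * indicator {0..Y} s \<partial>lborel)" for x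
    have gm: "(\<lambda>z. ennreal (snd z powr a * (norm (grad (\<phi> k) z))\<^sup>2) * indicator {0..Y} (snd z)) \<in> borel_measurable borel"
      by measurable
    have [measurable]: "G \<in> borel_measurable borel"
      using lborel.borel_measurable_nn_integral_fst[of "\<lambda>z. ennreal (snd z powr a * (norm (grad (\<phi> k) z))\<^sup>2) * indicator {0..Y} (snd z)" "lborel :: (real^'n) measure"] gm
      by (simp add: lborel_prod G_def[abs_def])
    define T where "T = (\<integral>\<^sup>+x\<in>ball 0 \<rho>. ennreal ((u (x, 0) - \<phi> k (x, 0))\<^sup>2) \<partial>lborel)"
    have fst_m [measurable]: "fst \<in> borel \<rightarrow>\<^sub>M (borel :: (real^'n) measure)"
      by (intro borel_measurable_continuous_onI continuous_intros)
    have bG: "(\<integral>\<^sup>+x. b x * G x \<partial>lborel) \<le> ennreal (2 * M + 2 * \<sigma>)"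
    proof -
      have "(\<integral>\<^sup>+x. b x * G x \<partial>lborel) = (\<integral>\<^sup>+x. \<integral>\<^sup>+s. b x * (ennreal (s powr a * (norm (grad (\<phi> k) (x, s)))\<^sup>2) * indicator {0..Y} s) \<partial>lborel \<partial>lborel)"
        unfolding G_def by (intro nn_integral_cong nn_integral_cmult[symmetric]) measurable
      also have "\<dots> = (\<integral>\<^sup>+z. b (fst z) * (ennreal (snd z powr a * (norm (grad (\<phi> k) z))\<^sup>2) * indicator {0..Y} (snd z)) \<partial>lborel)"
      proof -
        have "(\<lambda>z. b (fst z) * (ennreal (snd z powr a * (norm (grad (\<phi> k) z))\<^sup>2) * indicator {0..Y} (snd z))) \<in> borel_measurable borel"
          by measurable
        then show ?thesis
          using lborel.nn_integral_fst[of "\<lambda>z. b (fst z) * (ennreal (snd z powr a * (norm (grad (\<phi> k) z))\<^sup>2) * indicator {0..Y} (snd z))" "lborel :: (real^'n) measure"]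
          by (simp add: lborel_prod)
      qed
      also have "\<dots> \<le> H1a_sqnorm a 1 (\<phi> k) (grad (\<phi> k))"
        unfolding H1a_sqnorm_def
      proof (rule nn_integral_mono_AE)
        have "AE z in (lborel :: ((real^'n) \<times> real) measure). snd z \<noteq> 0" by (rule AE_lborel_snd_nonzero)
        then show "AE z in (lborel :: ((real^'n) \<times> real) measure). b (fst z) * (ennreal (snd z powr a * (norm (grad (\<phi> k) z))\<^sup>2) * indicator {0..Y} (snd z)) \<le>
          ennreal (snd z powr a * ((norm (grad (\<phi> k) z))\<^sup>2 + (\<phi> k z)\<^sup>2)) * indicator (half_ball 1) z"
        proof eventually_elim
          case (elim z)
          show ?case
          proof (cases "fst z \<in> ball 0 \<rho> \<and> snd z \<in> {0..Y}")
            case True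
            then have "z \<in> half_ball 1" using cylinder_subset_half_ball[OF \<rho>, of "fst z" "snd z"] elim Y
              by (auto simp: Y0_def)
            then show ?thesis using True by (auto simp: b_def intro!: ennreal_leI mult_left_mono)
          qed (auto simp: b_def)
        qed
      qed
      also note F
      finally show ?thesis .
    qed
    \<comment> \<open>The three-term splitting at a single point of the layer. Points with y = 0 are
      excluded because u' and u agree only inside the half ball.\<close>
    have main: "ennreal (snd z powr a) * J z * h (fst z) \<le>
        ennreal (snd z powr a) * J z * (ennreal (3 * \<omega>\<^sup>2) * b (fst z) + 3 * ennreal C * (b (fst z) * G (fst z)))
        + 3 * (ennreal (snd z powr a * ((norm (V' z - grad (\<phi> k) z))\<^sup>2 + (u' z - \<phi> k z)\<^sup>2)) * indicator (half_ball 1) z)"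
      if "snd z \<noteq> 0" for z :: "(real^'n) \<times> real"
    proof (cases "fst z \<in> ball 0 \<rho> \<and> snd z \<in> {0..Y}")
      case True
      obtain x y where z: "z = (x, y)" by (cases z)
      with True that have xy: "norm x < \<rho>" "0 < y" "y \<le> Y" by auto
      then have hb: "z \<in> half_ball 1" using cylinder_subset_half_ball[OF \<rho>, of x y] Y z by (auto simp: Y0_def)
      have "dist (x, y) (x, 0) < \<delta>" using xy Y by (simp add: dist_Pair_Pair)
      moreover have "(x, 0) \<in> K" "(x, y) \<in> K" using xy Y by (auto simp: K_def)
      ultimately have "\<bar>u (x, 0) - u (x, y)\<bar> < \<omega>" using \<delta>(2)[of "(x, 0)" "(x, y)"] by (simp add: dist_real_def abs_minus_commute)
      then have w1: "(u (x, 0) - u (x, y))\<^sup>2 \<le> \<omega>\<^sup>2" using \<omega> by (simp add: abs_le_square_iff[symmetric])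
      define p q where "p = u (x, y) - \<phi> k (x, y)" and "q = \<phi> k (x, y) - \<phi> k (x, 0)"
      have "(u (x, 0) - \<phi> k (x, 0))\<^sup>2 \<le> 3 * \<omega>\<^sup>2 + 3 * p\<^sup>2 + 3 * q\<^sup>2"
      proof -
        have "(r + p + q)\<^sup>2 \<le> 3 * r\<^sup>2 + 3 * p\<^sup>2 + 3 * q\<^sup>2" for r :: real
          using sum_squares_ge_zero[of "r - p" "r - q"] zero_le_power2[of "p - q"]
          by (simp add: power2_eq_square algebra_simps)
        from this[of "u (x, 0) - u (x, y)"] w1 show ?thesis by (simp add: p_def q_def)
      qed
      then have "ennreal ((u (x, 0) - \<phi> k (x, 0))\<^sup>2) \<le> ennreal (3 * \<omega>\<^sup>2 + 3 * p\<^sup>2 + 3 * q\<^sup>2)" by (rule ennreal_leI)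
      also have "\<dots> = ennreal (3 * \<omega>\<^sup>2) + 3 * ennreal (p\<^sup>2) + 3 * ennreal (q\<^sup>2)"
        by (simp add: ennreal_plus ennreal_mult)
      also have "\<dots> \<le> ennreal (3 * \<omega>\<^sup>2) + 3 * ennreal (p\<^sup>2) + 3 * (ennreal C * G x)"
        unfolding q_def C_def G_def
        by (intro add_left_mono mult_left_mono vertical_difference_bound a(2) \<phi>) (use xy in auto)
      finally have "ennreal (y powr a) * ennreal ((u (x, 0) - \<phi> k (x, 0))\<^sup>2) \<le>
        ennreal (y powr a) * (ennreal (3 * \<omega>\<^sup>2) + 3 * ennreal (p\<^sup>2) + 3 * (ennreal C * G x))"
        by (rule mult_left_mono) simp
      also have "\<dots> = ennreal (y powr a) * (ennreal (3 * \<omega>\<^sup>2) + 3 * (ennreal C * G x)) + 3 * ennreal (y powr a * p\<^sup>2)"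
        by (simp add: ennreal_mult' algebra_simps)
      also have "\<dots> \<le> ennreal (y powr a) * (ennreal (3 * \<omega>\<^sup>2) + 3 * (ennreal C * G x)) +
        3 * ennreal (y powr a * ((norm (V' z - grad (\<phi> k) z))\<^sup>2 + (u' z - \<phi> k z)\<^sup>2))"
        using eq[OF hb] by (intro add_left_mono mult_left_mono ennreal_leI) (auto simp: p_def z)
      finally show ?thesis using xy hb by (simp add: z J_def h_def b_def w_def mult.assoc)
    qed (auto simp: J_def h_def b_def)
    have T_h: "T = (\<integral>\<^sup>+x. h x \<partial>lborel)"
      unfolding T_def by (rule nn_integral_cong) (auto simp: h_def b_def w_def split: split_indicator)
    \<comment> \<open>The trace error does not depend on the height, so integrating it over the
      layer multiplies it by the weighted thickness c.\<close>
    have "ennreal c * T = (\<integral>\<^sup>+z. ennreal (snd z powr a) * indicator {0..Y} (snd z) * h (fst z) \<partial>lborel)"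
      unfolding c_def T_h using Y by (subst nn_integral_weight_fun[OF a(1)]) auto
    also have "\<dots> \<le> (\<integral>\<^sup>+z. ennreal (snd z powr a) * indicator {0..Y} (snd z) * (ennreal (3 * \<omega>\<^sup>2) * b (fst z) + 3 * ennreal C * (b (fst z) * G (fst z)))
        + 3 * (ennreal (snd z powr a * ((norm (V' z - grad (\<phi> k) z))\<^sup>2 + (u' z - \<phi> k z)\<^sup>2)) * indicator (half_ball 1) z) \<partial>lborel)"
    proof (rule nn_integral_mono_AE)
      have "AE z in (lborel :: ((real^'n) \<times> real) measure). snd z \<noteq> 0" by (rule AE_lborel_snd_nonzero)
      then show "AE z in (lborel :: ((real^'n) \<times> real) measure). ennreal (snd z powr a) * indicator {0..Y} (snd z) * h (fst z) \<le> ennreal (snd z powr a) * indicator {0..Y} (snd z) * (ennreal (3 * \<omega>\<^sup>2) * b (fst z) + 3 * ennreal C * (b (fst z) * G (fst z)))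
        + 3 * (ennreal (snd z powr a * ((norm (V' z - grad (\<phi> k) z))\<^sup>2 + (u' z - \<phi> k z)\<^sup>2)) * indicator (half_ball 1) z)"
        by eventually_elim (use main in \<open>simp add: J_def\<close>)
    qed
    also have "\<dots> = (\<integral>\<^sup>+z. ennreal (snd z powr a) * indicator {0..Y} (snd z) * (ennreal (3 * \<omega>\<^sup>2) * b (fst z) + 3 * ennreal C * (b (fst z) * G (fst z))) \<partial>lborel)
        + 3 * H1a_sqnorm a 1 (\<lambda>z. u' z - \<phi> k z) (\<lambda>z. V' z - grad (\<phi> k) z)"
      unfolding H1a_sqnorm_def by (subst nn_integral_add) (measurable, simp add: nn_integral_cmult)
    also have "(\<integral>\<^sup>+z. ennreal (snd z powr a) * indicator {0..Y} (snd z) * (ennreal (3 * \<omega>\<^sup>2) * b (fst z) + 3 * ennreal C * (b (fst z) * G (fst z))) \<partial>lborel)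
        = ennreal c * (\<integral>\<^sup>+x. ennreal (3 * \<omega>\<^sup>2) * b x + 3 * ennreal C * (b x * G x) \<partial>lborel)"
      unfolding c_def using Y by (subst nn_integral_weight_fun[OF a(1), of Y, symmetric]) auto
    also have "(\<integral>\<^sup>+x. ennreal (3 * \<omega>\<^sup>2) * b x + 3 * ennreal C * (b x * G x) \<partial>lborel)
        = ennreal (3 * \<omega>\<^sup>2) * ennreal B + 3 * ennreal C * (\<integral>\<^sup>+x. b x * G x \<partial>lborel)"
    proof -
      have "(\<integral>\<^sup>+x. b x \<partial>lborel) = ennreal B" by (simp add: b_def B(1))
      then show ?thesis by (simp add: nn_integral_add nn_integral_cmult mult.assoc)
    qed
    finally have "ennreal c * T \<le> ennreal c * (ennreal (3 * \<omega>\<^sup>2) * ennreal B + 3 * ennreal C * (\<integral>\<^sup>+x. b x * G x \<partial>lborel))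
       + 3 * H1a_sqnorm a 1 (\<lambda>z. u' z - \<phi> k z) (\<lambda>z. V' z - grad (\<phi> k) z)" .
    also have "\<dots> \<le> ennreal c * (ennreal (3 * \<omega>\<^sup>2) * ennreal B + 3 * ennreal C * ennreal (2 * M + 2 * \<sigma>)) + 3 * ennreal \<sigma>"
      using bG S by (intro add_mono mult_left_mono) auto
    also have "\<dots> = ennreal (c * (3 * \<omega>\<^sup>2 * B + 3 * C * (2 * M + 2 * \<sigma>)) + 3 * \<sigma>)"
    proof -
      have 3: "3 * ennreal x = ennreal (3 * x)" for x :: real
        using ennreal_mult'[of 3 x] by simp
      show ?thesis
        using Cc B(2) M(2) \<sigma>(1)
        by (simp add: 3 ennreal_mult'[symmetric] ennreal_plus[symmetric] mult.assoc[symmetric] del: ennreal_plus)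
    qed
    also have "\<dots> \<le> ennreal (c * e)"
    proof (rule ennreal_leI)
      have "c * (3 * \<omega>\<^sup>2 * B + 3 * C * (2 * M + 2 * \<sigma>)) + 3 * \<sigma> = c * (3 * \<omega>\<^sup>2 * B + 6 * C * M + (3 / c + 6 * C) * \<sigma>)"
        using Cc by (simp add: field_simps)
      also have "\<dots> \<le> c * (e / 3 + e / 3 + e / 3)"
        using \<omega>(2) Y(4) \<sigma>(2) Cc unfolding C_def[symmetric] by (intro mult_left_mono add_mono) auto
      finally show "c * (3 * \<omega>\<^sup>2 * B + 3 * C * (2 * M + 2 * \<sigma>)) + 3 * \<sigma> \<le> c * e" by simp
    qed
    finally have "ennreal c * T \<le> ennreal c * ennreal e" using Cc by (simp add: ennreal_mult')
    then show "(\<integral>\<^sup>+x\<in>ball 0 \<rho>. ennreal ((u (x, 0) - \<phi> k (x, 0))\<^sup>2) \<partial>lborel) \<le> ennreal e"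
      using Cc unfolding T_def[symmetric] by (subst (asm) ennreal_mult_le_mult_iff) auto
  qed
qed

subsection \<open>The derivative along rays\<close>

lemma nn_integral_bound_integral:
  fixes f :: "real \<Rightarrow> real"
  assumes "continuous_on {\<alpha>..\<beta>} f"
  shows "ennreal \<bar>integral {\<alpha>..\<beta>} f\<bar> \<le> (\<integral>\<^sup>+s. ennreal \<bar>f s\<bar> * indicator {\<alpha>..\<beta>} s \<partial>lborel)"
proof -
  have int: "set_integrable lborel {\<alpha>..\<beta>} f" using assms by (rule borel_integrable_atLeastAtMost')
  have "ennreal (norm (LINT s|lborel. indicator {\<alpha>..\<beta>} s *\<^sub>R f s)) \<le> (\<integral>\<^sup>+s. ennreal (norm (indicator {\<alpha>..\<beta>} s *\<^sub>R f s)) \<partial>lborel)"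
    using int unfolding set_integrable_def by (rule integral_norm_bound_ennreal)
  also have "\<dots> = (\<integral>\<^sup>+s. ennreal \<bar>f s\<bar> * indicator {\<alpha>..\<beta>} s \<partial>lborel)"
    by (intro nn_integral_cong) (auto split: split_indicator)
  finally show ?thesis
    using set_borel_integral_eq_integral(2)[OF int] by (simp add: set_lebesgue_integral_def)
qed

lemma nn_integral_square_bound:
  fixes f :: "real \<Rightarrow> real"
  assumes [measurable]: "f \<in> borel_measurable borel" and "\<alpha> \<le> \<beta>"
  shows "(\<integral>\<^sup>+s. ennreal \<bar>f s\<bar> * indicator {\<alpha>..\<beta>} s \<partial>lborel)\<^sup>2 \<le>
    ennreal (\<beta> - \<alpha>) * (\<integral>\<^sup>+s. ennreal ((f s)\<^sup>2) * indicator {\<alpha>..\<beta>} s \<partial>lborel)"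
proof -
  let ?I = "\<lambda>s. indicator {\<alpha>..\<beta>} s :: real"
  have "(\<integral>\<^sup>+s. ennreal \<bar>f s\<bar> * indicator {\<alpha>..\<beta>} s \<partial>lborel) = (\<integral>\<^sup>+s. ennreal \<bar>?I s * (?I s * f s)\<bar> \<partial>lborel)"
    by (intro nn_integral_cong) (auto split: split_indicator)
  moreover have "(\<integral>\<^sup>+s. ennreal ((?I s)\<^sup>2) \<partial>lborel) = ennreal (\<beta> - \<alpha>)"
  proof -
    have "(\<integral>\<^sup>+s. ennreal ((?I s)\<^sup>2) \<partial>lborel) = (\<integral>\<^sup>+s. indicator {\<alpha>..\<beta>} s \<partial>lborel)"
      by (intro nn_integral_cong) (auto split: split_indicator)
    then show ?thesis using assms(2) by simp
  qed
  moreover have "(\<integral>\<^sup>+s. ennreal ((?I s * f s)\<^sup>2) \<partial>lborel) = (\<integral>\<^sup>+s. ennreal ((f s)\<^sup>2) * indicator {\<alpha>..\<beta>} s \<partial>lborel)"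
    by (intro nn_integral_cong) (auto split: split_indicator)
  ultimately show ?thesis using nn_integral_Cauchy_Schwarz[of ?I lborel "\<lambda>s. ?I s * f s"] by simp
qed

lemma continuous_on_zero_of_nn_integral_zero:
  fixes w :: "'a::euclidean_space \<Rightarrow> real"
  assumes c: "continuous_on (cball z0 \<delta>) w" and \<delta>: "\<delta> > 0"
    and z: "(\<integral>\<^sup>+z. ennreal ((w z)\<^sup>2) * indicator (cball z0 \<delta>) z \<partial>lborel) = 0"
  shows "w z0 = 0"
proof (rule ccontr)
  assume nz: "w z0 \<noteq> 0"
  have "\<exists>\<epsilon>>0. \<forall>z\<in>cball z0 \<delta>. dist z z0 < \<epsilon> \<longrightarrow> dist (w z) (w z0) < \<bar>w z0\<bar> / 2"
    using c \<delta> nz unfolding continuous_on_iff by (metis centre_in_cball half_gt_zero less_imp_le zero_less_abs_iff)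
  then obtain \<epsilon> where \<epsilon>: "\<epsilon> > 0" "\<And>z. z \<in> cball z0 \<delta> \<Longrightarrow> dist z z0 < \<epsilon> \<Longrightarrow> dist (w z) (w z0) < \<bar>w z0\<bar> / 2" by blast
  define r where "r = min \<epsilon> \<delta>"
  have r: "r > 0" using \<epsilon> \<delta> by (simp add: r_def)
  have big: "(\<bar>w z0\<bar> / 2)\<^sup>2 \<le> (w z)\<^sup>2" if "z \<in> ball z0 r" for z
  proof -
    have "dist (w z) (w z0) < \<bar>w z0\<bar> / 2" using that \<epsilon>(2)[of z] by (simp add: r_def dist_commute)
    then have "\<bar>w z0\<bar> / 2 \<le> \<bar>w z\<bar>" unfolding dist_real_def by linarith
    then show ?thesis by (metis abs_ge_zero abs_le_square_iff abs_of_nonneg divide_nonneg_nonneg zero_le_numeral power2_abs)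
  qed
  have "ennreal ((\<bar>w z0\<bar> / 2)\<^sup>2) * emeasure lborel (ball z0 r) = (\<integral>\<^sup>+z. ennreal ((\<bar>w z0\<bar> / 2)\<^sup>2) * indicator (ball z0 r) z \<partial>lborel)"
    by (rule nn_integral_cmult_indicator[symmetric]) simp
  also have "\<dots> \<le> (\<integral>\<^sup>+z. ennreal ((w z)\<^sup>2) * indicator (cball z0 \<delta>) z \<partial>lborel)"
    by (intro nn_integral_mono) (use big in \<open>auto simp: r_def intro!: ennreal_leI split: split_indicator\<close>)
  finally have "ennreal ((\<bar>w z0\<bar> / 2)\<^sup>2) * emeasure lborel (ball z0 r) = 0" using z by simp
  moreover have "emeasure lborel (ball z0 r) \<noteq> 0" using r by (simp add: emeasure_ball unit_ball_vol_pos less_imp_neq[symmetric] ennreal_eq_0_iff not_le)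
  ultimately show False using nz by (auto simp: ennreal_eq_0_iff)
qed

text \<open>A single ray is a null set, invisible to L^2 convergence. The defect w(z) of the
  identity along the ray through z is therefore integrated over a ball of base points z. The smooth
  \<phi>_k have no defect, so the integral of w^2 is bounded by the approximation error of \<phi>_k
  and hence is 0; continuity of w gives the value at z0.\<close>

lemma H1a_lim_ray:
  fixes u :: "(real^'n) \<times> real \<Rightarrow> real"
  assumes \<phi>: "\<And>k. smooth (\<phi> k)" and lim: "H1a_lim a 1 \<phi> u V" and R: "R \<le> 1"
    and cu: "continuous_on (half_ball R) u" and cV: "continuous_on (half_ball R) V"
    and \<alpha>\<beta>: "0 < \<alpha>" "\<alpha> \<le> \<beta>" and z0: "\<beta> *\<^sub>R z0 \<in> half_ball R"
  shows "u (\<beta> *\<^sub>R z0) - u (\<alpha> *\<^sub>R z0) = integral {\<alpha>..\<beta>} (\<lambda>t. V (t *\<^sub>R z0) \<bullet> z0)"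
proof -
  obtain u' V' where uV [measurable]: "u' \<in> borel_measurable borel" "V' \<in> borel_measurable borel"
    and lim': "H1a_lim a 1 \<phi> u' V'" and eq: "\<And>z. z \<in> half_ball 1 \<Longrightarrow> u' z = u z \<and> V' z = V z"
    using H1a_lim_borel[OF lim] by blast
  note [measurable] = borel_measurable_smooth[OF \<phi>]
  \<comment> \<open>Base points near z0 for which the whole segment from \<alpha> z to \<beta> z
    stays in the half ball, at height at least \<alpha> (snd z0) / 2.\<close>
  define U where "U = {z :: (real^'n) \<times> real. norm (\<beta> *\<^sub>R z) < R} \<inter> {z. snd z0 / 2 < snd z}"
  have "open U" unfolding U_def by (intro open_Int open_Collect_less continuous_intros)
  have \<beta>: "\<beta> > 0" using \<alpha>\<beta> by simp
  have y0: "snd z0 > 0" using z0 \<beta> by (simp add: half_ball_def zero_less_mult_iff)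
  then have "z0 \<in> U" using z0 by (simp add: U_def half_ball_def)
  with \<open>open U\<close> obtain \<delta> where \<delta>: "\<delta> > 0" "cball z0 \<delta> \<subseteq> U" by (auto simp: open_contains_cball)
  define K where "K = cball z0 \<delta>"
  have inU: "t *\<^sub>R z \<in> half_ball R" "t *\<^sub>R z \<in> half_ball 1" "\<alpha> * snd z0 / 2 \<le> snd (t *\<^sub>R z)" "snd (t *\<^sub>R z) \<le> 1" "norm z \<le> 1 / \<beta>"
    if "z \<in> K" "t \<in> {\<alpha>..\<beta>}" for z t
  proof -
    have z: "norm (\<beta> *\<^sub>R z) < R" "snd z0 / 2 < snd z" using that \<delta> by (auto simp: K_def U_def)
    have "t * norm z \<le> \<beta> * norm z" using that by (intro mult_right_mono) auto
    then have n: "norm (t *\<^sub>R z) < R" using z \<alpha>\<beta> that by simp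
    then show "t *\<^sub>R z \<in> half_ball R" "t *\<^sub>R z \<in> half_ball 1" using R z y0 \<alpha>\<beta> that by (auto simp: half_ball_def)
    show "snd (t *\<^sub>R z) \<le> 1"
    proof -
      have "snd p \<le> norm p" for p :: "(real^'n) \<times> real" using norm_snd_le[of "snd p" "fst p"] by simp
      from this[of "t *\<^sub>R z"] n R show ?thesis by linarith
    qed
    have "\<alpha> * (snd z0 / 2) \<le> t * snd z" using that z y0 \<alpha>\<beta> by (intro mult_mono) auto
    then show "\<alpha> * snd z0 / 2 \<le> snd (t *\<^sub>R z)" by simp
    have "\<beta> * norm z \<le> 1" using z R \<beta> by simp
    then show "norm z \<le> 1 / \<beta>" using \<beta> by (simp add: field_simps)
  qed
  \<comment> \<open>A lower bound for the weight on all these segments: for a >= 0 it comes from the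
    lower bound on the height, for a < 0 from heights being at most 1.\<close>
  define m where "m = min ((\<alpha> * snd z0 / 2) powr a) 1"
  have m: "m > 0" using \<alpha>\<beta> y0 by (simp add: m_def)
  have ma: "m \<le> snd (t *\<^sub>R z) powr a" if "z \<in> K" "t \<in> {\<alpha>..\<beta>}" for z t
  proof (cases "a \<ge> 0")
    case True
    then show ?thesis using inU(3)[OF that] \<alpha>\<beta> y0 by (auto simp: m_def min_le_iff_disj intro!: powr_mono2)
  next
    case False
    have "0 < snd (t *\<^sub>R z)" using inU(2)[OF that] by (simp add: half_ball_def)
    then have "1 \<le> snd (t *\<^sub>R z) powr a" using inU(4)[OF that] False powr_mono2'[of a "snd (t *\<^sub>R z)" 1] by simp
    then show ?thesis by (simp add: m_def min_le_iff_disj)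
  qed
  define w where "w z = u (\<beta> *\<^sub>R z) - u (\<alpha> *\<^sub>R z) - integral {\<alpha>..\<beta>} (\<lambda>t. V (t *\<^sub>R z) \<bullet> z)" for z
  have cw: "continuous_on K w"
    unfolding w_def cbox_interval[symmetric]
  proof (intro continuous_on_diff integral_continuous_on_param)
    show "continuous_on K (\<lambda>z. u (\<beta> *\<^sub>R z))" "continuous_on K (\<lambda>z. u (\<alpha> *\<^sub>R z))"
      using inU(1) \<alpha>\<beta> by (auto intro!: continuous_on_compose2[OF cu] continuous_intros)
    show "continuous_on (K \<times> cbox \<alpha> \<beta>) (\<lambda>(z, t). V (t *\<^sub>R z) \<bullet> z)"
      unfolding split_beta
      by (intro continuous_intros continuous_on_compose2[OF cV]) (use inU(1) in auto)
  qed
  \<comment> \<open>The two endpoint errors give 3 * 2. In the integral term, (1/\<beta>)^2 bounds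
    |z|^2, one factor \<beta> - \<alpha> comes from Cauchy-Schwarz in t and the other from
    integrating the bound over t.\<close>
  define C where "C = 3 * 2 + 3 * ((1 / \<beta>)\<^sup>2 * (\<beta> - \<alpha>) * (\<beta> - \<alpha>))"
  have C: "C \<ge> 0" using \<alpha>\<beta> by (simp add: C_def)
  \<comment> \<open>The price of moving from z to t z: the Jacobian t^(-(N+1)) is largest at t =
    \<alpha>, and 1/m inserts the weight.\<close>
  define P where "P = inverse (\<alpha> ^ DIM((real^'n) \<times> real)) * inverse m"
  have P: "P > 0" using \<alpha>\<beta> m by (simp add: P_def)
  define S where "S k = H1a_sqnorm a 1 (\<lambda>z. u' z - \<phi> k z) (\<lambda>z. V' z - grad (\<phi> k) z)" for k
  have S0: "S \<longlonglongrightarrow> 0" using lim' by (simp add: H1a_lim_def S_def[abs_def])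
  have bound: "(\<integral>\<^sup>+z. ennreal ((w z)\<^sup>2) * indicator K z \<partial>lborel) \<le> ennreal (C * P) * S k" for k
  proof -
    define e where "e z = (u' z - \<phi> k z)\<^sup>2" for z
    define d where "d z = (norm (V' z - grad (\<phi> k) z))\<^sup>2" for z
    have [measurable]: "e \<in> borel_measurable borel" "d \<in> borel_measurable borel"
      by (simp_all add: e_def[abs_def] d_def[abs_def])
    have [measurable]: "K \<in> sets borel" by (simp add: K_def)
    \<comment> \<open>For fixed t the dilation by t maps the ball K into the unit half ball, so an
      error sampled at t z integrates to a multiple of the full approximation error.\<close>
    have sub: "(\<integral>\<^sup>+z. ennreal (g (t *\<^sub>R z)) * indicator K z \<partial>lborel) \<le> ennreal P * S k"
      if t: "t \<in> {\<alpha>..\<beta>}" and [measurable]: "g \<in> borel_measurable borel" and g: "\<And>z. 0 \<le> g z" "\<And>z. g z \<le> d z + e z" for g t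
    proof -
      define F where "F z = ennreal (snd z powr a * ((norm (V' z - grad (\<phi> k) z))\<^sup>2 + (u' z - \<phi> k z)\<^sup>2)) * indicator (half_ball 1) z" for z
      have [measurable]: "F \<in> borel_measurable borel" by (simp add: F_def[abs_def])
      have t0: "t > 0" using t \<alpha>\<beta> by simp
      have "(\<integral>\<^sup>+z. ennreal (g (t *\<^sub>R z)) * indicator K z \<partial>lborel) \<le> (\<integral>\<^sup>+z. ennreal (inverse m) * F (t *\<^sub>R z) \<partial>lborel)"
      proof (rule nn_integral_mono)
        fix z
        show "ennreal (g (t *\<^sub>R z)) * indicator K z \<le> ennreal (inverse m) * F (t *\<^sub>R z)"
        proof (cases "z \<in> K")
          case True
          have "g (t *\<^sub>R z) \<le> d (t *\<^sub>R z) + e (t *\<^sub>R z)" by (rule g)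
          also have "\<dots> = inverse m * (m * (d (t *\<^sub>R z) + e (t *\<^sub>R z)))" using m by simp
          also have "\<dots> \<le> inverse m * (snd (t *\<^sub>R z) powr a * (d (t *\<^sub>R z) + e (t *\<^sub>R z)))"
            using m ma[OF True t] by (intro mult_left_mono mult_right_mono) (auto simp: d_def e_def)
          finally have "ennreal (g (t *\<^sub>R z)) \<le> ennreal (inverse m * (snd (t *\<^sub>R z) powr a * (d (t *\<^sub>R z) + e (t *\<^sub>R z))))"
            by (rule ennreal_leI)
          then show ?thesis using True inU(2)[OF True t] m by (simp add: F_def d_def e_def ennreal_mult')
        qed simp
      qed
      also have "\<dots> = ennreal (inverse m) * (\<integral>\<^sup>+z. F (t *\<^sub>R z) \<partial>lborel)" by (rule nn_integral_cmult) measurable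
      also have "(\<integral>\<^sup>+z. F (t *\<^sub>R z) \<partial>lborel) = ennreal (inverse (t ^ DIM((real^'n) \<times> real))) * S k"
      proof -
        have "S k = ennreal (t ^ DIM((real^'n) \<times> real)) * (\<integral>\<^sup>+z. F (t *\<^sub>R z) \<partial>lborel)"
          unfolding S_def H1a_sqnorm_def F_def[symmetric] by (rule nn_integral_lborel_scale) (use t0 in auto)
        moreover have "ennreal (inverse T) * (ennreal T * I) = I" if "T > 0" for T I
          using that by (simp add: mult.assoc[symmetric] ennreal_mult'[symmetric])
        ultimately show ?thesis using t0 zero_less_power by metis
      qed
      also have "ennreal (inverse m) * (ennreal (inverse (t ^ DIM((real^'n) \<times> real))) * S k) \<le> ennreal P * S k"
      proof -
        have "inverse m * inverse (t ^ DIM((real^'n) \<times> real)) \<le> P"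
          unfolding P_def using t \<alpha>\<beta> m by (subst mult.commute) (intro mult_right_mono le_imp_inverse_le power_mono; simp)
        then show ?thesis using m by (simp add: mult.assoc[symmetric] ennreal_mult'[symmetric] mult_right_mono ennreal_leI)
      qed
      finally show ?thesis .
    qed
    have pw: "ennreal ((w z)\<^sup>2) * indicator K z \<le> 3 * (ennreal (e (\<beta> *\<^sub>R z)) * indicator K z) + 3 * (ennreal (e (\<alpha> *\<^sub>R z)) * indicator K z)
      + 3 * (ennreal ((1 / \<beta>)\<^sup>2 * (\<beta> - \<alpha>)) * (\<integral>\<^sup>+t. ennreal (d (t *\<^sub>R z)) * indicator K z * indicator {\<alpha>..\<beta>} t \<partial>lborel))" for z
    proof (cases "z \<in> K")
      case True
      have ftc: "\<phi> k (\<beta> *\<^sub>R z) - \<phi> k (\<alpha> *\<^sub>R z) = integral {\<alpha>..\<beta>} (\<lambda>t. grad (\<phi> k) (t *\<^sub>R z) \<bullet> z)"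
        using smooth_line_deriv[OF \<phi>[of k], of 0 z] \<alpha>\<beta>
        by (intro integral_unique[symmetric] fundamental_theorem_of_calculus)
           (auto simp: has_real_derivative_iff_has_vector_derivative[symmetric] intro: DERIV_subset)
      have c1: "continuous_on {\<alpha>..\<beta>} (\<lambda>t. V (t *\<^sub>R z) \<bullet> z)"
        using inU(1)[OF True] by (intro continuous_intros continuous_on_compose2[OF cV]) auto
      have c2: "continuous_on {\<alpha>..\<beta>} (\<lambda>t. grad (\<phi> k) (t *\<^sub>R z) \<bullet> z)"
        by (intro continuous_intros continuous_on_compose2[OF smoothD(3)[OF \<phi>]]) auto
      define f where "f t = (V (t *\<^sub>R z) - grad (\<phi> k) (t *\<^sub>R z)) \<bullet> z" for t
      have cf: "continuous_on {\<alpha>..\<beta>} f" using continuous_on_diff[OF c1 c2] by (simp add: f_def[abs_def] inner_diff_left)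
      have If: "integral {\<alpha>..\<beta>} f = integral {\<alpha>..\<beta>} (\<lambda>t. V (t *\<^sub>R z) \<bullet> z) - integral {\<alpha>..\<beta>} (\<lambda>t. grad (\<phi> k) (t *\<^sub>R z) \<bullet> z)"
        unfolding f_def inner_diff_left by (intro Henstock_Kurzweil_Integration.integral_diff integrable_continuous_interval c1 c2)
      define p q where "p = u (\<beta> *\<^sub>R z) - \<phi> k (\<beta> *\<^sub>R z)" and "q = u (\<alpha> *\<^sub>R z) - \<phi> k (\<alpha> *\<^sub>R z)"
      have w: "w z = p - q - integral {\<alpha>..\<beta>} f" by (simp add: w_def If ftc[symmetric] p_def q_def)
      have "(w z)\<^sup>2 \<le> 3 * p\<^sup>2 + 3 * q\<^sup>2 + 3 * (integral {\<alpha>..\<beta>} f)\<^sup>2"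
      proof -
        have "(p - q - r)\<^sup>2 \<le> 3 * p\<^sup>2 + 3 * q\<^sup>2 + 3 * r\<^sup>2" for r :: real
          using sum_squares_ge_zero[of "p + q" "p + r"] zero_le_power2[of "q - r"]
          by (simp add: power2_eq_square algebra_simps)
        then show ?thesis by (simp add: w)
      qed
      then have "ennreal ((w z)\<^sup>2) \<le> ennreal (3 * p\<^sup>2 + 3 * q\<^sup>2 + 3 * (integral {\<alpha>..\<beta>} f)\<^sup>2)" by (rule ennreal_leI)
      also have "\<dots> = 3 * ennreal (p\<^sup>2) + 3 * ennreal (q\<^sup>2) + 3 * ennreal ((integral {\<alpha>..\<beta>} f)\<^sup>2)"
        by (simp add: ennreal_plus ennreal_mult)
      also have "ennreal ((integral {\<alpha>..\<beta>} f)\<^sup>2) \<le> ennreal ((1 / \<beta>)\<^sup>2 * (\<beta> - \<alpha>)) * (\<integral>\<^sup>+t. ennreal (d (t *\<^sub>R z)) * indicator {\<alpha>..\<beta>} t \<partial>lborel)"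
      proof -
        define D where "D t = sqrt (d (t *\<^sub>R z)) / \<beta>" for t
        have [measurable]: "D \<in> borel_measurable borel" by (simp add: D_def[abs_def])
        have fD: "\<bar>f t\<bar> \<le> \<bar>D t\<bar>" if "t \<in> {\<alpha>..\<beta>}" for t
        proof -
          have "\<bar>f t\<bar> \<le> norm (V (t *\<^sub>R z) - grad (\<phi> k) (t *\<^sub>R z)) * norm z" unfolding f_def by (rule Cauchy_Schwarz_ineq2)
          also have "\<dots> \<le> norm (V (t *\<^sub>R z) - grad (\<phi> k) (t *\<^sub>R z)) * (1 / \<beta>)"
            using inU(5)[OF True that] by (intro mult_left_mono) auto
          also have "\<dots> = D t" using eq[OF inU(2)[OF True that]] by (simp add: D_def d_def)
          finally show ?thesis by simp
        qed
        have "ennreal ((integral {\<alpha>..\<beta>} f)\<^sup>2) = (ennreal \<bar>integral {\<alpha>..\<beta>} f\<bar>)\<^sup>2" by (simp add: ennreal_power)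
        also have "\<dots> \<le> (\<integral>\<^sup>+t. ennreal \<bar>f t\<bar> * indicator {\<alpha>..\<beta>} t \<partial>lborel)\<^sup>2"
          by (intro power_mono nn_integral_bound_integral cf) simp
        also have "\<dots> \<le> (\<integral>\<^sup>+t. ennreal \<bar>D t\<bar> * indicator {\<alpha>..\<beta>} t \<partial>lborel)\<^sup>2"
          by (intro power_mono nn_integral_mono) (use fD in \<open>auto intro!: ennreal_leI split: split_indicator\<close>)
        also have "\<dots> \<le> ennreal (\<beta> - \<alpha>) * (\<integral>\<^sup>+t. ennreal ((D t)\<^sup>2) * indicator {\<alpha>..\<beta>} t \<partial>lborel)"
          by (rule nn_integral_square_bound) (use \<alpha>\<beta> in auto)
        also have "(\<integral>\<^sup>+t. ennreal ((D t)\<^sup>2) * indicator {\<alpha>..\<beta>} t \<partial>lborel) = (\<integral>\<^sup>+t. ennreal ((1 / \<beta>)\<^sup>2) * (ennreal (d (t *\<^sub>R z)) * indicator {\<alpha>..\<beta>} t) \<partial>lborel)"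
          by (intro nn_integral_cong) (auto simp: D_def d_def power_divide ennreal_mult'[symmetric] split: split_indicator)
        also have "\<dots> = ennreal ((1 / \<beta>)\<^sup>2) * (\<integral>\<^sup>+t. ennreal (d (t *\<^sub>R z)) * indicator {\<alpha>..\<beta>} t \<partial>lborel)"
          by (rule nn_integral_cmult) measurable
        finally show ?thesis using \<alpha>\<beta> by (simp add: ennreal_mult' mult_ac)
      qed
      finally show ?thesis using True eq[OF inU(2)[OF True, of \<beta>]] eq[OF inU(2)[OF True, of \<alpha>]] \<alpha>\<beta>
        by (simp add: e_def p_def q_def add_left_mono mult_left_mono)
    qed simp
    have "(\<integral>\<^sup>+z. ennreal ((w z)\<^sup>2) * indicator K z \<partial>lborel) \<le> (\<integral>\<^sup>+z. 3 * (ennreal (e (\<beta> *\<^sub>R z)) * indicator K z) + 3 * (ennreal (e (\<alpha> *\<^sub>R z)) * indicator K z)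
      + 3 * (ennreal ((1 / \<beta>)\<^sup>2 * (\<beta> - \<alpha>)) * (\<integral>\<^sup>+t. ennreal (d (t *\<^sub>R z)) * indicator K z * indicator {\<alpha>..\<beta>} t \<partial>lborel)) \<partial>lborel)"
      by (intro nn_integral_mono pw)
    also have "\<dots> = 3 * (\<integral>\<^sup>+z. ennreal (e (\<beta> *\<^sub>R z)) * indicator K z \<partial>lborel) + 3 * (\<integral>\<^sup>+z. ennreal (e (\<alpha> *\<^sub>R z)) * indicator K z \<partial>lborel)
      + 3 * (ennreal ((1 / \<beta>)\<^sup>2 * (\<beta> - \<alpha>)) * (\<integral>\<^sup>+z. \<integral>\<^sup>+t. ennreal (d (t *\<^sub>R z)) * indicator K z * indicator {\<alpha>..\<beta>} t \<partial>lborel \<partial>lborel))"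
      by (simp add: nn_integral_add nn_integral_cmult)
    also have "(\<integral>\<^sup>+z. \<integral>\<^sup>+t. ennreal (d (t *\<^sub>R z)) * indicator K z * indicator {\<alpha>..\<beta>} t \<partial>lborel \<partial>lborel)
      = (\<integral>\<^sup>+t. \<integral>\<^sup>+z. ennreal (d (t *\<^sub>R z)) * indicator K z * indicator {\<alpha>..\<beta>} t \<partial>lborel \<partial>lborel)"
      by (rule lborel_pair.Fubini'[symmetric]) measurable
    also have "\<dots> \<le> (\<integral>\<^sup>+t. ennreal P * S k * indicator {\<alpha>..\<beta>} t \<partial>lborel)"
    proof (rule nn_integral_mono)
      fix t
      show "(\<integral>\<^sup>+z. ennreal (d (t *\<^sub>R z)) * indicator K z * indicator {\<alpha>..\<beta>} t \<partial>lborel) \<le> ennreal P * S k * indicator {\<alpha>..\<beta>} t"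
      proof (cases "t \<in> {\<alpha>..\<beta>}")
        case True
        then show ?thesis using sub[OF True, of d] by (simp add: d_def[abs_def] e_def)
      qed simp
    qed
    also have "\<dots> = ennreal P * S k * ennreal (\<beta> - \<alpha>)"
      using \<alpha>\<beta> by (simp add: nn_integral_cmult)
    finally have "(\<integral>\<^sup>+z. ennreal ((w z)\<^sup>2) * indicator K z \<partial>lborel) \<le>
      3 * (\<integral>\<^sup>+z. ennreal (e (\<beta> *\<^sub>R z)) * indicator K z \<partial>lborel) + 3 * (\<integral>\<^sup>+z. ennreal (e (\<alpha> *\<^sub>R z)) * indicator K z \<partial>lborel)
      + 3 * (ennreal ((1 / \<beta>)\<^sup>2 * (\<beta> - \<alpha>)) * (ennreal P * S k * ennreal (\<beta> - \<alpha>)))"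
      by (simp add: add_left_mono mult_left_mono)
    also have "\<dots> \<le> 3 * (ennreal P * S k) + 3 * (ennreal P * S k) + 3 * (ennreal ((1 / \<beta>)\<^sup>2 * (\<beta> - \<alpha>)) * (ennreal P * S k * ennreal (\<beta> - \<alpha>)))"
    proof -
      have "0 \<le> e z" "e z \<le> d z + e z" for z by (simp_all add: d_def e_def)
      with sub[of \<beta> e] sub[of \<alpha> e] \<alpha>\<beta> show ?thesis
        by (intro add_right_mono[OF add_mono[OF mult_left_mono mult_left_mono]]) simp_all
    qed
    also have "\<dots> = ennreal (C * P) * S k"
    proof -
      define X where "X = (1 / \<beta>)\<^sup>2 * (\<beta> - \<alpha>) * (\<beta> - \<alpha>)"
      have X: "X \<ge> 0" using \<alpha>\<beta> by (simp add: X_def)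
      have eX: "ennreal ((1 / \<beta>)\<^sup>2 * (\<beta> - \<alpha>)) * ennreal (\<beta> - \<alpha>) = ennreal X"
        unfolding X_def using \<alpha>\<beta> by (intro ennreal_mult[symmetric]) auto
      have "ennreal C = ennreal 3 + ennreal 3 + ennreal 3 * ennreal X"
        using X by (simp only: C_def X_def[symmetric] ennreal_mult[symmetric] ennreal_plus[symmetric]) simp
      then have CX: "ennreal C = 3 + 3 + 3 * ennreal X" by simp
      have "ennreal ((1 / \<beta>)\<^sup>2 * (\<beta> - \<alpha>)) * (ennreal P * S k * ennreal (\<beta> - \<alpha>)) = ennreal X * (ennreal P * S k)"
        unfolding eX[symmetric] by (simp only: ac_simps)
      moreover have "ennreal (C * P) * S k = ennreal C * (ennreal P * S k)"
        using C P by (simp only: ennreal_mult less_imp_le mult.assoc)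
      ultimately show ?thesis unfolding CX by (simp only: distrib_right mult.assoc)
    qed
    finally show ?thesis .
  qed
  have "(\<integral>\<^sup>+z. ennreal ((w z)\<^sup>2) * indicator K z \<partial>lborel) \<le> 0"
  proof (rule tendsto_lowerbound)
    show "(\<lambda>k. ennreal (C * P) * S k) \<longlonglongrightarrow> 0"
      using ennreal_tendsto_cmult[OF _ S0, of "ennreal (C * P)"] by simp
  qed (use bound in auto)
  then have "w z0 = 0"
    using cw \<delta> unfolding K_def by (intro continuous_on_zero_of_nn_integral_zero) auto
  then show ?thesis by (simp add: w_def)
qed

section \<open>Extension up to the flat boundary\<close>

definition upper_ball :: "real \<Rightarrow> ((real^'n) \<times> real) set" where
  "upper_ball R = {z. norm z < R \<and> 0 \<le> snd z}"

lemma hoelder_on_uniformly_continuous: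
  assumes "hoelder_on \<alpha> S f" "\<alpha> > 0"
  shows "uniformly_continuous_on S f"
proof -
  obtain C where C: "\<And>z w. z \<in> S \<Longrightarrow> w \<in> S \<Longrightarrow> dist (f z) (f w) \<le> C * dist z w powr \<alpha>"
    using assms(1) by (auto simp: hoelder_on_def)
  show ?thesis
    unfolding uniformly_continuous_on_def
  proof (intro allI impI)
    fix e :: real assume e: "e > 0"
    define \<delta> where "\<delta> = (e / (\<bar>C\<bar> + 1)) powr (1 / \<alpha>)"
    have "\<delta> > 0" using e by (simp add: \<delta>_def)
    moreover have "dist (f w) (f z) < e" if "z \<in> S" "w \<in> S" "dist w z < \<delta>" for z w
    proof -
      have "dist w z powr \<alpha> \<le> \<delta> powr \<alpha>" using that assms(2) by (intro powr_mono2) auto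
      also have "\<delta> powr \<alpha> = e / (\<bar>C\<bar> + 1)" using e assms(2) by (simp add: \<delta>_def powr_powr)
      finally have d: "dist w z powr \<alpha> \<le> e / (\<bar>C\<bar> + 1)" .
      have "dist (f w) (f z) \<le> C * dist w z powr \<alpha>" using C that by blast
      also have "\<dots> \<le> \<bar>C\<bar> * dist w z powr \<alpha>" by (intro mult_right_mono) auto
      also have "\<dots> \<le> \<bar>C\<bar> * (e / (\<bar>C\<bar> + 1))" using d by (intro mult_left_mono) auto
      also have "\<dots> < e" using e by (simp add: field_simps)
      finally show ?thesis .
    qed
    ultimately show "\<exists>d>0. \<forall>x\<in>S. \<forall>x'\<in>S. dist x' x < d \<longrightarrow> dist (f x') (f x) < e" by blast
  qed
qed

text \<open>A point with y = 0 is the limit of its upward shifts. Uniformly continuous functions on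
  the half ball therefore extend to the flat part.\<close>

lemma upper_ball_subset_closure: "upper_ball R \<subseteq> closure (half_ball R)"
proof safe
  fix x :: "real^'n" and y assume "(x, y) \<in> upper_ball R"
  then have z: "norm (x, y) < R" "0 \<le> y" by (auto simp: upper_ball_def)
  have "((\<lambda>h. norm (x, y + h)) \<longlongrightarrow> norm (x, y + 0)) (at_right 0)"
    by (intro tendsto_intros)
  then have ev: "\<forall>\<^sub>F h in at_right 0. norm (x, y + h) < R" using z by (intro order_tendstoD(2)) auto
  have "\<forall>\<^sub>F h in at_right 0. (x, y + h) \<in> half_ball R"
    using ev eventually_at_right_less[of "0::real"] by eventually_elim (use z in \<open>simp add: half_ball_def\<close>)
  moreover have "((\<lambda>h. (x, y + h)) \<longlongrightarrow> (x, y + 0)) (at_right 0)" by (intro tendsto_intros)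
  ultimately show "(x, y) \<in> closure (half_ball R)"
    by (intro Lim_in_closed_set[of "closure (half_ball R)" "\<lambda>h. (x, y + h)" "at_right 0"])
       (auto elim!: eventually_mono intro: closure_subset[THEN subsetD])
qed

text \<open>The normal part of z . V is y^(1-a) times y^a d_y u. The second factor extends
  continuously by hypothesis and the first is continuous up to y = 0 because a < 1, although V
  itself need not extend. Inside the half ball V is recovered by dividing by the positive power
  y^a.\<close>

lemma radial_derivative_extension:
  fixes V :: "(real^'n) \<times> real \<Rightarrow> (real^'n) \<times> real"
  assumes \<alpha>: "\<alpha> > 0" and a: "a < 1"
    and X: "hoelder_on \<alpha> (half_ball R) (\<lambda>z. fst (V z))"
    and Y: "hoelder_on \<alpha> (half_ball R) (\<lambda>z. snd z powr a * snd (V z))"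
  obtains Q where "continuous_on (upper_ball R) Q" "\<And>z. z \<in> half_ball R \<Longrightarrow> Q z = V z \<bullet> z"
    "continuous_on (half_ball R) V"
proof -
  obtain X' where X': "uniformly_continuous_on (closure (half_ball R)) X'" "\<And>z. z \<in> half_ball R \<Longrightarrow> fst (V z) = X' z"
    using uniformly_continuous_on_extension_on_closure[OF hoelder_on_uniformly_continuous[OF X \<alpha>]] by metis
  obtain Y' where Y': "uniformly_continuous_on (closure (half_ball R)) Y'" "\<And>z. z \<in> half_ball R \<Longrightarrow> snd z powr a * snd (V z) = Y' z"
    using uniformly_continuous_on_extension_on_closure[OF hoelder_on_uniformly_continuous[OF Y \<alpha>]] by metis
  have cX: "continuous_on (upper_ball R) X'" and cY: "continuous_on (upper_ball R) Y'"
    using X'(1) Y'(1) by (meson continuous_on_subset uniformly_continuous_imp_continuous upper_ball_subset_closure)+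
  define Q where "Q z = X' z \<bullet> fst z + snd z powr (1 - a) * Y' z" for z
  have "continuous_on (upper_ball R) Q"
    unfolding Q_def using a
    by (intro continuous_intros continuous_on_powr' cX cY) (auto simp: upper_ball_def)
  moreover have "Q z = V z \<bullet> z" if z: "z \<in> half_ball R" for z
  proof -
    have "snd z > 0" using z by (simp add: half_ball_def)
    then have "snd z powr (1 - a) * (snd z powr a * snd (V z)) = snd z * snd (V z)"
      by (simp add: mult.assoc[symmetric] powr_add[symmetric])
    then have "snd z powr (1 - a) * Y' z = snd z * snd (V z)" by (simp only: Y'(2)[OF z])
    then show ?thesis
      using X'(2)[OF z] by (simp add: Q_def inner_prod_def mult.commute)
  qed
  moreover have "continuous_on (half_ball R) V"
  proof -
    have sub: "half_ball R \<subseteq> upper_ball R" by (auto simp: half_ball_def upper_ball_def)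
    have "continuous_on (half_ball R) (\<lambda>z. (X' z, snd z powr (- a) * Y' z))"
      by (intro continuous_intros continuous_on_powr' continuous_on_subset[OF cX sub] continuous_on_subset[OF cY sub])
         (auto simp: half_ball_def)
    moreover have "V z = (X' z, snd z powr (- a) * Y' z)" if z: "z \<in> half_ball R" for z
    proof -
      have "snd z > 0" using z by (simp add: half_ball_def)
      then have "snd z powr (- a) * (snd z powr a * snd (V z)) = snd (V z)"
        by (simp add: mult.assoc[symmetric] powr_add[symmetric])
      then have "snd z powr (- a) * Y' z = snd (V z)" by (simp only: Y'(2)[OF z])
      then show ?thesis using X'(2)[OF z] by (simp add: prod_eq_iff)
    qed
    ultimately show ?thesis by (simp cong: continuous_on_cong)
  qed
  ultimately show ?thesis using that by blast
qed

text \<open>For rays inside the flat boundary the identity is the limit of the identities on nearby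
  rays of positive height; it is written with Q instead of V because only Q reaches y = 0.\<close>

lemma H1a_lim_ray_upper:
  fixes u :: "(real^'n) \<times> real \<Rightarrow> real"
  assumes \<phi>: "\<And>k. smooth (\<phi> k)" and lim: "H1a_lim a 1 \<phi> u V" and R: "R \<le> 1"
    and cu: "continuous_on (upper_ball R) u" and cV: "continuous_on (half_ball R) V"
    and cQ: "continuous_on (upper_ball R) Q" and Q: "\<And>z. z \<in> half_ball R \<Longrightarrow> Q z = V z \<bullet> z"
    and \<alpha>\<beta>: "0 < \<alpha>" "\<alpha> \<le> \<beta>" and z: "norm (\<beta> *\<^sub>R z) < R" "0 \<le> snd z"
  shows "u (\<beta> *\<^sub>R z) - u (\<alpha> *\<^sub>R z) = integral {\<alpha>..\<beta>} (\<lambda>t. Q (t *\<^sub>R z) / t)"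
proof -
  have sub: "half_ball R \<subseteq> upper_ball R" by (auto simp: half_ball_def upper_ball_def)
  have pos: "u (\<beta> *\<^sub>R z) - u (\<alpha> *\<^sub>R z) - integral {\<alpha>..\<beta>} (\<lambda>t. Q (t *\<^sub>R z) / t) = 0"
    if z: "norm (\<beta> *\<^sub>R z) < R" "0 < snd z" for z
  proof -
    have "\<beta> *\<^sub>R z \<in> half_ball R" using z \<alpha>\<beta> by (simp add: half_ball_def)
    from H1a_lim_ray[OF \<phi> lim R continuous_on_subset[OF cu sub] cV \<alpha>\<beta> this]
    have "u (\<beta> *\<^sub>R z) - u (\<alpha> *\<^sub>R z) = integral {\<alpha>..\<beta>} (\<lambda>t. V (t *\<^sub>R z) \<bullet> z)" .
    also have "\<dots> = integral {\<alpha>..\<beta>} (\<lambda>t. Q (t *\<^sub>R z) / t)"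
    proof (rule integral_cong)
      fix t assume t: "t \<in> {\<alpha>..\<beta>}"
      then have "t * norm z \<le> \<beta> * norm z" by (intro mult_right_mono) auto
      then have "t *\<^sub>R z \<in> half_ball R" using z t \<alpha>\<beta> by (simp add: half_ball_def)
      then show "V (t *\<^sub>R z) \<bullet> z = Q (t *\<^sub>R z) / t" using Q[of "t *\<^sub>R z"] t \<alpha>\<beta> by simp
    qed
    finally show ?thesis by simp
  qed
  show ?thesis
  proof (cases "snd z > 0")
    case True
    then show ?thesis using pos[OF z(1)] by simp
  next
    case False
    have "((\<lambda>h::real. norm (\<beta> *\<^sub>R (fst z, h))) \<longlongrightarrow> norm (\<beta> *\<^sub>R (fst z, 0::real))) (at_right 0)"
      by (intro tendsto_intros)
    moreover have "norm (\<beta> *\<^sub>R (fst z, 0::real)) < R" using z False by (metis less_eq_real_def prod.collapse)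
    ultimately have "\<forall>\<^sub>F h in at_right 0. norm (\<beta> *\<^sub>R (fst z, h::real)) < R" by (rule order_tendstoD(2))
    moreover have "\<forall>\<^sub>F h::real in at_right 0. 0 < h" by (rule eventually_at_right_less)
    ultimately have "\<forall>\<^sub>F h in at_right 0. 0 < h \<and> norm (\<beta> *\<^sub>R (fst z, h::real)) < R" by eventually_elim auto
    then obtain h where h: "0 < h" "norm (\<beta> *\<^sub>R (fst z, h::real)) < R"
      using eventually_happens'[of "at_right (0::real)"] by auto
    have in_ub: "t *\<^sub>R (fst z, s) \<in> upper_ball R" if "t \<in> {\<alpha>..\<beta>}" "s \<in> {0..h}" for t s
    proof -
      have "norm (fst z, s) \<le> norm (fst z, h)" using that h by (simp add: norm_Pair power_mono)
      then have "t * norm (fst z, s) \<le> \<beta> * norm (fst z, h)" using that \<alpha>\<beta> by (intro mult_mono) auto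
      moreover have "\<bar>t\<bar> = t" "\<bar>\<beta>\<bar> = \<beta>" using that \<alpha>\<beta> by auto
      ultimately have "norm (t *\<^sub>R (fst z, s)) < R" using h(2) by (simp only: norm_scaleR)
      then show ?thesis using that \<alpha>\<beta> by (simp add: upper_ball_def)
    qed
    \<comment> \<open>The defect of the identity at height s above the flat ray: continuous on [0,h]
      and 0 on the open interval, hence 0 at s = 0.\<close>
    define F where "F s = u (\<beta> *\<^sub>R (fst z, s)) - u (\<alpha> *\<^sub>R (fst z, s)) - integral (cbox \<alpha> \<beta>) (\<lambda>t. Q (t *\<^sub>R (fst z, s)) / t)" for s
    have "continuous_on {0..h} F"
      unfolding F_def
    proof (intro continuous_on_diff integral_continuous_on_param)
      show "continuous_on {0..h} (\<lambda>s. u (\<beta> *\<^sub>R (fst z, s)))" "continuous_on {0..h} (\<lambda>s. u (\<alpha> *\<^sub>R (fst z, s)))"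
        using in_ub \<alpha>\<beta> by (auto intro!: continuous_on_compose2[OF cu] continuous_intros)
      show "continuous_on ({0..h} \<times> cbox \<alpha> \<beta>) (\<lambda>(s, t). Q (t *\<^sub>R (fst z, s)) / t)"
        unfolding split_beta
        by (intro continuous_intros continuous_on_compose2[OF cQ]) (use in_ub \<alpha>\<beta> in auto)
    qed
    then have cF: "continuous_on (closure {0<..<h}) F" using h by simp
    have F0: "F s = 0" if s: "s \<in> {0<..<h}" for s
    proof -
      have "norm (\<beta> *\<^sub>R (fst z, s)) < R" using in_ub[of \<beta> s] s \<alpha>\<beta> by (simp add: upper_ball_def)
      then show ?thesis using pos[of "(fst z, s)"] s unfolding F_def by simp
    qed
    have "0 \<in> closure {0<..<h}" using h by simp
    with cF F0 have "F 0 = 0" by (rule continuous_constant_on_closure)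
    moreover have zeq: "(fst z, 0) = z" using False z by (simp add: prod_eq_iff)
    ultimately have "u (\<beta> *\<^sub>R z) - u (\<alpha> *\<^sub>R z) - integral {\<alpha>..\<beta>} (\<lambda>t. Q (t *\<^sub>R z) / t) = 0"
      by (simp only: F_def zeq box_real(2))
    then show ?thesis by linarith
  qed
qed

lemma has_radial_derivative:
  fixes u :: "(real^'n) \<times> real \<Rightarrow> real"
  assumes \<phi>: "\<And>k. smooth (\<phi> k)" and lim: "H1a_lim a 1 \<phi> u V" and R: "R \<le> 1"
    and cu: "continuous_on (upper_ball R) u" and cV: "continuous_on (half_ball R) V"
    and cQ: "continuous_on (upper_ball R) Q" and Q: "\<And>z. z \<in> half_ball R \<Longrightarrow> Q z = V z \<bullet> z"
    and t: "0 < t" and z: "norm (t *\<^sub>R z) < R" "0 \<le> snd z"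
  shows "((\<lambda>s. u (s *\<^sub>R z)) has_real_derivative Q (t *\<^sub>R z) / t) (at t)"
proof -
  \<comment> \<open>The ray identity is used on an interval that contains t in its interior. The end
    point is the midpoint between t and the radius at which the ray leaves the ball; through the
    origin the ray never leaves.\<close>
  obtain \<beta> where \<beta>: "t < \<beta>" "norm (\<beta> *\<^sub>R z) < R"
  proof (cases "z = 0")
    case True
    then show ?thesis using that[of "2 * t"] t z by auto
  next
    case False
    then have "t < R / norm z" using z t by (simp add: field_simps)
    moreover have "norm (((t + R / norm z) / 2) *\<^sub>R z) < R"
    proof -
      have "0 < R" using z(1) norm_ge_zero le_less_trans by blast
      then have "norm (((t + R / norm z) / 2) *\<^sub>R z) = (t * norm z + R) / 2"
        using False t by (simp add: abs_of_pos add_pos_pos distrib_right)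
      then show ?thesis using z t by simp
    qed
    ultimately show ?thesis using that[of "(t + R / norm z) / 2"] by simp
  qed
  define \<alpha> where "\<alpha> = t / 2"
  have \<alpha>: "0 < \<alpha>" "\<alpha> < t" using t by (simp_all add: \<alpha>_def)
  have n: "norm (s *\<^sub>R z) < R" if "s \<in> {\<alpha>..\<beta>}" for s
  proof -
    have "s * norm z \<le> \<beta> * norm z" using that by (intro mult_right_mono) auto
    then show ?thesis using \<beta> that \<alpha> by simp
  qed
  have "continuous_on {\<alpha>..\<beta>} (\<lambda>s. Q (s *\<^sub>R z) / s)"
    using n \<alpha> z by (intro continuous_intros continuous_on_compose2[OF cQ]) (auto simp: upper_ball_def)
  from integral_has_real_derivative[OF this, of t]
  have "((\<lambda>s. u (\<alpha> *\<^sub>R z) + integral {\<alpha>..s} (\<lambda>s. Q (s *\<^sub>R z) / s)) has_real_derivative Q (t *\<^sub>R z) / t) (at t within {\<alpha>..\<beta>})"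
    using \<alpha> \<beta> by (auto intro!: derivative_eq_intros)
  then have "((\<lambda>s. u (\<alpha> *\<^sub>R z) + integral {\<alpha>..s} (\<lambda>s. Q (s *\<^sub>R z) / s)) has_real_derivative Q (t *\<^sub>R z) / t) (at t within {\<alpha><..<\<beta>})"
    by (rule DERIV_subset) auto
  then have "((\<lambda>s. u (\<alpha> *\<^sub>R z) + integral {\<alpha>..s} (\<lambda>s. Q (s *\<^sub>R z) / s)) has_real_derivative Q (t *\<^sub>R z) / t) (at t)"
    using \<alpha> \<beta> by (simp add: at_within_open[of t "{\<alpha><..<\<beta>}"])
  then show ?thesis
  proof (rule has_field_derivative_transform_within_open[where S="{\<alpha><..<\<beta>}"])
    fix s assume s: "s \<in> {\<alpha><..<\<beta>}"
    show "u (\<alpha> *\<^sub>R z) + integral {\<alpha>..s} (\<lambda>s. Q (s *\<^sub>R z) / s) = u (s *\<^sub>R z)"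
      using H1a_lim_ray_upper[OF \<phi> lim R cu cV cQ Q \<alpha>(1) _ n z(2), of s] s by simp
  qed (use \<alpha> \<beta> in auto)
qed

subsection \<open>Test functions\<close>

lemma ennreal_inverse_cancel: "T > 0 \<Longrightarrow> ennreal (inverse T) * (ennreal T * I) = I"
  by (simp add: mult.assoc[symmetric] ennreal_mult'[symmetric])

lemma ennreal_tendsto_0_le:
  fixes f g :: "nat \<Rightarrow> ennreal"
  assumes "\<And>k. f k \<le> ennreal C * g k" and "g \<longlonglongrightarrow> 0"
  shows "f \<longlonglongrightarrow> 0"
proof (rule tendsto_sandwich[of "\<lambda>_. 0"])
  show "(\<lambda>k. ennreal C * g k) \<longlonglongrightarrow> 0"
    using ennreal_tendsto_cmult[OF ennreal_less_top assms(2)] by simp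
  show "\<forall>\<^sub>F k in sequentially. f k \<le> ennreal C * g k"
    by (rule always_eventually, rule allI, rule assms(1))
qed simp_all

text \<open>The value 0 is a minimum of the step, so the derivative vanishes wherever it is
  attained, the end point t = 0 included.\<close>

lemma deriv_smooth_step_0:
  assumes "t \<le> 0" shows "deriv smooth_step t = 0"
  by (rule DERIV_local_min[OF smooth_step_deriv, of 1])
     (use assms smooth_step_nonneg smooth_step_0[OF assms] in auto)

lemma deriv_smooth_step_1:
  assumes "1 \<le> t" shows "deriv smooth_step t = 0"
  by (rule DERIV_local_max[OF smooth_step_deriv, of 1])
     (use assms smooth_step_le_1 smooth_step_1[OF assms] in auto)

lemma cutoff_bounds: "0 \<le> cutoff t \<epsilon> z" "cutoff t \<epsilon> z \<le> 1"
  by (simp_all add: cutoff_def smooth_step_nonneg smooth_step_le_1)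

lemma cutoff_outside:
  assumes "t \<ge> 0" "\<epsilon> > 0" "norm z \<ge> t"
  shows "cutoff t \<epsilon> z = 0" "grad (cutoff t \<epsilon>) z = 0"
proof -
  have "t\<^sup>2 - z \<bullet> z \<le> 0" using assms by (simp add: power2_norm_eq_inner[symmetric] power_mono)
  then have "(t\<^sup>2 - z \<bullet> z) / \<epsilon> \<le> 0" using assms by (simp add: divide_le_0_iff)
  then show "cutoff t \<epsilon> z = 0" "grad (cutoff t \<epsilon>) z = 0"
    using assms by (simp_all add: cutoff_def smooth_step_0 grad_cutoff deriv_smooth_step_0)
qed

text \<open>The support lies in the closed ball of radius t < 1, at positive distance from the unit
  sphere.\<close>

lemma vanishing_near_sphere_cutoff:
  assumes "smooth f" "0 \<le> t" "t < 1" "\<epsilon> > 0"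
  shows "vanishing_near_sphere 1 (\<lambda>z. f z * cutoff t \<epsilon> z)"
proof -
  let ?H = "half_ball 1 :: ((real^'a) \<times> real) set"
  let ?K = "closure {z \<in> closure ?H. f z * cutoff t \<epsilon> z \<noteq> 0}"
  have "{z \<in> closure ?H. f z * cutoff t \<epsilon> z \<noteq> 0} \<subseteq> closure ?H \<inter> cball 0 t"
  proof safe
    fix x y assume "f (x, y) * cutoff t \<epsilon> (x, y) \<noteq> 0"
    then have "\<not> norm (x, y) \<ge> t" using cutoff_outside(1)[OF assms(2,4), of "(x, y)"] by auto
    then show "(x, y) \<in> cball 0 t" by simp
  qed
  then have K: "?K \<subseteq> closure ?H \<inter> cball 0 t"
    by (rule closure_minimal) auto
  then have "?K \<subseteq> cball 0 t" by blast
  then have "bounded ?K" by (rule bounded_subset[OF bounded_cball])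
  then have "compact ?K" by (simp only: compact_eq_bounded_closed closed_closure simp_thms)
  moreover have "closure (half_sphere 1 :: ((real^'a) \<times> real) set) \<subseteq> sphere 0 1"
    by (rule closure_minimal) (auto simp: half_sphere_def)
  moreover have "cball 0 t \<inter> sphere (0 :: (real^'a) \<times> real) 1 = {}" using assms(3) by auto
  ultimately have "?K \<subseteq> closure ?H - closure (half_sphere 1)" using K by blast
  with \<open>compact ?K\<close> smooth_mult[OF assms(1) smooth_cutoff] show ?thesis
    unfolding vanishing_near_sphere_def Let_def by blast
qed

text \<open>Convergence on the half ball of radius t is enough: beyond t the cutoff and its gradient
  vanish, so products extend by 0 to the unit half ball. The product rule costs a factor 2 C^2 + 2,
  where C bounds the gradient of the cutoff.\<close>

lemma H1a_lim_mult_cutoff: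
  fixes w :: "(real^'n) \<times> real \<Rightarrow> real"
  assumes \<phi>: "\<And>k. smooth (\<phi> k)" and lim: "H1a_lim a t \<phi> w W" and t: "0 \<le> t" "t < 1" and \<epsilon>: "\<epsilon> > 0"
  shows "H1a_lim a 1 (\<lambda>k z. \<phi> k z * cutoff t \<epsilon> z) (\<lambda>z. w z * cutoff t \<epsilon> z)
    (\<lambda>z. if z \<in> half_ball t then w z *\<^sub>R grad (cutoff t \<epsilon>) z + cutoff t \<epsilon> z *\<^sub>R W z else 0)"
proof -
  obtain w' W' where wW [measurable]: "w' \<in> borel_measurable borel" "W' \<in> borel_measurable borel"
    and lim': "H1a_lim a t \<phi> w' W'" and eq: "\<And>z. z \<in> half_ball t \<Longrightarrow> w' z = w z \<and> W' z = W z"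
    using H1a_lim_borel[OF lim] by blast
  note [measurable] = borel_measurable_smooth[OF \<phi>] borel_measurable_smooth[OF smooth_cutoff]
  let ?\<eta> = "cutoff t \<epsilon> :: (real^'n) \<times> real \<Rightarrow> real"
  let ?w = "\<lambda>z. w' z * ?\<eta> z"
  let ?W = "\<lambda>z. if z \<in> half_ball t then w' z *\<^sub>R grad ?\<eta> z + ?\<eta> z *\<^sub>R W' z else 0"
  obtain C where C: "C > 0" "\<And>z. z \<in> cball 0 1 \<Longrightarrow> norm (grad ?\<eta> z) \<le> C"
    using smooth_bounded[OF smooth_cutoff] by metis
  have le: "H1a_sqnorm a 1 (\<lambda>z. ?w z - \<phi> k z * ?\<eta> z) (\<lambda>z. ?W z - grad (\<lambda>z. \<phi> k z * ?\<eta> z) z)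
    \<le> ennreal (2 * C\<^sup>2 + 2) * H1a_sqnorm a t (\<lambda>z. w' z - \<phi> k z) (\<lambda>z. W' z - grad (\<phi> k) z)" for k
  proof -
    have "H1a_sqnorm a 1 (\<lambda>z. ?w z - \<phi> k z * ?\<eta> z) (\<lambda>z. ?W z - grad (\<lambda>z. \<phi> k z * ?\<eta> z) z) \<le>
      (\<integral>\<^sup>+z. ennreal (2 * C\<^sup>2 + 2) * (ennreal (snd z powr a * ((norm (W' z - grad (\<phi> k) z))\<^sup>2 + (w' z - \<phi> k z)\<^sup>2)) * indicator (half_ball t) z) \<partial>lborel)"
      unfolding H1a_sqnorm_def
    proof (rule nn_integral_mono)
      fix z :: "(real^'n) \<times> real"
      have g: "grad (\<lambda>z. \<phi> k z * ?\<eta> z) z = \<phi> k z *\<^sub>R grad ?\<eta> z + ?\<eta> z *\<^sub>R grad (\<phi> k) z"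
        by (rule grad_mult[OF \<phi> smooth_cutoff])
      consider "z \<notin> half_ball 1" | "z \<in> half_ball 1" "z \<notin> half_ball t" | "z \<in> half_ball t" by blast
      then show "ennreal (snd z powr a * ((norm (?W z - grad (\<lambda>z. \<phi> k z * ?\<eta> z) z))\<^sup>2 + (?w z - \<phi> k z * ?\<eta> z)\<^sup>2)) * indicator (half_ball 1) z
        \<le> ennreal (2 * C\<^sup>2 + 2) * (ennreal (snd z powr a * ((norm (W' z - grad (\<phi> k) z))\<^sup>2 + (w' z - \<phi> k z)\<^sup>2)) * indicator (half_ball t) z)"
      proof cases
        case 1
        then show ?thesis by simp
      next
        case 2
        then have "norm z \<ge> t" by (auto simp: half_ball_def)
        then have "?\<eta> z = 0" "grad ?\<eta> z = 0" using cutoff_outside[OF t(1) \<epsilon>] by auto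
        then show ?thesis using 2 by (simp add: g)
      next
        case 3
        then have z1: "z \<in> half_ball 1" using t by (auto simp: half_ball_def)
        define d D where "d = w' z - \<phi> k z" and "D = W' z - grad (\<phi> k) z"
        have eta: "\<bar>?\<eta> z\<bar> \<le> 1" using cutoff_bounds[of t \<epsilon> z] by simp
        have "?W z - grad (\<lambda>z. \<phi> k z * ?\<eta> z) z = d *\<^sub>R grad ?\<eta> z - (- ?\<eta> z) *\<^sub>R D"
          using 3 by (simp add: g d_def D_def algebra_simps)
        then have "(norm (?W z - grad (\<lambda>z. \<phi> k z * ?\<eta> z) z))\<^sup>2 \<le> 2 * (norm (d *\<^sub>R grad ?\<eta> z))\<^sup>2 + 2 * (norm ((- ?\<eta> z) *\<^sub>R D))\<^sup>2"
          by (simp only: norm_diff_square_le)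
        also have "\<dots> = 2 * (d\<^sup>2 * (norm (grad ?\<eta> z))\<^sup>2) + 2 * (\<bar>?\<eta> z\<bar>\<^sup>2 * (norm D)\<^sup>2)"
          by (simp add: power_mult_distrib)
        also have "\<dots> \<le> 2 * (d\<^sup>2 * C\<^sup>2) + 2 * (1\<^sup>2 * (norm D)\<^sup>2)"
          using C(2)[of z] eta z1 bounded_half_ball[OF z1] by (intro add_mono mult_left_mono mult_right_mono power_mono) auto
        finally have 1: "(norm (?W z - grad (\<lambda>z. \<phi> k z * ?\<eta> z) z))\<^sup>2 \<le> 2 * C\<^sup>2 * d\<^sup>2 + 2 * (norm D)\<^sup>2" by (simp add: mult_ac)
        have "?w z - \<phi> k z * ?\<eta> z = d * ?\<eta> z" by (simp add: d_def algebra_simps)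
        then have "(?w z - \<phi> k z * ?\<eta> z)\<^sup>2 = d\<^sup>2 * \<bar>?\<eta> z\<bar>\<^sup>2" by (simp add: power_mult_distrib)
        also have "\<dots> \<le> d\<^sup>2 * 1\<^sup>2" using eta by (intro mult_left_mono power_mono) auto
        finally have "(norm (?W z - grad (\<lambda>z. \<phi> k z * ?\<eta> z) z))\<^sup>2 + (?w z - \<phi> k z * ?\<eta> z)\<^sup>2 \<le> (2 * C\<^sup>2 * d\<^sup>2 + 2 * (norm D)\<^sup>2) + d\<^sup>2 * 1\<^sup>2"
          using 1 by (rule add_mono[rotated])
        also have "\<dots> \<le> (2 * C\<^sup>2 + 2) * ((norm D)\<^sup>2 + d\<^sup>2)" by (simp add: algebra_simps)
        finally have "snd z powr a * ((norm (?W z - grad (\<lambda>z. \<phi> k z * ?\<eta> z) z))\<^sup>2 + (?w z - \<phi> k z * ?\<eta> z)\<^sup>2)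
          \<le> snd z powr a * ((2 * C\<^sup>2 + 2) * ((norm D)\<^sup>2 + d\<^sup>2))" by (rule mult_left_mono) simp
        also have "\<dots> = (2 * C\<^sup>2 + 2) * (snd z powr a * ((norm D)\<^sup>2 + d\<^sup>2))" by simp
        finally have "ennreal (snd z powr a * ((norm (?W z - grad (\<lambda>z. \<phi> k z * ?\<eta> z) z))\<^sup>2 + (?w z - \<phi> k z * ?\<eta> z)\<^sup>2))
          \<le> ennreal (2 * C\<^sup>2 + 2) * ennreal (snd z powr a * ((norm D)\<^sup>2 + d\<^sup>2))"
          by (subst ennreal_mult[symmetric]) (auto intro: ennreal_leI)
        then show ?thesis using 3 z1 by (simp add: d_def D_def)
      qed
    qed
    also have "\<dots> = ennreal (2 * C\<^sup>2 + 2) * H1a_sqnorm a t (\<lambda>z. w' z - \<phi> k z) (\<lambda>z. W' z - grad (\<phi> k) z)"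
      unfolding H1a_sqnorm_def by (rule nn_integral_cmult) measurable
    finally show ?thesis .
  qed
  have "(\<lambda>k. H1a_sqnorm a 1 (\<lambda>z. ?w z - \<phi> k z * ?\<eta> z) (\<lambda>z. ?W z - grad (\<lambda>z. \<phi> k z * ?\<eta> z) z)) \<longlonglongrightarrow> 0"
    using lim' unfolding H1a_lim_def by (intro ennreal_tendsto_0_le[OF le]) blast
  then have "H1a_lim a 1 (\<lambda>k z. \<phi> k z * ?\<eta> z) ?w ?W" by (simp add: H1a_lim_def set_borel_measurable_def)
  then show ?thesis
  proof (subst H1a_lim_cong[where u'="?w" and V'="?W"])
    fix z :: "(real^'n) \<times> real" assume "z \<in> half_ball 1"
    show "w z * ?\<eta> z = ?w z \<and> (if z \<in> half_ball t then w z *\<^sub>R grad ?\<eta> z + ?\<eta> z *\<^sub>R W z else 0) = ?W z"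
    proof (cases "z \<in> half_ball t")
      case False
      then have "norm z \<ge> t" using \<open>z \<in> half_ball 1\<close> by (auto simp: half_ball_def)
      then show ?thesis using False cutoff_outside(1)[OF t(1) \<epsilon>, of z] by simp
    qed (use eq in auto)
  qed
qed

text \<open>Makes dilates of the solution admissible in the weak formulation: the dilated
  approximants are again smooth and converge to the dilate.\<close>

lemma H1a_lim_dilation:
  fixes u :: "(real^'n) \<times> real \<Rightarrow> real"
  assumes \<phi>: "\<And>k. smooth (\<phi> k)" and lim: "H1a_lim a (c * t) \<phi> u V" and c: "0 < c"
  shows "H1a_lim a t (\<lambda>k z. \<phi> k (c *\<^sub>R z)) (\<lambda>z. u (c *\<^sub>R z)) (\<lambda>z. c *\<^sub>R V (c *\<^sub>R z))"
proof -
  obtain u' V' where uV [measurable]: "u' \<in> borel_measurable borel" "V' \<in> borel_measurable borel"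
    and lim': "H1a_lim a (c * t) \<phi> u' V'" and eq: "\<And>z. z \<in> half_ball (c * t) \<Longrightarrow> u' z = u z \<and> V' z = V z"
    using H1a_lim_borel[OF lim] by blast
  note [measurable] = borel_measurable_smooth[OF \<phi>]
  have hb: "c *\<^sub>R z \<in> half_ball (c * t) \<longleftrightarrow> z \<in> half_ball t" for z :: "(real^'n) \<times> real"
    using c by (simp add: half_ball_def zero_less_mult_iff)
  \<comment> \<open>The chain rule contributes c^2 to the gradient part (and 1 to the function
    part), the weight c^(-a), the volume c^(-(N+1)).\<close>
  define P where "P = max (c\<^sup>2) 1 * inverse (c powr a) * inverse (c ^ DIM((real^'n) \<times> real))"
  have le: "H1a_sqnorm a t (\<lambda>z. u' (c *\<^sub>R z) - \<phi> k (c *\<^sub>R z)) (\<lambda>z. c *\<^sub>R V' (c *\<^sub>R z) - grad (\<lambda>z. \<phi> k (c *\<^sub>R z)) z)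
    \<le> ennreal P * H1a_sqnorm a (c * t) (\<lambda>z. u' z - \<phi> k z) (\<lambda>z. V' z - grad (\<phi> k) z)" for k
  proof -
    define F where "F z = ennreal (snd z powr a * ((norm (V' z - grad (\<phi> k) z))\<^sup>2 + (u' z - \<phi> k z)\<^sup>2)) * indicator (half_ball (c * t)) z" for z
    have [measurable]: "F \<in> borel_measurable borel" by (simp add: F_def[abs_def])
    have "H1a_sqnorm a t (\<lambda>z. u' (c *\<^sub>R z) - \<phi> k (c *\<^sub>R z)) (\<lambda>z. c *\<^sub>R V' (c *\<^sub>R z) - grad (\<lambda>z. \<phi> k (c *\<^sub>R z)) z)
      \<le> (\<integral>\<^sup>+z. ennreal (max (c\<^sup>2) 1 * inverse (c powr a)) * F (c *\<^sub>R z) \<partial>lborel)"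
      unfolding H1a_sqnorm_def
    proof (rule nn_integral_mono)
      fix z :: "(real^'n) \<times> real"
      show "ennreal (snd z powr a * ((norm (c *\<^sub>R V' (c *\<^sub>R z) - grad (\<lambda>z. \<phi> k (c *\<^sub>R z)) z))\<^sup>2 + (u' (c *\<^sub>R z) - \<phi> k (c *\<^sub>R z))\<^sup>2)) * indicator (half_ball t) z
        \<le> ennreal (max (c\<^sup>2) 1 * inverse (c powr a)) * F (c *\<^sub>R z)"
      proof (cases "z \<in> half_ball t")
        case True
        then have z: "snd z > 0" by (simp add: half_ball_def)
        define d D where "d = u' (c *\<^sub>R z) - \<phi> k (c *\<^sub>R z)" and "D = V' (c *\<^sub>R z) - grad (\<phi> k) (c *\<^sub>R z)"
        have "c *\<^sub>R V' (c *\<^sub>R z) - grad (\<lambda>z. \<phi> k (c *\<^sub>R z)) z = c *\<^sub>R D"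
          by (simp add: grad_dilation[OF \<phi>] D_def scaleR_diff_right)
        then have "(norm (c *\<^sub>R V' (c *\<^sub>R z) - grad (\<lambda>z. \<phi> k (c *\<^sub>R z)) z))\<^sup>2 = c\<^sup>2 * (norm D)\<^sup>2"
          by (simp add: power_mult_distrib)
        moreover have "c\<^sup>2 * (norm D)\<^sup>2 + d\<^sup>2 \<le> max (c\<^sup>2) 1 * (norm D)\<^sup>2 + max (c\<^sup>2) 1 * d\<^sup>2"
          using mult_right_mono[of 1 "max (c\<^sup>2) 1" "d\<^sup>2"] by (intro add_mono mult_right_mono) auto
        ultimately have "snd z powr a * ((norm (c *\<^sub>R V' (c *\<^sub>R z) - grad (\<lambda>z. \<phi> k (c *\<^sub>R z)) z))\<^sup>2 + d\<^sup>2)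
          \<le> snd z powr a * (max (c\<^sup>2) 1 * ((norm D)\<^sup>2 + d\<^sup>2))"
          by (intro mult_left_mono) (simp_all add: distrib_left)
        also have "\<dots> = max (c\<^sup>2) 1 * inverse (c powr a) * (snd (c *\<^sub>R z) powr a * ((norm D)\<^sup>2 + d\<^sup>2))"
          using c z by (simp add: powr_mult)
        finally have "ennreal (snd z powr a * ((norm (c *\<^sub>R V' (c *\<^sub>R z) - grad (\<lambda>z. \<phi> k (c *\<^sub>R z)) z))\<^sup>2 + d\<^sup>2)) \<le>
          ennreal (max (c\<^sup>2) 1 * inverse (c powr a)) * ennreal (snd (c *\<^sub>R z) powr a * ((norm D)\<^sup>2 + d\<^sup>2))"
          by (subst ennreal_mult[symmetric]) (auto intro: ennreal_leI)
        then show ?thesis using True hb[of z] unfolding F_def d_def D_def by simp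
      qed simp
    qed
    also have "\<dots> = ennreal (max (c\<^sup>2) 1 * inverse (c powr a)) * (\<integral>\<^sup>+z. F (c *\<^sub>R z) \<partial>lborel)"
      by (rule nn_integral_cmult) measurable
    also have "(\<integral>\<^sup>+z. F (c *\<^sub>R z) \<partial>lborel) = ennreal (inverse (c ^ DIM((real^'n) \<times> real))) * (\<integral>\<^sup>+z. F z \<partial>lborel)"
      using c by (subst nn_integral_lborel_scale[of F c], measurable)
        (rule ennreal_inverse_cancel[symmetric, OF zero_less_power])
    also have "(\<integral>\<^sup>+z. F z \<partial>lborel) = H1a_sqnorm a (c * t) (\<lambda>z. u' z - \<phi> k z) (\<lambda>z. V' z - grad (\<phi> k) z)"
      by (simp add: H1a_sqnorm_def F_def)
    finally show ?thesis using c by (simp add: P_def ennreal_mult' mult.assoc)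
  qed
  have "(\<lambda>k. H1a_sqnorm a t (\<lambda>z. u' (c *\<^sub>R z) - \<phi> k (c *\<^sub>R z)) (\<lambda>z. c *\<^sub>R V' (c *\<^sub>R z) - grad (\<lambda>z. \<phi> k (c *\<^sub>R z)) z)) \<longlonglongrightarrow> 0"
    using lim' unfolding H1a_lim_def by (intro ennreal_tendsto_0_le[OF le]) blast
  then have "H1a_lim a t (\<lambda>k z. \<phi> k (c *\<^sub>R z)) (\<lambda>z. u' (c *\<^sub>R z)) (\<lambda>z. c *\<^sub>R V' (c *\<^sub>R z))"
    by (simp add: H1a_lim_def set_borel_measurable_def)
  then show ?thesis
    using eq hb by (subst H1a_lim_cong[where u'="\<lambda>z. u' (c *\<^sub>R z)" and V'="\<lambda>z. c *\<^sub>R V' (c *\<^sub>R z)"]) auto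
qed

section \<open>Traces of the solution and of the test functions\<close>

lemma borel_measurable_pair0: "(\<lambda>x::real^'n. (x, 0::real)) \<in> borel \<rightarrow>\<^sub>M borel"
  by (intro borel_measurable_continuous_onI continuous_intros)

text \<open>The trace and the restriction of u to y = 0 are L^2 limits of the same smooth functions
  on the ball of radius \<rho>. The radius is below 1 because u is continuous only up to the open
  flat ball.\<close>

lemma has_trace_AE_eq:
  fixes u :: "(real^'n) \<times> real \<Rightarrow> real"
  assumes a: "-1 < a" "a < 1" and tr: "has_trace a 1 u tr"
    and cont: "continuous_on (half_ball 1 \<union> flat_ball 1) u" and \<rho>: "0 < \<rho>" "\<rho> < 1"
  shows "AE x in lborel. x \<in> ball 0 \<rho> \<longrightarrow> tr x = u (x, 0)"
proof -
  obtain \<phi> V where \<phi>: "\<And>k. smooth (\<phi> k)" and lim: "H1a_lim a 1 \<phi> u V"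
    and T: "(\<lambda>k. \<integral>\<^sup>+x\<in>ball 0 1. ennreal ((tr x - \<phi> k (x, 0))\<^sup>2) \<partial>lborel) \<longlonglongrightarrow> 0"
    using tr unfolding has_trace_def by blast
  have U: "(\<lambda>k. \<integral>\<^sup>+x\<in>ball 0 \<rho>. ennreal ((u (x, 0) - \<phi> k (x, 0))\<^sup>2) \<partial>lborel) \<longlonglongrightarrow> 0"
    by (rule H1a_lim_trace[OF a \<phi> lim cont \<rho>])
  note [measurable] = borel_measurable_smooth[OF \<phi>] borel_measurable_pair0
  define t where "t x = indicator (ball 0 1) x *\<^sub>R tr x" for x
  have [measurable]: "t \<in> borel_measurable borel"
    using tr by (simp add: has_trace_def set_borel_measurable_def t_def[abs_def])
  define w where "w x = (if x \<in> ball 0 \<rho> then u (x, 0) else 0)" for x :: "real^'n"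
  have cw: "continuous_on (ball 0 \<rho>) (\<lambda>x. u (x, 0))"
    by (intro continuous_on_compose2[OF cont] continuous_intros) (use \<rho> in \<open>auto simp: flat_ball_def\<close>)
  have [measurable]: "w \<in> borel_measurable borel" unfolding w_def[abs_def]
    by (rule borel_measurable_continuous_on_if[OF _ cw]) auto
  have b [measurable]: "(indicator (ball 0 r) :: real^'n \<Rightarrow> ennreal) \<in> borel_measurable borel" for r
    by (intro borel_measurable_indicator borel_open open_ball)
  have le: "(\<integral>\<^sup>+x. ennreal ((t x - w x)\<^sup>2) * indicator (ball 0 \<rho>) x \<partial>lborel) \<le>
      2 * (\<integral>\<^sup>+x\<in>ball 0 1. ennreal ((tr x - \<phi> k (x, 0))\<^sup>2) \<partial>lborel) + 2 * (\<integral>\<^sup>+x\<in>ball 0 \<rho>. ennreal ((u (x, 0) - \<phi> k (x, 0))\<^sup>2) \<partial>lborel)" for k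
  proof -
    have "(\<integral>\<^sup>+x. ennreal ((t x - w x)\<^sup>2) * indicator (ball 0 \<rho>) x \<partial>lborel) \<le>
      (\<integral>\<^sup>+x. 2 * (ennreal ((t x - \<phi> k (x, 0))\<^sup>2) * indicator (ball 0 1) x) + 2 * (ennreal ((w x - \<phi> k (x, 0))\<^sup>2) * indicator (ball 0 \<rho>) x) \<partial>lborel)"
    proof (rule nn_integral_mono)
      fix x :: "real^'n"
      show "ennreal ((t x - w x)\<^sup>2) * indicator (ball 0 \<rho>) x \<le>
        2 * (ennreal ((t x - \<phi> k (x, 0))\<^sup>2) * indicator (ball 0 1) x) + 2 * (ennreal ((w x - \<phi> k (x, 0))\<^sup>2) * indicator (ball 0 \<rho>) x)"
      proof (cases "x \<in> ball 0 \<rho>")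
        case True
        then have x1: "x \<in> ball 0 1" using \<rho> by simp
        have "(t x - w x)\<^sup>2 \<le> 2 * (t x - \<phi> k (x, 0))\<^sup>2 + 2 * (w x - \<phi> k (x, 0))\<^sup>2"
          using norm_diff_square_le[of "t x - \<phi> k (x, 0)" "w x - \<phi> k (x, 0)"] by simp
        then have "ennreal ((t x - w x)\<^sup>2) \<le> ennreal (2 * (t x - \<phi> k (x, 0))\<^sup>2 + 2 * (w x - \<phi> k (x, 0))\<^sup>2)"
          by (rule ennreal_leI)
        also have "\<dots> = 2 * ennreal ((t x - \<phi> k (x, 0))\<^sup>2) + 2 * ennreal ((w x - \<phi> k (x, 0))\<^sup>2)"
          by (simp add: ennreal_plus ennreal_mult)
        finally show ?thesis using True x1 by simp
      qed simp
    qed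
    also have "\<dots> = 2 * (\<integral>\<^sup>+x. ennreal ((t x - \<phi> k (x, 0))\<^sup>2) * indicator (ball 0 1) x \<partial>lborel)
       + 2 * (\<integral>\<^sup>+x. ennreal ((w x - \<phi> k (x, 0))\<^sup>2) * indicator (ball 0 \<rho>) x \<partial>lborel)"
      by (subst nn_integral_add) (measurable, simp add: nn_integral_cmult)
    also have "(\<integral>\<^sup>+x. ennreal ((t x - \<phi> k (x, 0))\<^sup>2) * indicator (ball 0 1) x \<partial>lborel) = (\<integral>\<^sup>+x\<in>ball 0 1. ennreal ((tr x - \<phi> k (x, 0))\<^sup>2) \<partial>lborel)"
      by (intro nn_integral_cong) (simp add: t_def split: split_indicator)
    also have "(\<integral>\<^sup>+x. ennreal ((w x - \<phi> k (x, 0))\<^sup>2) * indicator (ball 0 \<rho>) x \<partial>lborel) = (\<integral>\<^sup>+x\<in>ball 0 \<rho>. ennreal ((u (x, 0) - \<phi> k (x, 0))\<^sup>2) \<partial>lborel)"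
      by (intro nn_integral_cong) (simp add: w_def split: split_indicator)
    finally show ?thesis .
  qed
  have "(\<integral>\<^sup>+x. ennreal ((t x - w x)\<^sup>2) * indicator (ball 0 \<rho>) x \<partial>lborel) \<le> 2 * 0 + 2 * 0"
    by (rule tendsto_lowerbound[OF tendsto_add[OF ennreal_tendsto_cmult[OF _ T] ennreal_tendsto_cmult[OF _ U]]])
       (auto intro!: always_eventually le)
  then have "(\<integral>\<^sup>+x. ennreal ((t x - w x)\<^sup>2) * indicator (ball 0 \<rho>) x \<partial>lborel) = 0" by simp
  then have "AE x in lborel. ennreal ((t x - w x)\<^sup>2) * indicator (ball 0 \<rho>) x = 0"
    by (subst (asm) nn_integral_0_iff_AE) auto
  then show ?thesis
  proof eventually_elim
    case (elim x)
    show ?case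
    proof
      assume x: "x \<in> ball 0 \<rho>"
      then have "x \<in> ball 0 1" using \<rho> by simp
      with elim x show "tr x = u (x, 0)" by (simp add: t_def w_def)
    qed
  qed
qed

text \<open>A test function needs a trace on the whole unit ball, while the convergence is known
  only on the ball of radius t. The cutoff is 0 outside that ball and at most 1 inside, so it does
  not increase the error.\<close>

lemma has_trace_mult_cutoff:
  fixes w :: "(real^'n) \<times> real \<Rightarrow> real"
  assumes \<phi>: "\<And>k. smooth (\<phi> k)" and lim: "H1a_lim a t \<phi> w W" and t: "0 < t" "t < 1" and \<epsilon>: "\<epsilon> > 0"
    and tr: "(\<lambda>k. \<integral>\<^sup>+x\<in>ball 0 t. ennreal ((w (x, 0) - \<phi> k (x, 0))\<^sup>2) \<partial>lborel) \<longlonglongrightarrow> 0"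
    and cw: "continuous_on (ball 0 t) (\<lambda>x. w (x, 0))"
  shows "has_trace a 1 (\<lambda>z. w z * cutoff t \<epsilon> z) (\<lambda>x. w (x, 0) * cutoff t \<epsilon> (x, 0::real))"
proof -
  let ?\<eta> = "cutoff t \<epsilon> :: (real^'n) \<times> real \<Rightarrow> real"
  have out: "?\<eta> (x, 0) = 0" if "x \<notin> ball 0 t" for x
    using that t \<epsilon> by (intro cutoff_outside) (auto simp: norm_Pair)
  define v where "v x = (if x \<in> ball 0 t then w (x, 0) else 0)" for x :: "real^'n"
  note [measurable] = borel_measurable_smooth(1)[OF smooth_cutoff] borel_measurable_pair0
  have [measurable]: "v \<in> borel_measurable borel" unfolding v_def[abs_def]
    by (rule borel_measurable_continuous_on_if[OF _ cw]) auto
  have "(\<lambda>x. v x * ?\<eta> (x, 0)) \<in> borel_measurable borel" by measurable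
  also have "(\<lambda>x. v x * ?\<eta> (x, 0)) = (\<lambda>x. w (x, 0) * ?\<eta> (x, 0))"
    using out by (auto simp: fun_eq_iff v_def)
  finally have "set_borel_measurable lborel (ball 0 1) (\<lambda>x. w (x, 0) * ?\<eta> (x, 0))"
    unfolding set_borel_measurable_def
    by (intro borel_measurable_scaleR borel_measurable_indicator) simp_all
  moreover have "(\<lambda>k. \<integral>\<^sup>+x\<in>ball 0 1. ennreal ((w (x, 0) * ?\<eta> (x, 0) - \<phi> k (x, 0) * ?\<eta> (x, 0))\<^sup>2) \<partial>lborel) \<longlonglongrightarrow> 0"
  proof (rule ennreal_tendsto_0_le[OF _ tr, of _ 1])
    fix k
    show "(\<integral>\<^sup>+x\<in>ball 0 1. ennreal ((w (x, 0) * ?\<eta> (x, 0) - \<phi> k (x, 0) * ?\<eta> (x, 0))\<^sup>2) \<partial>lborel) \<le>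
      ennreal 1 * (\<integral>\<^sup>+x\<in>ball 0 t. ennreal ((w (x, 0) - \<phi> k (x, 0))\<^sup>2) \<partial>lborel)"
      unfolding ennreal_1 mult_1
    proof (rule nn_integral_mono)
      fix x :: "real^'n"
      have "(w (x, 0) * ?\<eta> (x, 0) - \<phi> k (x, 0) * ?\<eta> (x, 0))\<^sup>2 = (w (x, 0) - \<phi> k (x, 0))\<^sup>2 * (?\<eta> (x, 0))\<^sup>2"
        by (simp add: left_diff_distrib[symmetric] power_mult_distrib)
      also have "\<dots> \<le> (w (x, 0) - \<phi> k (x, 0))\<^sup>2 * 1\<^sup>2"
        using cutoff_bounds[of t \<epsilon> "(x, 0)"] by (intro mult_left_mono power_mono) auto
      finally have "ennreal ((w (x, 0) * ?\<eta> (x, 0) - \<phi> k (x, 0) * ?\<eta> (x, 0))\<^sup>2) \<le> ennreal ((w (x, 0) - \<phi> k (x, 0))\<^sup>2)"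
        by (intro ennreal_leI) simp
      then show "ennreal ((w (x, 0) * ?\<eta> (x, 0) - \<phi> k (x, 0) * ?\<eta> (x, 0))\<^sup>2) * indicator (ball 0 1) x \<le> ennreal ((w (x, 0) - \<phi> k (x, 0))\<^sup>2) * indicator (ball 0 t) x"
        using out[of x] by (cases "x \<in> ball 0 t") (auto split: split_indicator)
    qed
  qed
  ultimately show ?thesis
    using H1a_lim_mult_cutoff[OF \<phi> lim less_imp_le[OF t(1)] t(2) \<epsilon>] smooth_mult[OF \<phi> smooth_cutoff]
    unfolding has_trace_def by (intro conjI exI) auto
qed

text \<open>The weak equation tested with w times a cutoff. Both sides localise to radius t, where
  the abstract trace of u may be replaced by its boundary values.\<close>

lemma weak_solution_cutoff:
  fixes w :: "(real^'n) \<times> real \<Rightarrow> real"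
  assumes a: "-1 < a" "a < 1" and weak: "weak_solution a p lm lp g u" and V: "H1a_grad a 1 u V"
    and cont: "continuous_on (half_ball 1 \<union> flat_ball 1) u"
    and \<phi>: "\<And>k. smooth (\<phi> k)" and lim: "H1a_lim a t \<phi> w W" and t: "0 < t" "t < 1" and \<epsilon>: "\<epsilon> > 0"
    and tr: "(\<lambda>k. \<integral>\<^sup>+x\<in>ball 0 t. ennreal ((w (x, 0) - \<phi> k (x, 0))\<^sup>2) \<partial>lborel) \<longlonglongrightarrow> 0"
    and cw: "continuous_on (ball 0 t) (\<lambda>x. w (x, 0))"
  shows "(LINT z:half_ball t|lborel. snd z powr a * (V z \<bullet> (w z *\<^sub>R grad (cutoff t \<epsilon>) z + cutoff t \<epsilon> z *\<^sub>R W z)))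
    = (LINT x:ball 0 t|lborel. boundary_flux p lm lp (u (x, 0)) * (w (x, 0) * cutoff t \<epsilon> (x, 0::real)))"
proof -
  let ?\<eta> = "cutoff t \<epsilon> :: (real^'n) \<times> real \<Rightarrow> real"
  let ?W = "\<lambda>z. if z \<in> half_ball t then w z *\<^sub>R grad ?\<eta> z + ?\<eta> z *\<^sub>R W z else 0"
  obtain tu where tu: "has_trace a 1 u tu"
    and eq: "\<And>V \<phi> W s. H1a_grad a 1 u V \<Longrightarrow> H1a0_grad a 1 \<phi> W \<Longrightarrow> has_trace a 1 \<phi> s \<Longrightarrow>
           set_integrable lborel (ball 0 1) (\<lambda>x. boundary_flux p lm lp (tu x) * s x) \<and>
           (LINT z:half_ball 1|lborel. snd z powr a * (V z \<bullet> W z)) =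
           (LINT x:ball 0 1|lborel. boundary_flux p lm lp (tu x) * s x)"
    using weak unfolding weak_solution_def by blast
  have "H1a0_grad a 1 (\<lambda>z. w z * ?\<eta> z) ?W"
    unfolding H1a0_grad_def
    using H1a_lim_mult_cutoff[OF \<phi> lim less_imp_le[OF t(1)] t(2) \<epsilon>]
      vanishing_near_sphere_cutoff[OF \<phi> less_imp_le[OF t(1)] t(2) \<epsilon>]
    by (intro exI[of _ "\<lambda>k z. \<phi> k z * ?\<eta> z"]) auto
  from eq[OF V this has_trace_mult_cutoff[OF \<phi> lim t \<epsilon> tr cw]]
  have int: "set_integrable lborel (ball 0 1) (\<lambda>x. boundary_flux p lm lp (tu x) * (w (x, 0) * ?\<eta> (x, 0)))"
    and id: "(LINT z:half_ball 1|lborel. snd z powr a * (V z \<bullet> ?W z)) =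
           (LINT x:ball 0 1|lborel. boundary_flux p lm lp (tu x) * (w (x, 0) * ?\<eta> (x, 0)))"
    by auto
  have "(LINT z:half_ball t|lborel. snd z powr a * (V z \<bullet> (w z *\<^sub>R grad ?\<eta> z + ?\<eta> z *\<^sub>R W z))) = (LINT z:half_ball 1|lborel. snd z powr a * (V z \<bullet> ?W z))"
    unfolding set_lebesgue_integral_def using t
    by (intro Bochner_Integration.integral_cong) (auto simp: half_ball_def split: split_indicator)
  also note id
  also have "(LINT x:ball 0 1|lborel. boundary_flux p lm lp (tu x) * (w (x, 0) * ?\<eta> (x, 0)))
     = (LINT x:ball 0 t|lborel. boundary_flux p lm lp (u (x, 0)) * (w (x, 0) * ?\<eta> (x, 0)))"
    unfolding set_lebesgue_integral_def
  proof (rule integral_cong_AE)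
    have AE: "AE x in lborel. x \<in> ball 0 t \<longrightarrow> tu x = u (x, 0)"
      by (rule has_trace_AE_eq[OF a tu cont t])
    have out: "?\<eta> (x, 0) = 0" if "x \<notin> ball 0 t" for x
      using that t \<epsilon> by (intro cutoff_outside) (auto simp: norm_Pair)
    show "AE x in lborel. indicator (ball 0 1) x *\<^sub>R (boundary_flux p lm lp (tu x) * (w (x, 0) * ?\<eta> (x, 0)))
      = indicator (ball 0 t) x *\<^sub>R (boundary_flux p lm lp (u (x, 0)) * (w (x, 0) * ?\<eta> (x, 0)))"
      using AE
    proof eventually_elim
      case (elim x)
      then show ?case using out[of x] t by (cases "x \<in> ball 0 t") (auto split: split_indicator)
    qed
    \<comment> \<open>Measurability of the integrand with the abstract trace comes from its
      integrability, which the weak formulation includes.\<close>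
    show "(\<lambda>x. indicator (ball 0 1) x *\<^sub>R (boundary_flux p lm lp (tu x) * (w (x, 0) * ?\<eta> (x, 0)))) \<in> borel_measurable lborel"
      using int unfolding set_integrable_def by (rule borel_measurable_integrable)
    have cu: "continuous_on (ball 0 t) (\<lambda>x. u (x, 0))"
      by (intro continuous_on_compose2[OF cont] continuous_intros) (use t in \<open>auto simp: flat_ball_def\<close>)
    define v1 v2 where "v1 x = (if x \<in> ball 0 t then w (x, 0) else 0)" and "v2 x = (if x \<in> ball 0 t then u (x, 0) else 0)" for x :: "real^'n"
    note [measurable] = borel_measurable_smooth(1)[OF smooth_cutoff] borel_measurable_pair0
    have [measurable]: "v1 \<in> borel_measurable borel" unfolding v1_def[abs_def]
      by (rule borel_measurable_continuous_on_if[OF _ cw]) auto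
    have [measurable]: "v2 \<in> borel_measurable borel" unfolding v2_def[abs_def]
      by (rule borel_measurable_continuous_on_if[OF _ cu]) auto
    have "(\<lambda>x. boundary_flux p lm lp (v2 x) * (v1 x * ?\<eta> (x, 0))) \<in> borel_measurable borel"
      unfolding boundary_flux_def by measurable
    then have "(\<lambda>x. indicator (ball 0 t) x *\<^sub>R (boundary_flux p lm lp (v2 x) * (v1 x * ?\<eta> (x, 0)))) \<in> borel_measurable lborel"
      by (intro borel_measurable_scaleR borel_measurable_indicator) simp_all
    also have "(\<lambda>x. indicator (ball 0 t) x *\<^sub>R (boundary_flux p lm lp (v2 x) * (v1 x * ?\<eta> (x, 0))))
      = (\<lambda>x. indicator (ball 0 t) x *\<^sub>R (boundary_flux p lm lp (u (x, 0)) * (w (x, 0) * ?\<eta> (x, 0))))"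
      by (auto simp: fun_eq_iff v1_def v2_def split: split_indicator)
    finally show "(\<lambda>x. indicator (ball 0 t) x *\<^sub>R (boundary_flux p lm lp (u (x, 0)) * (w (x, 0) * ?\<eta> (x, 0)))) \<in> borel_measurable lborel" .
  qed
  finally show ?thesis .
qed

subsection \<open>Integrals depending on a parameter\<close>

text \<open>A compact set that carries both the hemisphere measure and the flat one. Its compactness
  provides the uniform bounds on integrands.\<close>

definition half_disc :: "((real^'n) \<times> real) set" where
  "half_disc = {z. norm z \<le> 1 \<and> 0 \<le> snd z}"

lemma compact_half_disc: "compact (half_disc :: ((real^'n) \<times> real) set)"
proof -
  have eq: "half_disc = cball 0 1 \<inter> {z :: (real^'n) \<times> real. 0 \<le> snd z}" by (auto simp: half_disc_def)
  have "closed {z :: (real^'n) \<times> real. 0 \<le> snd z}" by (intro closed_Collect_le continuous_intros)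
  then show ?thesis unfolding eq by (intro compact_Int_closed compact_cball)
qed

text \<open>Dominated convergence along sequences. The parameter space is general because it is used
  with one radius as well as with a pair of radii.\<close>

lemma continuous_on_integral_param:
  fixes M :: "((real^'n) \<times> real) measure" and G :: "'p::heine_borel \<Rightarrow> (real^'n) \<times> real \<Rightarrow> real"
  assumes fin: "finite_measure M" and AE: "AE z in M. z \<in> half_disc"
    and meas: "\<And>s. s \<in> S \<Longrightarrow> G s \<in> borel_measurable M"
    and cont: "continuous_on (S \<times> half_disc) (\<lambda>(s, z). G s z)"
  shows "continuous_on S (\<lambda>s. LINT z|M. G s z)"
    and "\<And>s. s \<in> S \<Longrightarrow> integrable M (G s)"
proof -
  interpret finite_measure M by fact
  have bound: "\<exists>C. \<forall>s\<in>T. \<forall>z\<in>half_disc. \<bar>G s z\<bar> \<le> C" if "compact T" "T \<subseteq> S" for T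
  proof -
    have "continuous_on (T \<times> half_disc) (\<lambda>(s, z). G s z)"
      by (rule continuous_on_subset[OF cont]) (use that in auto)
    then have "bounded ((\<lambda>(s, z). G s z) ` (T \<times> half_disc))"
      by (intro compact_imp_bounded compact_continuous_image compact_Times that compact_half_disc)
    then obtain C where "\<forall>y\<in>(\<lambda>(s, z). G s z) ` (T \<times> half_disc). norm y \<le> C" unfolding bounded_iff by blast
    then have "\<forall>s\<in>T. \<forall>z\<in>half_disc. \<bar>G s z\<bar> \<le> C" by force
    then show ?thesis by blast
  qed
  show "integrable M (G s)" if s: "s \<in> S" for s
  proof -
    obtain C where "\<forall>s\<in>{s}. \<forall>z\<in>half_disc. \<bar>G s z\<bar> \<le> C" using bound[of "{s}"] s by auto
    then have C: "\<And>z. z \<in> half_disc \<Longrightarrow> \<bar>G s z\<bar> \<le> C" by blast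
    have "AE z in M. norm (G s z) \<le> C" using AE by eventually_elim (simp add: C)
    then show ?thesis by (rule integrable_const_bound) (rule meas[OF s])
  qed
  show "continuous_on S (\<lambda>s. LINT z|M. G s z)"
    unfolding continuous_on_sequentially
  proof safe
    fix x :: "nat \<Rightarrow> 'p" and s assume s: "s \<in> S" and x: "\<forall>n. x n \<in> S" "x \<longlonglongrightarrow> s"
    \<comment> \<open>A convergent sequence together with its limit is compact, so a single constant
      dominates the integrands for all its members.\<close>
    have "compact (insert s (range x))" using x(2) by (rule compact_sequence_with_limit)
    then obtain C where "\<forall>s\<in>insert s (range x). \<forall>z\<in>half_disc. \<bar>G s z\<bar> \<le> C" using bound s x by blast
    then have C: "\<And>n z. z \<in> half_disc \<Longrightarrow> \<bar>G (x n) z\<bar> \<le> C" by blast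
    have "(\<lambda>n. LINT z|M. G (x n) z) \<longlonglongrightarrow> (LINT z|M. G s z)"
    proof (rule integral_dominated_convergence[where w="\<lambda>_. C"])
      show "AE z in M. (\<lambda>n. G (x n) z) \<longlonglongrightarrow> G s z"
        using AE
      proof eventually_elim
        case (elim z)
        have "continuous_on S (\<lambda>s. G s z)"
          by (rule continuous_on_compose2[OF cont, of S "\<lambda>s. (s, z)", simplified])
             (use elim in \<open>auto intro!: continuous_intros\<close>)
        then show ?case using s x by (auto simp: continuous_on_sequentially comp_def)
      qed
      show "AE z in M. norm (G (x n) z) \<le> C" for n using AE by eventually_elim (simp add: C)
    qed (use meas s x in auto)
    then show "((\<lambda>s. LINT z|M. G s z) \<circ> x) \<longlonglongrightarrow> (LINT z|M. G s z)" by (simp add: comp_def)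
  qed
qed

text \<open>Difference quotients are dominated by a bound for the derivative on the compact set of
  parameters and points, by the mean value inequality; the dominating constant is integrable because
  the measure is finite.\<close>

lemma has_real_derivative_integral_param:
  fixes M :: "((real^'n) \<times> real) measure" and G :: "real \<Rightarrow> (real^'n) \<times> real \<Rightarrow> real"
  assumes fin: "finite_measure M" and AE: "AE z in M. z \<in> half_disc" and s: "\<alpha> < s" "s < \<beta>"
    and meas: "\<And>s. s \<in> {\<alpha>..\<beta>} \<Longrightarrow> G s \<in> borel_measurable M"
    and meas': "\<And>s. s \<in> {\<alpha>..\<beta>} \<Longrightarrow> G' s \<in> borel_measurable M"
    and cont: "continuous_on ({\<alpha>..\<beta>} \<times> half_disc) (\<lambda>(s, z). G s z)"
    and cont': "continuous_on ({\<alpha>..\<beta>} \<times> half_disc) (\<lambda>(s, z). G' s z)"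
    and d: "\<And>s z. s \<in> {\<alpha>..\<beta>} \<Longrightarrow> z \<in> half_disc \<Longrightarrow> ((\<lambda>s. G s z) has_real_derivative G' s z) (at s)"
  shows "((\<lambda>s. LINT z|M. G s z) has_real_derivative (LINT z|M. G' s z)) (at s)"
proof -
  interpret finite_measure M by fact
  have "bounded ((\<lambda>(s, z). G' s z) ` ({\<alpha>..\<beta>} \<times> half_disc))"
    by (intro compact_imp_bounded compact_continuous_image cont' compact_Times compact_half_disc compact_Icc)
  then obtain C where "\<forall>y\<in>(\<lambda>(s, z). G' s z) ` ({\<alpha>..\<beta>} \<times> half_disc). norm y \<le> C" unfolding bounded_iff by blast
  then have C: "\<bar>G' s z\<bar> \<le> C" if "s \<in> {\<alpha>..\<beta>}" "z \<in> half_disc" for s z using that by force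
  note int = continuous_on_integral_param(2)[OF fin AE meas cont, simplified]
  have lip: "\<bar>G x z - G s z\<bar> \<le> C * \<bar>x - s\<bar>" if "x \<in> {\<alpha>..\<beta>}" "z \<in> half_disc" for x z
  proof -
    have "norm (G x z - G s z) \<le> C * norm (x - s)"
    proof (rule field_differentiable_bound[of "{\<alpha>..\<beta>}" "\<lambda>s. G s z" "\<lambda>s. G' s z"])
      fix s assume "s \<in> {\<alpha>..\<beta>}"
      then show "((\<lambda>s. G s z) has_real_derivative G' s z) (at s within {\<alpha>..\<beta>})" "norm (G' s z) \<le> C"
        using d[OF _ that(2)] C[OF _ that(2)] by (auto intro: has_field_derivative_at_within)
    qed (use that s in auto)
    then show ?thesis by simp
  qed
  have "((\<lambda>x. ((LINT z|M. G x z) - (LINT z|M. G s z)) / (x - s)) \<longlongrightarrow> (LINT z|M. G' s z)) (at s within {\<alpha><..<\<beta>})"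
    unfolding tendsto_at_iff_sequentially
  proof safe
    fix x :: "nat \<Rightarrow> real" assume x: "\<forall>i. x i \<in> {\<alpha><..<\<beta>} - {s}" "x \<longlonglongrightarrow> s"
    then have x': "x i \<in> {\<alpha>..\<beta>}" "x i \<noteq> s" for i by (metis DiffD1 DiffD2 atLeastAtMost_iff greaterThanLessThan_iff less_imp_le insertI1)+
    have s': "s \<in> {\<alpha>..\<beta>}" using s by simp
    have "(\<lambda>i. LINT z|M. (G (x i) z - G s z) / (x i - s)) \<longlonglongrightarrow> (LINT z|M. G' s z)"
    proof (rule integral_dominated_convergence[where w="\<lambda>_. C"])
      show "G' s \<in> borel_measurable M" by (rule meas'[OF s'])
      show "(\<lambda>z. (G (x i) z - G s z) / (x i - s)) \<in> borel_measurable M" for i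
        using meas[OF x'(1)[of i]] meas[OF s'] by measurable
      show "integrable M (\<lambda>_. C)" by simp
      show "AE z in M. (\<lambda>i. (G (x i) z - G s z) / (x i - s)) \<longlonglongrightarrow> G' s z"
        using AE
      proof eventually_elim
        case (elim z)
        have "((\<lambda>x. (G x z - G s z) / (x - s)) \<longlongrightarrow> G' s z) (at s)"
          using d[OF s' elim] by (simp add: has_field_derivative_iff)
        moreover have "filterlim x (at s) sequentially"
          using x x'(2) by (auto simp: filterlim_at)
        ultimately show ?case by (rule filterlim_compose)
      qed
      show "AE z in M. norm ((G (x i) z - G s z) / (x i - s)) \<le> C" for i
        using AE
      proof eventually_elim
        case (elim z)
        have "\<bar>G (x i) z - G s z\<bar> \<le> C * \<bar>x i - s\<bar>" by (rule lip[OF x'(1) elim])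
        then show ?case using x'(2)[of i] by (simp add: divide_le_eq)
      qed
    qed
    moreover have "(LINT z|M. (G (x i) z - G s z) / (x i - s)) = ((LINT z|M. G (x i) z) - (LINT z|M. G s z)) / (x i - s)" for i
      using Bochner_Integration.integral_diff[OF int[of "x i"] int[of s]] x'(1)[of i] s' by simp
    ultimately show "((\<lambda>x. ((LINT z|M. G x z) - (LINT z|M. G s z)) / (x - s)) \<circ> x) \<longlonglongrightarrow> (LINT z|M. G' s z)"
      by (simp only: comp_def)
  qed
  moreover have "at s within {\<alpha><..<\<beta>} = at s" using s by (intro at_within_open) auto
  ultimately show ?thesis by (simp add: has_field_derivative_iff)
qed

lemma deriv_smooth_step_nonneg: "0 \<le> deriv smooth_step x"
  by (rule mono_on_imp_deriv_nonneg[of UNIV smooth_step, OF _ smooth_step_deriv])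
     (auto simp: mono_on_def smooth_step_mono)

text \<open>The radial derivative of \<open>- cutoff t \<epsilon>\<close> is an approximation of the unit mass at \<open>t\<close>.\<close>

lemma cutoff_approximates_delta:
  fixes m :: "real \<Rightarrow> real" and \<epsilon> :: "nat \<Rightarrow> real"
  assumes t1: "0 < t1" "t1 < t" and m: "continuous_on {t1..t} m"
    and \<epsilon>: "\<And>k. \<epsilon> k > 0" "\<epsilon> \<longlonglongrightarrow> 0"
  shows "(\<lambda>k. LINT s|lborel. indicator {0<..<t} s * (m s * (2 * s / \<epsilon> k * deriv smooth_step ((t\<^sup>2 - s\<^sup>2) / \<epsilon> k)))) \<longlonglongrightarrow> m t"
proof (rule LIMSEQ_I)
  fix e :: real assume e: "e > 0"
  have "\<exists>d>0. \<forall>s\<in>{t1..t}. dist s t < d \<longrightarrow> dist (m s) (m t) < e / 2"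
    using m t1 e unfolding continuous_on_iff by (metis atLeastAtMost_iff half_gt_zero less_imp_le order_refl)
  then obtain d where d: "d > 0" "\<And>s. s \<in> {t1..t} \<Longrightarrow> dist s t < d \<Longrightarrow> dist (m s) (m t) < e / 2" by blast
  \<comment> \<open>Close enough to t that m varies by at most e/2 on [t2, t], but not below t1,
    where m need not be continuous.\<close>
  define t2 where "t2 = max t1 (t - d / 2)"
  have t2: "0 < t2" "t1 \<le> t2" "t2 < t" using t1 d by (auto simp: t2_def)
  have md: "\<bar>m s - m t\<bar> \<le> e / 2" if "s \<in> {t2..t}" for s
    using d(2)[of s] that d(1) t2 by (auto simp: t2_def dist_real_def)
  have "t\<^sup>2 - t2\<^sup>2 > 0" using t2 by (simp add: power_strict_mono)
  then have "\<forall>\<^sub>F k in sequentially. \<epsilon> k < t\<^sup>2 - t2\<^sup>2" using \<epsilon>(2) by (rule order_tendstoD(2)[rotated])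
  \<comment> \<open>From here on the step has reached 1 at s = t2, so the kernel is concentrated on
    [t2, t].\<close>
  then obtain N where N: "\<And>k. k \<ge> N \<Longrightarrow> \<epsilon> k < t\<^sup>2 - t2\<^sup>2" by (auto simp: eventually_sequentially)
  show "\<exists>no. \<forall>k\<ge>no. norm ((LINT s|lborel. indicator {0<..<t} s * (m s * (2 * s / \<epsilon> k * deriv smooth_step ((t\<^sup>2 - s\<^sup>2) / \<epsilon> k)))) - m t) < e"
  proof (intro exI allI impI)
    fix k assume k: "k \<ge> N"
    define K where "K s = 2 * s / \<epsilon> k * deriv smooth_step ((t\<^sup>2 - s\<^sup>2) / \<epsilon> k)" for s
    have cK: "continuous_on {t2..t} K"
      unfolding K_def using \<epsilon>(1)[of k]
      by (intro continuous_intros continuous_on_compose2[OF continuous_on_deriv_smooth_step[of UNIV]]) auto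
    \<comment> \<open>The kernel is an exact derivative. Its integral over [t2, t] is the total rise
      of the step, which is 1.\<close>
    have dK: "((\<lambda>s. - smooth_step ((t\<^sup>2 - s\<^sup>2) / \<epsilon> k)) has_real_derivative K s) (at s)" for s
    proof -
      have "((\<lambda>s. (t\<^sup>2 - s\<^sup>2) / \<epsilon> k) has_real_derivative - (2 * s / \<epsilon> k)) (at s)"
        using \<epsilon>(1)[of k] by (auto intro!: derivative_eq_intros)
      from DERIV_minus[OF DERIV_chain2[OF smooth_step_deriv this]] show ?thesis by (simp add: K_def mult.commute)
    qed
    have "has_bochner_integral lborel (\<lambda>s. indicator {t2..t} s *\<^sub>R K s) (- smooth_step ((t\<^sup>2 - t\<^sup>2) / \<epsilon> k) - (- smooth_step ((t\<^sup>2 - t2\<^sup>2) / \<epsilon> k)))"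
      using t2 dK cK by (intro has_bochner_integral_FTC_Icc)
        (auto simp: has_real_derivative_iff_has_vector_derivative intro: has_vector_derivative_at_within)
    moreover have "smooth_step ((t\<^sup>2 - t\<^sup>2) / \<epsilon> k) = 0" "smooth_step ((t\<^sup>2 - t2\<^sup>2) / \<epsilon> k) = 1"
      using N[OF k] \<epsilon>(1)[of k] by (auto intro!: smooth_step_0 smooth_step_1)
    ultimately have iK: "integrable lborel (\<lambda>s. indicator {t2..t} s * K s)" "(LINT s|lborel. indicator {t2..t} s * K s) = 1"
      by (auto simp: has_bochner_integral_iff)
    have "m s * K s * indicator {0<..<t} s = indicator {t2..t} s * (m s * K s)" for s
    proof -
      consider "s \<le> 0" | "0 < s" "s < t2" | "t2 \<le> s" "s < t" | "s = t" | "s > t" by linarith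
      then show ?thesis
      proof cases
        case 2
        then have "s\<^sup>2 \<le> t2\<^sup>2" using t2 by (intro power_mono) auto
        then have "1 \<le> (t\<^sup>2 - s\<^sup>2) / \<epsilon> k" using N[OF k] \<epsilon>(1)[of k] by simp
        then show ?thesis using 2 by (simp add: K_def deriv_smooth_step_1)
      next
        case 4
        then show ?thesis using t2 by (simp add: K_def deriv_smooth_step_0)
      qed (use t2 in auto)
    qed
    then have eq: "indicator {0<..<t} s * (m s * K s) = indicator {t2..t} s * (m s * K s)" for s
      by (simp add: mult.commute)
    have "continuous_on {t2..t} m" by (rule continuous_on_subset[OF m]) (use t2 in auto)
    then have imK: "integrable lborel (\<lambda>s. indicator {t2..t} s * (m s * K s))"
      using borel_integrable_atLeastAtMost'[OF continuous_on_mult[OF _ cK]] by (simp add: set_integrable_def)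
    have "(LINT s|lborel. indicator {0<..<t} s * (m s * K s)) - m t
        = (LINT s|lborel. indicator {t2..t} s * (m s * K s)) - m t * (LINT s|lborel. indicator {t2..t} s * K s)"
      by (simp add: eq iK)
    also have "\<dots> = (LINT s|lborel. indicator {t2..t} s * (m s * K s) - m t * (indicator {t2..t} s * K s))"
      using imK iK by simp
    finally have "\<bar>(LINT s|lborel. indicator {0<..<t} s * (m s * K s)) - m t\<bar>
        = \<bar>LINT s|lborel. indicator {t2..t} s * (m s * K s) - m t * (indicator {t2..t} s * K s)\<bar>" by simp
    also have "\<dots> \<le> (LINT s|lborel. \<bar>indicator {t2..t} s * (m s * K s) - m t * (indicator {t2..t} s * K s)\<bar>)"
      by (rule integral_abs_bound)
    also have "\<dots> \<le> (LINT s|lborel. e / 2 * (indicator {t2..t} s * K s))"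
    proof (rule integral_mono)
      fix s
      show "\<bar>indicator {t2..t} s * (m s * K s) - m t * (indicator {t2..t} s * K s)\<bar> \<le> e / 2 * (indicator {t2..t} s * K s)"
      proof (cases "s \<in> {t2..t}")
        case True
        have "0 \<le> K s" using True t2 \<epsilon>(1)[of k] deriv_smooth_step_nonneg by (simp add: K_def)
        moreover have "m s * K s - m t * K s = (m s - m t) * K s" by (simp add: algebra_simps)
        moreover have "\<bar>m s - m t\<bar> * K s \<le> e / 2 * K s" using \<open>0 \<le> K s\<close> by (rule mult_right_mono[OF md[OF True]])
        ultimately show ?thesis using True by (simp add: abs_mult)
      qed simp
    qed (use imK iK in auto)
    also have "\<dots> = e / 2" by (simp add: iK)
    finally show "norm ((LINT s|lborel. indicator {0<..<t} s * (m s * (2 * s / \<epsilon> k * deriv smooth_step ((t\<^sup>2 - s\<^sup>2) / \<epsilon> k)))) - m t) < e"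
      using e unfolding K_def by simp
  qed
qed

subsection \<open>Green's formula on half balls\<close>

text \<open>The product of the norms of the two gradients is dominated by the sum of the two
  integrands of the squared norms, both of finite integral.\<close>

lemma H1a_sqnorm_finite_integrable:
  fixes u w :: "(real^'n) \<times> real \<Rightarrow> real"
  assumes "H1a_sqnorm a r u V < \<infinity>" "H1a_sqnorm a r w W < \<infinity>"
    and V: "set_borel_measurable borel (half_ball r) V" and W: "set_borel_measurable borel (half_ball r) W"
    and u: "set_borel_measurable borel (half_ball r) u" and w: "set_borel_measurable borel (half_ball r) w"
  shows "set_integrable lborel (half_ball r) (\<lambda>z. snd z powr a * (V z \<bullet> W z))"
proof -
  define V' W' u' w' where "V' z = indicator (half_ball r) z *\<^sub>R V z" and "W' z = indicator (half_ball r) z *\<^sub>R W z"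
    and "u' z = indicator (half_ball r) z *\<^sub>R u z" and "w' z = indicator (half_ball r) z *\<^sub>R w z" for z
  have [measurable]: "V' \<in> borel_measurable borel" "W' \<in> borel_measurable borel" "u' \<in> borel_measurable borel" "w' \<in> borel_measurable borel"
    using V W u w by (simp_all add: set_borel_measurable_def V'_def[abs_def] W'_def[abs_def] u'_def[abs_def] w'_def[abs_def])
  have finite_hemisphere: "H1a_sqnorm a r u' V' < \<infinity>" "H1a_sqnorm a r w' W' < \<infinity>"
    using assms(1,2) H1a_sqnorm_cong[of r u' u V' V] H1a_sqnorm_cong[of r w' w W' W]
    by (simp_all add: V'_def W'_def u'_def w'_def)
  have *: "integrable lborel (\<lambda>z. snd z powr a * (norm (V' z) * norm (W' z)))"
  proof (rule integrableI_bounded)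
    have "(\<integral>\<^sup>+z. ennreal (norm (snd z powr a * (norm (V' z) * norm (W' z)))) \<partial>lborel) \<le>
      (\<integral>\<^sup>+z. ennreal (snd z powr a * ((norm (V' z))\<^sup>2 + (u' z)\<^sup>2)) * indicator (half_ball r) z +
        ennreal (snd z powr a * ((norm (W' z))\<^sup>2 + (w' z)\<^sup>2)) * indicator (half_ball r) z \<partial>lborel)"
    proof (rule nn_integral_mono)
      fix z
      show "ennreal (norm (snd z powr a * (norm (V' z) * norm (W' z)))) \<le>
        ennreal (snd z powr a * ((norm (V' z))\<^sup>2 + (u' z)\<^sup>2)) * indicator (half_ball r) z +
        ennreal (snd z powr a * ((norm (W' z))\<^sup>2 + (w' z)\<^sup>2)) * indicator (half_ball r) z"
      proof (cases "z \<in> half_ball r")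
        case True
        have "norm (V' z) * norm (W' z) \<le> ((norm (V' z))\<^sup>2 + (u' z)\<^sup>2) + ((norm (W' z))\<^sup>2 + (w' z)\<^sup>2)"
          using zero_le_power2[of "norm (V' z) - norm (W' z)"] zero_le_power2[of "norm (V' z) + norm (W' z)"]
            zero_le_power2[of "u' z"] zero_le_power2[of "w' z"] unfolding power2_diff power2_sum by linarith
        then have "snd z powr a * (norm (V' z) * norm (W' z)) \<le> snd z powr a * (((norm (V' z))\<^sup>2 + (u' z)\<^sup>2) + ((norm (W' z))\<^sup>2 + (w' z)\<^sup>2))"
          by (rule mult_left_mono) simp
        then show ?thesis using True by (simp add: ennreal_plus[symmetric] ennreal_leI distrib_left del: ennreal_plus)
      qed (simp add: V'_def)
    qed
    also have "\<dots> = H1a_sqnorm a r u' V' + H1a_sqnorm a r w' W'"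
      unfolding H1a_sqnorm_def by (rule nn_integral_add) measurable
    also have "\<dots> < \<infinity>" using finite_hemisphere by simp
    finally show "(\<integral>\<^sup>+z. ennreal (norm (snd z powr a * (norm (V' z) * norm (W' z)))) \<partial>lborel) < \<infinity>" .
  qed measurable
  have "integrable lborel (\<lambda>z. snd z powr a * (V' z \<bullet> W' z))"
    by (rule Bochner_Integration.integrable_bound[OF *])
       (auto simp: abs_mult intro!: mult_left_mono Cauchy_Schwarz_ineq2)
  then show "set_integrable lborel (half_ball r) (\<lambda>z. snd z powr a * (V z \<bullet> W z))"
    unfolding set_integrable_def by (rule Bochner_Integration.integrable_cong[THEN iffD1, OF refl, rotated]) (simp add: V'_def W'_def split: split_indicator)
qed

lemma integrable_weight_bounded:
  fixes k :: "(real^'n) \<times> real \<Rightarrow> real"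
  assumes a: "a > -1" and [measurable]: "k \<in> borel_measurable borel" and k: "\<And>z. z \<in> half_ball r \<Longrightarrow> \<bar>k z\<bar> \<le> C"
  shows "integrable lborel (\<lambda>z. indicator (half_ball r) z * (snd z powr a * k z))"
proof (rule integrableI_bounded)
  have "(\<integral>\<^sup>+z. ennreal (norm (indicator (half_ball r) z * (snd z powr a * k z))) \<partial>lborel) \<le>
    (\<integral>\<^sup>+z. ennreal \<bar>C\<bar> * (ennreal (snd z powr a) * indicator (half_ball r) z) \<partial>(lborel :: ((real^'n) \<times> real) measure))"
  proof (rule nn_integral_mono)
    fix z :: "(real^'n) \<times> real"
    show "ennreal (norm (indicator (half_ball r) z * (snd z powr a * k z))) \<le> ennreal \<bar>C\<bar> * (ennreal (snd z powr a) * indicator (half_ball r) z)"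
    proof (cases "z \<in> half_ball r")
      case True
      have "snd z powr a * \<bar>k z\<bar> \<le> snd z powr a * \<bar>C\<bar>"
        using k[OF True] by (intro mult_left_mono) auto
      then show ?thesis using True by (simp add: abs_mult ennreal_mult[symmetric] ennreal_leI mult.commute)
    qed simp
  qed
  also have "\<dots> = ennreal \<bar>C\<bar> * (\<integral>\<^sup>+z. ennreal (snd z powr a) * indicator (half_ball r) z \<partial>(lborel :: ((real^'n) \<times> real) measure))"
    by (rule nn_integral_cmult) measurable
  also have "\<dots> < \<infinity>" using nn_integral_weight_half_ball[OF a, of r, where 'n='n] by (simp add: ennreal_mult_less_top)
  finally show "(\<integral>\<^sup>+z. ennreal (norm (indicator (half_ball r) z * (snd z powr a * k z))) \<partial>lborel) < \<infinity>" .
qed measurable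

lemma compact_upper_cball: "compact {z :: (real^'n) \<times> real. norm z \<le> r \<and> 0 \<le> snd z}"
proof -
  have eq: "{z :: (real^'n) \<times> real. norm z \<le> r \<and> 0 \<le> snd z} = cball 0 r \<inter> {z. 0 \<le> snd z}" by auto
  have "closed {z :: (real^'n) \<times> real. 0 \<le> snd z}" by (intro closed_Collect_le continuous_intros)
  then show ?thesis unfolding eq by (intro compact_Int_closed compact_cball)
qed

lemma continuous_on_upper_ball_bounded:
  fixes k :: "(real^'n) \<times> real \<Rightarrow> real"
  assumes "continuous_on (upper_ball R) k" "r < R"
  obtains C where "C \<ge> 0" "\<And>z. norm z \<le> r \<Longrightarrow> 0 \<le> snd z \<Longrightarrow> \<bar>k z\<bar> \<le> C"
proof -
  let ?K = "{z :: (real^'n) \<times> real. norm z \<le> r \<and> 0 \<le> snd z}"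
  have "continuous_on ?K k" by (rule continuous_on_subset[OF assms(1)]) (use assms(2) in \<open>auto simp: upper_ball_def\<close>)
  then have "bounded (k ` ?K)" by (intro compact_imp_bounded compact_continuous_image compact_upper_cball)
  then obtain C where "\<forall>y\<in>k ` ?K. norm y \<le> C" unfolding bounded_iff by blast
  then have "\<And>z. norm z \<le> r \<Longrightarrow> 0 \<le> snd z \<Longrightarrow> \<bar>k z\<bar> \<le> \<bar>C\<bar>" by fastforce
  then show ?thesis using that[of "\<bar>C\<bar>"] by simp
qed

text \<open>The sequence \<phi> fixes one smooth approximation of u with gradient V. The function q
  stands for z . V, extended continuously to the flat part and by 0 elsewhere, so that it is Borel
  on the whole space.\<close>

locale weak_solution_near_0 =
  fixes a p lm lp R :: real and g u q :: "(real^'n) \<times> real \<Rightarrow> real" and V \<phi>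
  assumes a: "-1 < a" "a < 1" and p: "2 \<le> p" and lm: "0 \<le> lm" and lp: "0 \<le> lp" and R: "0 < R" "R < 1"
    and weak: "weak_solution a p lm lp g u"
    and cont: "continuous_on (half_ball 1 \<union> flat_ball 1) u"
    and smooth: "\<And>k. smooth (\<phi> k)" and lim: "H1a_lim a 1 \<phi> u V"
    and cV: "continuous_on (half_ball R) V"
    and cq: "continuous_on (upper_ball R) q" and q: "\<And>z. z \<in> half_ball R \<Longrightarrow> q z = V z \<bullet> z"
    and q_out: "\<And>z. z \<notin> upper_ball R \<Longrightarrow> q z = 0"
begin

text \<open>Values of u outside the half ball and the flat ball are arbitrary. This truncation is
  Borel on the whole space and agrees with u wherever radii below R are concerned.\<close>

definition u0 :: "(real^'n) \<times> real \<Rightarrow> real" where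
  "u0 z = (if z \<in> upper_ball R then u z else 0)"

lemma upper_ball_subset: "upper_ball R \<subseteq> half_ball 1 \<union> flat_ball 1"
proof safe
  fix x y assume "(x, y) \<in> upper_ball R" "(x, y) \<notin> flat_ball 1"
  moreover have "norm x \<le> norm (x, y)" by (rule norm_fst_le)
  ultimately show "(x, y) \<in> half_ball 1"
    using R by (cases "y = 0") (auto simp: upper_ball_def half_ball_def flat_ball_def)
qed

lemma continuous_on_u: "continuous_on (upper_ball R) u"
  by (rule continuous_on_subset[OF cont upper_ball_subset])

lemma continuous_on_u0: "continuous_on (upper_ball R) u0"
  using continuous_on_u by (rule continuous_on_eq) (simp add: u0_def)

lemma upper_ball_measurable: "upper_ball r \<in> sets (borel :: ((real^'n) \<times> real) measure)"
proof -
  have eq: "upper_ball r = ball 0 r \<inter> {z :: (real^'n) \<times> real. 0 \<le> snd z}" by (auto simp: upper_ball_def)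
  have "closed {z :: (real^'n) \<times> real. 0 \<le> snd z}" by (intro closed_Collect_le continuous_intros)
  then show ?thesis unfolding eq by (intro sets.Int borel_open open_ball borel_closed)
qed

lemma u0_measurable [measurable]: "u0 \<in> borel_measurable borel"
  unfolding u0_def[abs_def] by (rule borel_measurable_continuous_on_if[OF upper_ball_measurable continuous_on_u]) simp

lemma q_measurable [measurable]: "q \<in> borel_measurable borel"
proof -
  have "(\<lambda>z. if z \<in> upper_ball R then q z else 0) \<in> borel_measurable borel"
    by (rule borel_measurable_continuous_on_if[OF upper_ball_measurable cq]) simp
  moreover have "(\<lambda>z. if z \<in> upper_ball R then q z else 0) = q" using q_out by auto
  ultimately show ?thesis by simp
qed

definition flux :: "real \<Rightarrow> real" where "flux = boundary_flux p lm lp"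

lemma continuous_on_flux: "continuous_on UNIV flux"
proof -
  have "continuous_on UNIV (\<lambda>s. max (- s) 0 powr (p - 1))" "continuous_on UNIV (\<lambda>s::real. max s 0 powr (p - 1))"
    using p by (intro continuous_on_powr' continuous_intros; simp)+
  then show ?thesis unfolding flux_def boundary_flux_def
    by (intro continuous_on_diff continuous_on_mult continuous_on_const)
qed

lemma flux_measurable [measurable]: "flux \<in> borel_measurable borel"
  by (intro borel_measurable_continuous_onI continuous_on_flux)

lemma continuous_on_dilation:
  assumes "continuous_on (upper_ball R) k" "S \<subseteq> {0..<R}"
  shows "continuous_on (S \<times> half_disc) (\<lambda>(s, z). k (s *\<^sub>R z))"
proof -
  have "s *\<^sub>R z \<in> upper_ball R" if s: "s \<in> S" and z: "z \<in> half_disc" for s z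
  proof -
    have "0 \<le> s" "s < R" using s assms(2) by auto
    moreover have "s * norm z \<le> s * 1" using z \<open>0 \<le> s\<close> by (intro mult_left_mono) (auto simp: half_disc_def)
    ultimately show ?thesis using z by (simp add: upper_ball_def half_disc_def)
  qed
  then show ?thesis unfolding split_beta
    by (intro continuous_on_compose2[OF assms(1)] continuous_intros) auto
qed

lemma AE_hemisphere_half_disc: "AE z in (hemisphere a :: ((real^'n) \<times> real) measure). z \<in> half_disc"
  using AE_hemisphere by eventually_elim (simp add: half_disc_def)

lemma finite_hemisphere: "finite_measure (hemisphere a :: ((real^'n) \<times> real) measure)"
  by (rule finite_measure_hemisphere[OF a(1)])

text \<open>The weak equation is tested with the dilate u(c z) times cutoffs whose transition layer
  shrinks to the sphere of radius t. As the gradient of the cutoff is radial, its contribution is an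
  integral of u(c z) q(z) against a kernel concentrating on that sphere. Choosing c = s / t makes
  the dilate have radius s there.\<close>

lemma green_ball:
  assumes s: "0 < s" "s < R" and t: "0 < t" "t < R"
  defines "c \<equiv> s / t"
  shows "(LINT z:half_ball t|lborel. snd z powr a * (V z \<bullet> (c *\<^sub>R V (c *\<^sub>R z))))
    = t powr (real CARD('n) + a - 1) * (LINT z|hemisphere a. u0 (s *\<^sub>R z) * q (t *\<^sub>R z))
      + (LINT x:ball 0 t|lborel. flux (u (x, 0)) * u (c *\<^sub>R x, 0))"
proof -
  have c: "c > 0" and ct: "c * t = s" using s t by (simp_all add: c_def)
  define w W where "w z = u (c *\<^sub>R z)" and "W z = c *\<^sub>R V (c *\<^sub>R z)" for z
  have s1: "s \<le> 1" "t \<le> 1" using s t R by auto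
  have limV: "H1a_lim a t \<phi> u V" and limS: "H1a_lim a s \<phi> u V"
    by (rule H1a_lim_subset[OF s1(2) lim], rule H1a_lim_subset[OF s1(1) lim])
  have limW: "H1a_lim a t (\<lambda>k z. \<phi> k (c *\<^sub>R z)) w W"
    unfolding w_def W_def by (rule H1a_lim_dilation[OF smooth _ c]) (simp add: ct limS)
  have smW: "smooth (\<lambda>z. \<phi> k (c *\<^sub>R z))" for k by (rule smooth_dilation[OF smooth])
  have cw: "continuous_on (ball 0 t) (\<lambda>x. w (x, 0))"
    unfolding w_def
  proof (rule continuous_on_compose2[OF cont])
    show "continuous_on (ball 0 t) (\<lambda>x::real^'n. c *\<^sub>R (x, 0::real))" by (intro continuous_intros)
    show "(\<lambda>x::real^'n. c *\<^sub>R (x, 0)) ` ball 0 t \<subseteq> half_ball 1 \<union> flat_ball 1"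
    proof (rule image_subsetI)
      fix x :: "real^'n" assume "x \<in> ball 0 t"
      then have "c * norm x < c * t" using c by simp
      then have "norm (c *\<^sub>R x) < 1" using c ct s1 by simp
      then show "c *\<^sub>R (x, 0) \<in> half_ball 1 \<union> flat_ball 1" by (simp add: flat_ball_def)
    qed
  qed
  \<comment> \<open>After the change of variable x to c x, this is the trace convergence of u on the
    ball of radius s.\<close>
  have tr: "(\<lambda>k. \<integral>\<^sup>+x\<in>ball 0 t. ennreal ((w (x, 0) - \<phi> k (c *\<^sub>R (x, 0)))\<^sup>2) \<partial>lborel) \<longlonglongrightarrow> 0"
  proof (rule ennreal_tendsto_0_le)
    show "(\<lambda>k. \<integral>\<^sup>+x\<in>ball 0 s. ennreal ((u (x, 0) - \<phi> k (x, 0))\<^sup>2) \<partial>lborel) \<longlonglongrightarrow> 0"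
      by (rule H1a_lim_trace[OF a smooth lim cont]) (use s R in auto)
    fix k
    define v where "v x = (if x \<in> ball 0 s then u (x, 0) else 0)" for x :: "real^'n"
    have cus: "continuous_on (ball 0 s) (\<lambda>x. u (x, 0))"
      by (intro continuous_on_compose2[OF cont] continuous_intros) (use s1 in \<open>auto simp: flat_ball_def\<close>)
    note [measurable] = borel_measurable_smooth(1)[OF smooth] borel_measurable_pair0
    have [measurable]: "v \<in> borel_measurable borel" unfolding v_def[abs_def]
      by (rule borel_measurable_continuous_on_if[OF _ cus]) auto
    have [measurable]: "(indicator (ball 0 s) :: real^'n \<Rightarrow> ennreal) \<in> borel_measurable borel"
      by (intro borel_measurable_indicator borel_open open_ball)
    define F where "F x = ennreal ((v x - \<phi> k (x, 0))\<^sup>2) * indicator (ball 0 s) x" for x :: "real^'n"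
    have [measurable]: "F \<in> borel_measurable borel" unfolding F_def[abs_def] by measurable
    have "(\<integral>\<^sup>+x\<in>ball 0 t. ennreal ((w (x, 0) - \<phi> k (c *\<^sub>R (x, 0)))\<^sup>2) \<partial>lborel) = (\<integral>\<^sup>+x. F (c *\<^sub>R x) \<partial>lborel)"
    proof (rule nn_integral_cong)
      fix x :: "real^'n"
      have "c *\<^sub>R x \<in> ball 0 s \<longleftrightarrow> x \<in> ball 0 t" using c unfolding ct[symmetric] by simp
      then show "ennreal ((w (x, 0) - \<phi> k (c *\<^sub>R (x, 0)))\<^sup>2) * indicator (ball 0 t) x = F (c *\<^sub>R x)"
        unfolding F_def w_def v_def by (simp split: split_indicator)
    qed
    also have "\<dots> = ennreal (inverse (c ^ DIM(real^'n))) * (\<integral>\<^sup>+x. F x \<partial>lborel)"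
      using c by (subst nn_integral_lborel_scale[of F c], measurable) (rule ennreal_inverse_cancel[symmetric, OF zero_less_power])
    also have "(\<integral>\<^sup>+x. F x \<partial>lborel) = (\<integral>\<^sup>+x\<in>ball 0 s. ennreal ((u (x, 0) - \<phi> k (x, 0))\<^sup>2) \<partial>lborel)"
      by (intro nn_integral_cong) (simp add: F_def v_def split: split_indicator)
    finally show "(\<integral>\<^sup>+x\<in>ball 0 t. ennreal ((w (x, 0) - \<phi> k (c *\<^sub>R (x, 0)))\<^sup>2) \<partial>lborel) \<le>
      ennreal (inverse (c ^ DIM(real^'n))) * (\<integral>\<^sup>+x\<in>ball 0 s. ennreal ((u (x, 0) - \<phi> k (x, 0))\<^sup>2) \<partial>lborel)" by simp
  qed
  define \<epsilon> where "\<epsilon> k = inverse (real (Suc k))" for k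
  have \<epsilon>: "\<epsilon> k > 0" "\<epsilon> \<longlonglongrightarrow> 0" for k
    using LIMSEQ_inverse_real_of_nat by (simp_all add: \<epsilon>_def[abs_def])
  define \<eta> where "\<eta> k = (cutoff t (\<epsilon> k) :: (real^'n) \<times> real \<Rightarrow> real)" for k
  have etam: "\<eta> k \<in> borel_measurable lborel" for k
    unfolding \<eta>_def using borel_measurable_smooth(1)[OF smooth_cutoff] by simp
  have id: "(LINT z:half_ball t|lborel. snd z powr a * (V z \<bullet> (w z *\<^sub>R grad (\<eta> k) z + \<eta> k z *\<^sub>R W z)))
    = (LINT x:ball 0 t|lborel. boundary_flux p lm lp (u (x, 0)) * (w (x, 0) * \<eta> k (x, 0)))" for k
    unfolding \<eta>_def using t R
    by (intro weak_solution_cutoff[OF a weak _ cont smW limW _ _ \<epsilon>(1) tr cw])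
       (auto simp: H1a_grad_def intro!: exI[of _ \<phi>] smooth lim)
  have etat: "(\<lambda>k. \<eta> k z) \<longlonglongrightarrow> 1" if z: "norm z < t" for z
  proof -
    have "t\<^sup>2 - z \<bullet> z > 0" using z t by (simp add: power2_norm_eq_inner[symmetric] power_strict_mono)
    then have "\<forall>\<^sub>F k in sequentially. \<epsilon> k < t\<^sup>2 - z \<bullet> z" using \<epsilon>(2) by (rule order_tendstoD(2)[rotated])
    then have "\<forall>\<^sub>F k in sequentially. \<eta> k z = 1"
      by eventually_elim (use \<epsilon>(1) in \<open>auto simp: \<eta>_def cutoff_def intro!: smooth_step_1\<close>)
    then show ?thesis by (rule tendsto_eventually)
  qed
  define A where "A z = snd z powr a * (V z \<bullet> W z)" for z
  have bm: "set_borel_measurable borel (half_ball t) u" "set_borel_measurable borel (half_ball t) V"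
    "set_borel_measurable borel (half_ball t) w" "set_borel_measurable borel (half_ball t) W"
    using limV limW by (simp_all add: H1a_lim_def set_borel_measurable_def)
  have iA: "integrable lborel (\<lambda>z. indicator (half_ball t) z * A z)"
    using H1a_sqnorm_finite_integrable[OF H1a_lim_finite[OF a(1) smooth limV] H1a_lim_finite[OF a(1) smW limW] bm(2,4,1,3)]
    unfolding A_def set_integrable_def by simp
  \<comment> \<open>Minus the part of the integrand that contains the gradient of the cutoff,
    without the weight; V enters it only through q.\<close>
  define k where "k j z = u0 (c *\<^sub>R z) * q z * (2 / \<epsilon> j * deriv smooth_step ((t\<^sup>2 - z \<bullet> z) / \<epsilon> j))" for j z
  have dm: "deriv smooth_step \<in> borel_measurable borel"
    by (rule borel_measurable_continuous_onI[OF continuous_on_deriv_smooth_step])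
  have km [measurable]: "k j \<in> borel_measurable borel" for j
    unfolding k_def[abs_def] by (intro borel_measurable_times measurable_compose[OF _ dm] measurable_compose[OF _ u0_measurable]) measurable
  have hb: "z \<in> half_ball R" "z \<in> upper_ball R" "norm z < t" "snd z > 0" "c *\<^sub>R z \<in> upper_ball R" "norm (c *\<^sub>R z) \<le> s" if "z \<in> half_ball t" for z :: "(real^'n) \<times> real"
  proof -
    have "c * norm z < s" using that c unfolding ct[symmetric] by (simp add: half_ball_def)
    then show "z \<in> half_ball R" "z \<in> upper_ball R" "norm z < t" "snd z > 0" "c *\<^sub>R z \<in> upper_ball R" "norm (c *\<^sub>R z) \<le> s"
      using that c s t by (auto simp: half_ball_def upper_ball_def)
  qed
  have iB: "integrable lborel (\<lambda>z. indicator (half_ball t) z * (snd z powr a * k j z))" for j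
  proof -
    obtain C1 where C1: "C1 \<ge> 0" "\<And>z. norm z \<le> s \<Longrightarrow> 0 \<le> snd z \<Longrightarrow> \<bar>u0 z\<bar> \<le> C1"
      using continuous_on_upper_ball_bounded[OF continuous_on_u0 s(2)] by blast
    obtain C2 where C2: "C2 \<ge> 0" "\<And>z. norm z \<le> t \<Longrightarrow> 0 \<le> snd z \<Longrightarrow> \<bar>q z\<bar> \<le> C2"
      using continuous_on_upper_ball_bounded[OF cq t(2)] by blast
    have "continuous_on UNIV (\<lambda>z::(real^'n) \<times> real. 2 / \<epsilon> j * deriv smooth_step ((t\<^sup>2 - z \<bullet> z) / \<epsilon> j))"
      using \<epsilon>(1)[of j] by (intro continuous_intros continuous_on_compose2[OF continuous_on_deriv_smooth_step[of UNIV]]) auto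
    from continuous_on_upper_ball_bounded[OF continuous_on_subset[OF this subset_UNIV], of t R]
    obtain C3 where C3: "C3 \<ge> 0" "\<And>z::(real^'n) \<times> real. norm z \<le> t \<Longrightarrow> 0 \<le> snd z \<Longrightarrow> \<bar>2 / \<epsilon> j * deriv smooth_step ((t\<^sup>2 - z \<bullet> z) / \<epsilon> j)\<bar> \<le> C3"
      using t(2) by blast
    show ?thesis
    proof (rule integrable_weight_bounded[OF a(1) km])
      fix z :: "(real^'n) \<times> real" assume z: "z \<in> half_ball t"
      have "0 \<le> snd (c *\<^sub>R z)" using hb[OF z] c by simp
      then show "\<bar>k j z\<bar> \<le> C1 * C2 * C3"
        unfolding k_def abs_mult[of "_ * _" "_ * deriv _ _"] abs_mult[of "u0 _"]
        using C1(2)[of "c *\<^sub>R z"] C2(2)[of z] C3(2)[of z] C1(1) C2(1) C3(1) hb[OF z] by (intro mult_mono) auto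
    qed
  qed
  have split: "(LINT z:half_ball t|lborel. snd z powr a * (V z \<bullet> (w z *\<^sub>R grad (\<eta> j) z + \<eta> j z *\<^sub>R W z)))
    = (LINT z|lborel. indicator (half_ball t) z * A z * \<eta> j z) - (LINT z|lborel. indicator (half_ball t) z * (snd z powr a * k j z))" for j
  proof -
    have iA': "integrable lborel (\<lambda>z. indicator (half_ball t) z * A z * \<eta> j z)"
    proof (rule Bochner_Integration.integrable_bound[OF iA])
      show "(\<lambda>z. indicator (half_ball t) z * A z * \<eta> j z) \<in> borel_measurable lborel"
        by (rule borel_measurable_times[OF borel_measurable_integrable[OF iA] etam])
      have "\<bar>\<eta> j z\<bar> \<le> 1" for z using cutoff_bounds[of t "\<epsilon> j" z] by (simp add: \<eta>_def)
      then show "AE z in lborel. norm (indicator (half_ball t) z * A z * \<eta> j z) \<le> norm (indicator (half_ball t) z * A z)"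
        by (intro AE_I2) (simp add: abs_mult mult_left_le)
    qed
    have "indicator (half_ball t) z *\<^sub>R (snd z powr a * (V z \<bullet> (w z *\<^sub>R grad (\<eta> j) z + \<eta> j z *\<^sub>R W z)))
      = indicator (half_ball t) z * A z * \<eta> j z - indicator (half_ball t) z * (snd z powr a * k j z)" for z
    proof (cases "z \<in> half_ball t")
      case True
      have "V z \<bullet> grad (\<eta> j) z = - (2 / \<epsilon> j) * deriv smooth_step ((t\<^sup>2 - z \<bullet> z) / \<epsilon> j) * q z"
        using q[OF hb(1)[OF True]] unfolding \<eta>_def grad_cutoff[OF \<epsilon>(1)] by simp
      moreover have "u0 (c *\<^sub>R z) = w z" using hb(5)[OF True] by (simp add: u0_def w_def)
      ultimately show ?thesis using True
        by (simp add: A_def k_def inner_add_right algebra_simps)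
    qed simp
    then show ?thesis unfolding set_lebesgue_integral_def using iA' iB by simp
  qed
  have limA: "(\<lambda>j. LINT z|lborel. indicator (half_ball t) z * A z * \<eta> j z) \<longlonglongrightarrow> (LINT z|lborel. indicator (half_ball t) z * A z)"
  proof (rule integral_dominated_convergence[where w="\<lambda>z. norm (indicator (half_ball t) z * A z)"])
    show "(\<lambda>z. indicator (half_ball t) z * A z) \<in> borel_measurable lborel" by (rule borel_measurable_integrable[OF iA])
    show "(\<lambda>z. indicator (half_ball t) z * A z * \<eta> j z) \<in> borel_measurable lborel" for j
      by (rule borel_measurable_times[OF borel_measurable_integrable[OF iA] etam])
    show "integrable lborel (\<lambda>z. norm (indicator (half_ball t) z * A z))" using iA by (rule integrable_norm)
    have "(\<lambda>j. indicator (half_ball t) z * A z * \<eta> j z) \<longlonglongrightarrow> indicator (half_ball t) z * A z" for z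
      using tendsto_mult[OF tendsto_const etat[of z], of "indicator (half_ball t) z * A z"] hb(3)[of z]
      by (cases "z \<in> half_ball t") auto
    then show "AE z in lborel. (\<lambda>j. indicator (half_ball t) z * A z * \<eta> j z) \<longlonglongrightarrow> indicator (half_ball t) z * A z" by simp
    have "\<bar>\<eta> j z\<bar> \<le> 1" for j z using cutoff_bounds[of t "\<epsilon> j" z] by (simp add: \<eta>_def)
    then show "AE z in lborel. norm (indicator (half_ball t) z * A z * \<eta> j z) \<le> norm (indicator (half_ball t) z * A z)" for j
      by (intro AE_I2) (simp add: abs_mult mult_left_le)
  qed
  define \<kappa> where "\<kappa> r = (LINT z|hemisphere a. u0 ((c * r) *\<^sub>R z) * q (r *\<^sub>R z))" for r
  \<comment> \<open>In polar coordinates the volume factor is r^(N+a). One power of r is moved into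
    the kernel, where 2 r / \<epsilon> is the factor that gives it unit mass; hence the exponent N +
    a - 1.\<close>
  define m where "m r = r powr (real CARD('n) + a - 1) * \<kappa> r" for r
  have polar: "(LINT z|lborel. indicator (half_ball t) z * (snd z powr a * k j z))
    = (LINT r|lborel. indicator {0<..<t} r * (m r * (2 * r / \<epsilon> j * deriv smooth_step ((t\<^sup>2 - r\<^sup>2) / \<epsilon> j))))" for j
  proof -
    define f where "f z = indicator (half_ball t) z * k j z" for z
    have [measurable]: "f \<in> borel_measurable borel" unfolding f_def[abs_def] by measurable
    have eq: "indicator (half_ball t) z * (snd z powr a * k j z) = indicator {z. 0 < snd z} z * (snd z powr a * f z)" for z
      by (auto simp: f_def half_ball_def split: split_indicator)
    have "(LINT z|lborel. indicator (half_ball t) z * (snd z powr a * k j z)) =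
      (LINT r|lborel. indicator {0<..} r * (r powr (real CARD('n) + a) * (LINT z|hemisphere a. f (r *\<^sub>R z))))"
      unfolding eq by (rule integral_weighted_polar[OF a(1)]) (measurable, use iB[of j] in \<open>simp add: eq\<close>)
    also have "\<dots> = (LINT r|lborel. indicator {0<..<t} r * (m r * (2 * r / \<epsilon> j * deriv smooth_step ((t\<^sup>2 - r\<^sup>2) / \<epsilon> j))))"
    proof (rule Bochner_Integration.integral_cong[OF refl])
      fix r :: real
      show "indicator {0<..} r * (r powr (real CARD('n) + a) * (LINT z|hemisphere a. f (r *\<^sub>R z))) =
        indicator {0<..<t} r * (m r * (2 * r / \<epsilon> j * deriv smooth_step ((t\<^sup>2 - r\<^sup>2) / \<epsilon> j)))"
      proof (cases "r > 0")
        case True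
        have "(LINT z|hemisphere a. f (r *\<^sub>R z)) = (LINT z|hemisphere a. indicator {0<..<t} r * (2 / \<epsilon> j * deriv smooth_step ((t\<^sup>2 - r\<^sup>2) / \<epsilon> j)) * (u0 ((c * r) *\<^sub>R z) * q (r *\<^sub>R z)))"
        proof (rule integral_cong_AE)
          show "AE z in hemisphere a. f (r *\<^sub>R z) = indicator {0<..<t} r * (2 / \<epsilon> j * deriv smooth_step ((t\<^sup>2 - r\<^sup>2) / \<epsilon> j)) * (u0 ((c * r) *\<^sub>R z) * q (r *\<^sub>R z))"
            using AE_hemisphere
          proof eventually_elim
            case (elim z)
            have "(r *\<^sub>R z) \<bullet> (r *\<^sub>R z) = r\<^sup>2" using elim by (simp add: power2_norm_eq_inner[symmetric] power2_eq_square[of r] dot_square_norm)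
            moreover have "r *\<^sub>R z \<in> half_ball t \<longleftrightarrow> r \<in> {0<..<t}" using elim True by (simp add: half_ball_def)
            ultimately show ?case unfolding f_def k_def by (simp split: split_indicator)
          qed
        qed measurable
        also have "\<dots> = indicator {0<..<t} r * (2 / \<epsilon> j * deriv smooth_step ((t\<^sup>2 - r\<^sup>2) / \<epsilon> j)) * \<kappa> r"
          unfolding \<kappa>_def by (rule integral_mult_right_zero)
        finally have "(LINT z|hemisphere a. f (r *\<^sub>R z)) = indicator {0<..<t} r * (2 / \<epsilon> j * deriv smooth_step ((t\<^sup>2 - r\<^sup>2) / \<epsilon> j)) * \<kappa> r" .
        moreover have "r powr (real CARD('n) + a) = r powr (real CARD('n) + a - 1) * r"
          using True by (simp add: powr_diff)
        ultimately show ?thesis using True by (simp add: m_def)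
      qed simp
    qed
    finally show ?thesis .
  qed
  have limB: "(\<lambda>j. LINT z|lborel. indicator (half_ball t) z * (snd z powr a * k j z)) \<longlonglongrightarrow> m t"
    unfolding polar
  proof (rule cutoff_approximates_delta[OF _ _ _ \<epsilon>])
    show "0 < t / 2" "t / 2 < t" using t by simp_all
    have c1: "continuous_on ({t / 2..t} \<times> half_disc) (\<lambda>(r, z). u0 ((c * r) *\<^sub>R z))"
    proof -
      have "continuous_on ({0..s} \<times> half_disc) (\<lambda>(r, z). u0 (r *\<^sub>R z))"
        by (rule continuous_on_dilation[OF continuous_on_u0]) (use s in auto)
      then have "continuous_on ({t / 2..t} \<times> half_disc) (\<lambda>p. (\<lambda>(r, z). u0 (r *\<^sub>R z)) (c * fst p, snd p))"
        by (rule continuous_on_compose2) (use c t ct in \<open>auto intro!: continuous_intros simp: ct[symmetric]\<close>)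
      then show ?thesis by (simp add: split_beta)
    qed
    have c2: "continuous_on ({t / 2..t} \<times> half_disc) (\<lambda>(r, z). q (r *\<^sub>R z))"
      by (rule continuous_on_dilation[OF cq]) (use t in auto)
    have "continuous_on ({t / 2..t} \<times> half_disc) (\<lambda>(r, z). u0 ((c * r) *\<^sub>R z) * q (r *\<^sub>R z))"
      using continuous_on_mult[OF c1 c2] by (simp add: split_beta)
    then have "continuous_on {t / 2..t} \<kappa>"
      unfolding \<kappa>_def by (intro continuous_on_integral_param(1)[OF finite_hemisphere AE_hemisphere_half_disc]) measurable
    then show "continuous_on {t / 2..t} m"
      unfolding m_def using t by (intro continuous_intros continuous_on_powr') auto
  qed
  have limF: "(\<lambda>j. LINT x:ball 0 t|lborel. boundary_flux p lm lp (u (x, 0)) * (w (x, 0) * \<eta> j (x, 0))) \<longlonglongrightarrow>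
    (LINT x:ball 0 t|lborel. flux (u (x, 0)) * u (c *\<^sub>R x, 0))"
  proof -
    define h where "h x = flux (u0 (x, 0)) * u0 (c *\<^sub>R (x, 0))" for x :: "real^'n"
    note [measurable] = borel_measurable_pair0
    have hm [measurable]: "h \<in> borel_measurable borel" unfolding h_def[abs_def] by measurable
    have hx: "(x, 0) \<in> upper_ball R" "c *\<^sub>R (x, 0) \<in> upper_ball R" "norm (x, 0::real) \<le> t" "norm (c *\<^sub>R (x, 0::real)) \<le> s"
      if "x \<in> ball 0 t" for x :: "real^'n"
    proof -
      have n: "norm x < t" using that by simp
      then have "c * norm x < s" using c unfolding ct[symmetric] by simp
      with n show "(x, 0) \<in> upper_ball R" "c *\<^sub>R (x, 0) \<in> upper_ball R" "norm (x, 0::real) \<le> t" "norm (c *\<^sub>R (x, 0::real)) \<le> s"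
        using c s t by (auto simp: upper_ball_def)
    qed
    have "continuous_on (upper_ball R) (\<lambda>z. flux (u0 z))"
      by (rule continuous_on_compose2[OF continuous_on_flux continuous_on_u0]) simp
    then obtain C1 where C1: "C1 \<ge> 0" "\<And>z. norm z \<le> t \<Longrightarrow> 0 \<le> snd z \<Longrightarrow> \<bar>flux (u0 z)\<bar> \<le> C1"
      using continuous_on_upper_ball_bounded[OF _ t(2)] by blast
    obtain C2 where C2: "C2 \<ge> 0" "\<And>z. norm z \<le> s \<Longrightarrow> 0 \<le> snd z \<Longrightarrow> \<bar>u0 z\<bar> \<le> C2"
      using continuous_on_upper_ball_bounded[OF continuous_on_u0 s(2)] by blast
    have bd: "\<bar>h x\<bar> \<le> C1 * C2" if "x \<in> ball 0 t" for x
      unfolding h_def abs_mult using C1 C2 hx[OF that] by (intro mult_mono) auto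
    have em: "(\<lambda>x. \<eta> j (x, 0)) \<in> borel_measurable borel" for j
      unfolding \<eta>_def by (rule measurable_compose[OF borel_measurable_pair0 borel_measurable_smooth(1)[OF smooth_cutoff]])
    have ind: "(\<lambda>x. indicator (ball 0 t) x * h x) \<in> borel_measurable borel"
      by (intro borel_measurable_times borel_measurable_indicator hm) simp
    have "(\<lambda>j. LINT x|lborel. indicator (ball 0 t) x * h x * \<eta> j (x, 0)) \<longlonglongrightarrow> (LINT x|lborel. indicator (ball 0 t) x * h x)"
    proof (rule integral_dominated_convergence[where w="\<lambda>x. indicator (ball 0 t) x * (C1 * C2)"])
      show "integrable lborel (\<lambda>x. indicator (ball (0::real^'n) t) x * (C1 * C2))"
        using emeasure_lborel_ball_finite[of "0::real^'n" t] by (intro integrable_mult_left integrable_real_indicator) auto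
      have "(\<lambda>j. indicator (ball 0 t) x * h x * \<eta> j (x, 0)) \<longlonglongrightarrow> indicator (ball 0 t) x * h x" for x
        using tendsto_mult[OF tendsto_const etat[of "(x, 0)"], of "indicator (ball 0 t) x * h x"]
        by (cases "x \<in> ball 0 t") (auto simp: norm_Pair)
      then show "AE x in lborel. (\<lambda>j. indicator (ball 0 t) x * h x * \<eta> j (x, 0)) \<longlonglongrightarrow> indicator (ball 0 t) x * h x" by simp
      fix j
      show "AE x in lborel. norm (indicator (ball 0 t) x * h x * \<eta> j (x, 0)) \<le> indicator (ball 0 t) x * (C1 * C2)"
      proof (rule AE_I2)
        fix x :: "real^'n"
        have "\<bar>\<eta> j (x, 0)\<bar> \<le> 1" using cutoff_bounds[of t "\<epsilon> j" "(x, 0::real)"] by (simp add: \<eta>_def)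
        then have "x \<in> ball 0 t \<Longrightarrow> \<bar>h x\<bar> * \<bar>\<eta> j (x, 0)\<bar> \<le> C1 * C2 * 1" using bd[of x] by (intro mult_mono) auto
        then show "norm (indicator (ball 0 t) x * h x * \<eta> j (x, 0)) \<le> indicator (ball 0 t) x * (C1 * C2)"
          by (auto simp: abs_mult split: split_indicator)
      qed
      show "(\<lambda>x. indicator (ball 0 t) x * h x * \<eta> j (x, 0)) \<in> borel_measurable lborel"
        using borel_measurable_times[OF ind em] by simp
    qed (use ind in simp)
    moreover have "indicator (ball 0 t) x * h x * \<eta> j (x, 0) = indicator (ball 0 t) x *\<^sub>R (boundary_flux p lm lp (u (x, 0)) * (w (x, 0) * \<eta> j (x, 0)))" for x j
      using hx[of x] unfolding h_def flux_def w_def u0_def by (cases "x \<in> ball 0 t") (simp_all del: scaleR_Pair)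
    moreover have "indicator (ball 0 t) x * h x = indicator (ball 0 t) x *\<^sub>R (flux (u (x, 0)) * u (c *\<^sub>R x, 0))" for x
      using hx[of x] unfolding h_def u0_def by (cases "x \<in> ball 0 t") simp_all
    ultimately show ?thesis unfolding set_lebesgue_integral_def by (simp only:)
  qed
  have "(\<lambda>j. (LINT z|lborel. indicator (half_ball t) z * A z * \<eta> j z) - (LINT z|lborel. indicator (half_ball t) z * (snd z powr a * k j z))) \<longlonglongrightarrow>
    (LINT z|lborel. indicator (half_ball t) z * A z) - m t"
    by (rule tendsto_diff[OF limA limB])
  then have "(LINT z|lborel. indicator (half_ball t) z * A z) - m t = (LINT x:ball 0 t|lborel. flux (u (x, 0)) * u (c *\<^sub>R x, 0))"
    unfolding split[symmetric] id using limF by (rule LIMSEQ_unique)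
  moreover have "m t = t powr (real CARD('n) + a - 1) * (LINT z|hemisphere a. u0 (s *\<^sub>R z) * q (t *\<^sub>R z))"
    by (simp only: m_def \<kappa>_def ct)
  moreover have "(LINT z:half_ball t|lborel. snd z powr a * (V z \<bullet> (c *\<^sub>R V (c *\<^sub>R z)))) = (LINT z|lborel. indicator (half_ball t) z * A z)"
    by (simp add: set_lebesgue_integral_def A_def W_def)
  ultimately show ?thesis by simp
qed

end

subsection \<open>Monotonicity of a frequency quotient\<close>

lemma smooth_real_deriv:
  fixes \<eta> :: "real \<Rightarrow> real"
  assumes "smooth \<eta>"
  shows "(\<eta> has_real_derivative deriv \<eta> x) (at x)" "continuous_on UNIV (deriv \<eta>)"
proof -
  have d: "(\<eta> has_real_derivative grad \<eta> x) (at x)" for x using smoothD(2)[OF assms, of x] by simp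
  then have "grad \<eta> = deriv \<eta>" using DERIV_imp_deriv by (metis ext)
  with d smoothD(3)[OF assms] show "(\<eta> has_real_derivative deriv \<eta> x) (at x)" "continuous_on UNIV (deriv \<eta>)" by simp_all
qed

text \<open>Nothing is assumed about f at the end points of the interval. The support of the test
  function is enclosed in a compact subinterval, where f and its derivative are continuous and the
  boundary terms vanish.\<close>

lemma test_function_integration_by_parts:
  fixes f f' \<eta> :: "real \<Rightarrow> real"
  assumes f: "\<And>r. r \<in> {0<..<R} \<Longrightarrow> (f has_real_derivative f' r) (at r)"
    and f': "continuous_on {0<..<R} f'" and \<eta>: "test_function {0<..<R} \<eta>" and R: "0 < R"
  shows "(LINT r:{0<..<R}|lborel. f r * deriv \<eta> r) = - (LINT r:{0<..<R}|lborel. f' r * \<eta> r)"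
proof -
  define K where "K = closure {x. \<eta> x \<noteq> 0}"
  have K: "compact K" "K \<subseteq> {0<..<R}" and sm: "smooth \<eta>" using \<eta> by (auto simp: test_function_def K_def)
  \<comment> \<open>End points halfway between the extreme points of the support and the ends of the
    interval; for an empty support any interval will do.\<close>
  obtain \<alpha> \<beta> where ab: "0 < \<alpha>" "\<alpha> < \<beta>" "\<beta> < R" "K \<subseteq> {\<alpha><..<\<beta>}"
  proof (cases "K = {}")
    case True
    then show ?thesis using that[of "R / 3" "R / 2"] R by auto
  next
    case False
    obtain m M where m: "m \<in> K" "\<And>t. t \<in> K \<Longrightarrow> m \<le> t" and M: "M \<in> K" "\<And>t. t \<in> K \<Longrightarrow> t \<le> M"
      using compact_attains_inf[OF K(1) False] compact_attains_sup[OF K(1) False] by blast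
    have "0 < m" "m \<le> M" "M < R" using m M K(2) by auto
    moreover have "K \<subseteq> {m / 2<..<(M + R) / 2}"
    proof
      fix x assume "x \<in> K"
      then show "x \<in> {m / 2<..<(M + R) / 2}" using m(2)[of x] M(2)[of x] \<open>0 < m\<close> \<open>M < R\<close> by auto
    qed
    ultimately show ?thesis using that[of "m / 2" "(M + R) / 2"] by auto
  qed
  have eta0: "\<eta> x = 0" if "x \<notin> K" for x
    using that closure_subset[of "{x. \<eta> x \<noteq> 0}"] unfolding K_def by blast
  have deta0: "deriv \<eta> x = 0" if "x \<notin> K" for x
  proof -
    have "((\<lambda>x. 0) has_real_derivative 0) (at x)" by simp
    then have "(\<eta> has_real_derivative 0) (at x)"
      by (rule has_field_derivative_transform_within_open[where S="- K"])
         (use K(1) that eta0 in \<open>auto simp: open_Compl compact_imp_closed\<close>)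
    then show ?thesis by (rule DERIV_imp_deriv)
  qed
  have sub: "{\<alpha>..\<beta>} \<subseteq> {0<..<R}" using ab by auto
  have cf: "continuous_on {\<alpha>..\<beta>} f"
    by (rule DERIV_continuous_on[OF has_field_derivative_at_within[OF f[OF subsetD[OF sub]]]])
  have c\<eta>: "continuous_on {\<alpha>..\<beta>} \<eta>" using smoothD(1)[OF sm] continuous_on_subset by blast
  have cd: "continuous_on {\<alpha>..\<beta>} (deriv \<eta>)" using smooth_real_deriv(2)[OF sm] continuous_on_subset by blast
  have cf': "continuous_on {\<alpha>..\<beta>} f'" by (rule continuous_on_subset[OF f' sub])
  have i1: "set_integrable lborel {\<alpha>..\<beta>} (\<lambda>r. f r * deriv \<eta> r)" and i2: "set_integrable lborel {\<alpha>..\<beta>} (\<lambda>r. f' r * \<eta> r)"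
    by (intro borel_integrable_atLeastAtMost' continuous_on_mult cf cd cf' c\<eta>)+
  have "has_bochner_integral lborel (\<lambda>r. indicator {\<alpha>..\<beta>} r *\<^sub>R (f r * deriv \<eta> r + f' r * \<eta> r)) (f \<beta> * \<eta> \<beta> - f \<alpha> * \<eta> \<alpha>)"
  proof (rule has_bochner_integral_FTC_Icc)
    show "\<alpha> \<le> \<beta>" using ab by simp
    show "continuous_on {\<alpha>..\<beta>} (\<lambda>r. f r * deriv \<eta> r + f' r * \<eta> r)" by (intro continuous_intros cf cd cf' c\<eta>)
    fix x assume "\<alpha> \<le> x" "x \<le> \<beta>"
    then have "(f has_real_derivative f' x) (at x)" using f sub by auto
    from DERIV_mult[OF this smooth_real_deriv(1)[OF sm, of x]]
    have "((\<lambda>r. f r * \<eta> r) has_real_derivative f x * deriv \<eta> x + f' x * \<eta> x) (at x)" by (simp add: algebra_simps)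
    then show "((\<lambda>r. f r * \<eta> r) has_vector_derivative f x * deriv \<eta> x + f' x * \<eta> x) (at x within {\<alpha>..\<beta>})"
      by (auto simp: has_real_derivative_iff_has_vector_derivative intro: has_vector_derivative_at_within)
  qed
  moreover have "\<eta> \<alpha> = 0" "\<eta> \<beta> = 0" by (rule eta0, use ab(4) in force)+
  ultimately have "(LINT r:{\<alpha>..\<beta>}|lborel. f r * deriv \<eta> r + f' r * \<eta> r) = 0"
    by (simp add: has_bochner_integral_iff set_lebesgue_integral_def)
  then have "(LINT r:{\<alpha>..\<beta>}|lborel. f r * deriv \<eta> r) = - (LINT r:{\<alpha>..\<beta>}|lborel. f' r * \<eta> r)"
    using set_integral_add(2)[OF i1 i2] by simp
  moreover have "(LINT r:{0<..<R}|lborel. h r) = (LINT r:{\<alpha>..\<beta>}|lborel. h r)" if "\<And>r. r \<notin> K \<Longrightarrow> h r = 0" for h :: "real \<Rightarrow> real"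
    unfolding set_lebesgue_integral_def
  proof (rule Bochner_Integration.integral_cong[OF refl])
    fix r
    show "indicator {0<..<R} r *\<^sub>R h r = indicator {\<alpha>..\<beta>} r *\<^sub>R h r"
      using that[of r] ab(4) K(2) by (cases "r \<in> K") (auto simp: indicator_def)
  qed
  ultimately show ?thesis using eta0 deta0 by simp
qed

text \<open>All four claims follow from a continuous nonnegative derivative. It serves as the weak
  derivative, and the limit at 0 is the infimum, which is nonnegative since f is.\<close>

lemma C1_nonneg_derivative_conclusion:
  fixes f f' :: "real \<Rightarrow> real"
  assumes R: "0 < R" and f: "\<And>r. r \<in> {0<..<R} \<Longrightarrow> (f has_real_derivative f' r) (at r)"
    and f': "continuous_on {0<..<R} f'" and nn: "\<And>r. r \<in> {0<..<R} \<Longrightarrow> 0 \<le> f' r" and f0: "\<And>r. r \<in> {0<..<R} \<Longrightarrow> 0 \<le> f r"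
  shows "W11_loc {0<..<R} f \<and> mono_on {0<..<R} f \<and> distr_deriv_nonneg {0<..<R} f \<and> (\<exists>k\<ge>0. (f \<longlongrightarrow> k) (at_right 0))"
proof -
  have cf: "continuous_on {0<..<R} f"
    by (rule DERIV_continuous_on[OF has_field_derivative_at_within[OF f]])
  have L1: "L1_loc {0<..<R} h" if "continuous_on {0<..<R} h" for h
    unfolding L1_loc_def set_integrable_def
    using borel_integrable_compact continuous_on_subset[OF that] by blast
  note parts = test_function_integration_by_parts[OF f f' _ R]
  have "W11_loc {0<..<R} f"
    unfolding W11_loc_def using L1[OF cf] L1[OF f'] parts by blast
  moreover have mono: "mono_on {0<..<R} f"
  proof (rule mono_onI)
    fix x y assume xy: "x \<in> {0<..<R}" "y \<in> {0<..<R}" "x \<le> y"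
    show "f x \<le> f y"
    proof (rule DERIV_nonneg_imp_nondecreasing[OF xy(3)])
      fix z assume "x \<le> z" "z \<le> y"
      then have "z \<in> {0<..<R}" using xy by auto
      then show "\<exists>d. (f has_real_derivative d) (at z) \<and> 0 \<le> d" using f nn by blast
    qed
  qed
  moreover have "distr_deriv_nonneg {0<..<R} f"
    unfolding distr_deriv_nonneg_def
  proof (intro allI impI)
    fix \<eta> :: "real \<Rightarrow> real" assume \<eta>: "test_function {0<..<R} \<eta> \<and> (\<forall>r. 0 \<le> \<eta> r)"
    have "- (LINT r:{0<..<R}|lborel. f r * deriv \<eta> r) = (LINT r:{0<..<R}|lborel. f' r * \<eta> r)" using parts \<eta> by simp
    also have "\<dots> \<ge> 0" unfolding set_lebesgue_integral_def
      using nn \<eta> by (intro Bochner_Integration.integral_nonneg) (auto split: split_indicator)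
    finally show "0 \<le> - (LINT r:{0<..<R}|lborel. f r * deriv \<eta> r)" .
  qed
  moreover have "\<exists>k\<ge>0. (f \<longlongrightarrow> k) (at_right 0)"
  proof -
    define k where "k = Inf (f ` {0<..<R})"
    have ne: "f ` {0<..<R} \<noteq> {}" using R by (auto intro!: exI[of _ "R / 2"])
    have bdd: "bdd_below (f ` {0<..<R})" using f0 by (intro bdd_belowI[of _ 0]) auto
    have "k \<ge> 0" unfolding k_def using f0 by (intro cInf_greatest ne) auto
    moreover have "(f \<longlongrightarrow> k) (at_right 0)"
    proof (rule order_tendstoI)
      fix y assume "y < k"
      have "\<forall>\<^sub>F r in at_right 0. r \<in> {0<..<R}" using eventually_at_right_real[OF R] .
      then show "\<forall>\<^sub>F r in at_right 0. y < f r"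
      proof eventually_elim
        case (elim r)
        then have "k \<le> f r" unfolding k_def by (intro cInf_lower bdd) auto
        with \<open>y < k\<close> show ?case by simp
      qed
    next
      fix y assume "k < y"
      then obtain r0 where r0: "r0 \<in> {0<..<R}" "f r0 < y" using cInf_lessD[OF ne] unfolding k_def by blast
      have "\<forall>\<^sub>F r in at_right 0. r \<in> {0<..<r0}" using r0 by (intro eventually_at_right_real) auto
      then show "\<forall>\<^sub>F r in at_right 0. f r < y"
      proof eventually_elim
        case (elim r)
        then have "f r \<le> f r0" using mono_onD[OF mono, of r r0] r0 by auto
        with r0 show ?case by simp
      qed
    qed
    ultimately show ?thesis by blast
  qed
  ultimately show ?thesis by blast
qed

text \<open>If \<open>H\<close> vanished at some radius but not at a later one, then at the last zero the
  boundedness of the monotone quotient \<open>D/H\<close> would bound the logarithmic derivative of \<open>H\<close>,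
  so \<open>H\<close> could not leave 0.\<close>

lemma frequency_calculus:
  fixes H D P I Q :: "real \<Rightarrow> real"
  assumes R: "0 < R" and p: "2 \<le> p" and a: "a < 1"
    and H: "\<And>r. r \<in> {0<..<R} \<Longrightarrow> (H has_real_derivative 2 / r * I r) (at r)"
    and D: "\<And>r. r \<in> {0<..<R} \<Longrightarrow> ((\<lambda>r. D r + 2 * P r) has_real_derivative 2 / r * (Q r + (1 - a) * P r)) (at r)"
    and I: "\<And>r. r \<in> {0<..<R} \<Longrightarrow> I r = D r + p * P r"
    and nn: "\<And>r. r \<in> {0<..<R} \<Longrightarrow> 0 \<le> D r" "\<And>r. r \<in> {0<..<R} \<Longrightarrow> 0 \<le> P r" "\<And>r. r \<in> {0<..<R} \<Longrightarrow> 0 \<le> H r"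
    and CS: "\<And>r. r \<in> {0<..<R} \<Longrightarrow> (I r)\<^sup>2 \<le> H r * Q r"
    and cont: "continuous_on {0<..<R} P" "continuous_on {0<..<R} I" "continuous_on {0<..<R} Q"
    and N: "\<And>r. r \<in> {0<..<R} \<Longrightarrow> N r = (D r + 2 * P r) / H r"
  shows "W11_loc {0<..<R} N \<and> mono_on {0<..<R} N \<and> distr_deriv_nonneg {0<..<R} N \<and> (\<exists>k\<ge>0. (N \<longlongrightarrow> k) (at_right 0))"
proof -
  let ?E = "\<lambda>r. D r + 2 * P r"
  define N' where "N' r = (2 / r * (Q r + (1 - a) * P r) * H r - ?E r * (2 / r * I r)) / (H r * H r)" for r
  \<comment> \<open>With E = D + 2 P and I = D + p P, both parts nonnegative and p at least 2: the
    first bound drives the monotonicity, the last one controls the growth of H near a zero.\<close>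
  have EI: "?E r \<le> I r" "0 \<le> ?E r" "I r \<le> p / 2 * ?E r" if r: "r \<in> {0<..<R}" for r
  proof -
    have "2 * P r \<le> p * P r" using p nn(2)[OF r] by (intro mult_right_mono) auto
    then show "?E r \<le> I r" using I[OF r] by simp
    show "0 \<le> ?E r" using nn[OF r] by simp
    have "D r * 2 \<le> D r * p" using p nn(1)[OF r] by (intro mult_left_mono) auto
    then show "I r \<le> p / 2 * ?E r" using I[OF r] by (simp add: field_simps)
  qed
  \<comment> \<open>The numerator of the quotient's derivative is nonnegative because E I <= I^2 <=
    H Q; the term (1 - a) P H only helps.\<close>
  have N'_nonneg: "0 \<le> N' r" if r: "r \<in> {0<..<R}" for r
  proof -
    have "?E r * I r \<le> I r * I r" using EI[OF r] by (intro mult_right_mono) auto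
    also have "\<dots> \<le> H r * Q r" using CS[OF r] by (simp add: power2_eq_square)
    finally have 1: "?E r * I r \<le> Q r * H r" by (simp add: mult.commute)
    have "0 \<le> (1 - a) * P r * H r" using nn[OF r] a by simp
    with 1 have "0 \<le> (Q r + (1 - a) * P r) * H r - ?E r * I r" by (simp add: distrib_right)
    then have "0 \<le> 2 / r * ((Q r + (1 - a) * P r) * H r - ?E r * I r)" using r by simp
    also have "\<dots> = 2 / r * (Q r + (1 - a) * P r) * H r - ?E r * (2 / r * I r)"
    proof -
      have "c * (X * h - e * i) = c * X * h - e * (c * i)" for c X h e i :: real by (simp add: algebra_simps)
      then show ?thesis .
    qed
    finally show ?thesis unfolding N'_def by simp
  qed
  have dN: "((\<lambda>r. ?E r / H r) has_real_derivative N' r) (at r)" if r: "r \<in> {0<..<R}" "H r \<noteq> 0" for r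
    unfolding N'_def by (rule DERIV_divide[OF D[OF r(1)] H[OF r(1)] r(2)])
  have cH: "continuous_on {0<..<R} H"
    by (rule DERIV_continuous_on[OF has_field_derivative_at_within[OF H]])
  have cE: "continuous_on {0<..<R} ?E"
    by (rule DERIV_continuous_on[OF has_field_derivative_at_within[OF D]])
  have cD: "continuous_on {0<..<R} D"
    using continuous_on_diff[OF cE continuous_on_mult[OF continuous_on_const[of _ 2] cont(1)]] by simp
  have Hmono: "H x \<le> H y" if xy: "0 < x" "x \<le> y" "y < R" for x y
  proof (rule DERIV_nonneg_imp_nondecreasing[OF xy(2)])
    fix z assume "x \<le> z" "z \<le> y"
    then have z: "z \<in> {0<..<R}" using xy by auto
    then have "0 \<le> 2 / z * I z" using EI[OF z] by simp
    then show "\<exists>d. (H has_real_derivative d) (at z) \<and> 0 \<le> d" using H[OF z] by blast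
  qed
  have dichotomy: "H r2 = 0" if r1: "r1 \<in> {0<..<R}" "H r1 = 0" and r2: "r2 \<in> {0<..<R}" for r1 r2
  proof (rule ccontr)
    assume H2: "H r2 \<noteq> 0"
    then have "H r2 > 0" using nn(3)[OF r2] by simp
    have "r1 < r2" using Hmono[of r2 r1] r1 r2 \<open>H r2 > 0\<close> by (cases "r1 < r2") auto
    \<comment> \<open>The zeros of H between the two radii form a compact set; its largest element
      r0 is the last zero, after which the quotient is a genuine division and nondecreasing.\<close>
    define Z where "Z = {r \<in> {r1..r2}. H r = 0}"
    have "continuous_on {r1..r2} H" by (rule continuous_on_subset[OF cH]) (use r1 r2 in auto)
    then have "closed Z" unfolding Z_def by (intro continuous_closed_preimage_constant) auto
    then have "compact Z" unfolding Z_def by (metis (no_types, lifting) bounded_closed_interval bounded_subset compact_eq_bounded_closed mem_Collect_eq subsetI)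
    moreover have "r1 \<in> Z" using r1 \<open>r1 < r2\<close> by (simp add: Z_def)
    ultimately obtain r0 where r0: "r0 \<in> Z" "\<And>r. r \<in> Z \<Longrightarrow> r \<le> r0" using compact_attains_sup[of Z] by blast
    have r0': "r0 \<in> {0<..<R}" "H r0 = 0" "r0 < r2" using r0(1) r1 r2 H2 by (auto simp: Z_def order_less_le)
    have Hpos: "H r > 0" if "r0 < r" "r \<le> r2" for r
    proof -
      have "r \<notin> Z" using r0(2)[of r] that by auto
      then have "H r \<noteq> 0" using that r0(1) by (auto simp: Z_def)
      then show ?thesis using nn(3)[of r] that r0'(1) r2 by (auto simp: order_less_le)
    qed
    define M where "M = ?E r2 / H r2"
    have NM: "?E r / H r \<le> M" if r: "r0 < r" "r \<le> r2" for r
      unfolding M_def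
    proof (rule DERIV_nonneg_imp_nondecreasing[OF r(2)])
      fix z assume z: "r \<le> z" "z \<le> r2"
      then have z': "z \<in> {0<..<R}" using r r0' r2 by auto
      have "H z \<noteq> 0" using Hpos[of z] z r by auto
      then show "\<exists>d. ((\<lambda>r. ?E r / H r) has_real_derivative d) (at z) \<and> 0 \<le> d" using dN[OF z'] N'_nonneg[OF z'] by blast
    qed
    \<comment> \<open>For r > r0 the derivative of log H is 2 I / (r H), at most p E / (r H) and so
      at most p M / r0. With this C the function H exp(-C r) cannot increase, and it is 0 at
      r0.\<close>
    define C where "C = p / r0 * M"
    have "H r2 * exp (- C * r2) \<le> H r0 * exp (- C * r0)"
    proof (rule DERIV_nonpos_imp_decreasing_open[of r0 r2 "\<lambda>r. H r * exp (- C * r)"])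
      show "r0 \<le> r2" using r0' by simp
      show "continuous_on {r0..r2} (\<lambda>r. H r * exp (- C * r))"
        by (intro continuous_intros continuous_on_subset[OF cH]) (use r0' r2 in auto)
      fix z assume z: "r0 < z" "z < r2"
      then have z': "z \<in> {0<..<R}" using r0' r2 by auto
      have Hz: "H z > 0" using Hpos[of z] z by simp
      have M0: "0 \<le> M" using NM[of z] z EI(2)[OF z'] Hz by (smt (verit) divide_nonneg_pos)
      have "I z \<le> p / 2 * ?E z" by (rule EI(3)[OF z'])
      also have "?E z \<le> M * H z" using NM[of z] z Hz by (simp add: divide_le_eq)
      finally have "I z \<le> p / 2 * (M * H z)" using p by (simp add: mult_left_mono)
      then have "2 / z * I z \<le> 2 / z * (p / 2 * (M * H z))" using z' by (intro mult_left_mono) auto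
      also have "\<dots> = p / z * (M * H z)" by simp
      also have "\<dots> \<le> p / r0 * (M * H z)" using z r0' p M0 Hz
        by (intro mult_right_mono divide_left_mono) auto
      finally have "2 / z * I z - C * H z \<le> 0" by (simp add: C_def)
      then have "(2 / z * I z - C * H z) * exp (- C * z) \<le> 0" by (simp add: mult_le_0_iff)
      moreover have "((\<lambda>r. H r * exp (- C * r)) has_real_derivative (2 / z * I z - C * H z) * exp (- C * z)) (at z)"
        by (rule derivative_eq_intros H[OF z'] refl)+ (simp add: algebra_simps)
      ultimately show "\<exists>y. ((\<lambda>r. H r * exp (- C * r)) has_real_derivative y) (at z) \<and> y \<le> 0" by blast
    qed
    then have "H r2 * exp (- C * r2) \<le> 0" using r0' by simp
    then show False using \<open>H r2 > 0\<close> by (simp add: mult_le_0_iff not_less[symmetric])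
  qed
  show ?thesis
  proof (cases "\<exists>r\<in>{0<..<R}. H r = 0")
    case True
    then obtain r1 where r1: "r1 \<in> {0<..<R}" "H r1 = 0" by blast
    have N0: "N r = 0" if "r \<in> {0<..<R}" for r
      using dichotomy[OF r1 that] N[OF that] by simp
    have dN0: "(N has_real_derivative 0) (at r)" if r: "r \<in> {0<..<R}" for r
      by (rule has_field_derivative_transform_within_open[OF DERIV_const[of 0], where S="{0<..<R}"])
         (simp_all only: open_greaterThanLessThan r N0)
    show ?thesis
      by (rule C1_nonneg_derivative_conclusion[OF R dN0]) (simp_all only: N0 continuous_on_const order_refl)
  next
    case False
    show ?thesis
    proof (rule C1_nonneg_derivative_conclusion[OF R, where f'=N'])
      fix r assume r: "r \<in> {0<..<R}"
      show "(N has_real_derivative N' r) (at r)"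
      proof (rule has_field_derivative_transform_within_open)
        show "((\<lambda>r. ?E r / H r) has_real_derivative N' r) (at r)" using dN[OF r] False r by blast
        show "open {0<..<R}" by simp
        show "?E x / H x = N x" if "x \<in> {0<..<R}" for x using N[OF that] by (rule sym)
      qed (rule r)
      show "0 \<le> N' r" by (rule N'_nonneg[OF r])
      show "0 \<le> N r" using N[OF r] EI(2)[OF r] nn(3)[OF r] by simp
    next
      show "continuous_on {0<..<R} N'"
        unfolding N'_def
      proof (intro continuous_on_divide continuous_on_diff continuous_on_mult continuous_on_add continuous_on_const continuous_on_id cont cH cD)
      qed (use False in auto)
    qed
  qed
qed

subsection \<open>The frequency of a weak solution\<close>

text \<open>Symmetry rewrites the increment A(x,x) - A(r,r) as [A(x,x) - A(r,x)] +
  [A(x,r) - A(r,r)], where only the first argument moves. The first bracket is handled by the mean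
  value theorem and joint continuity of the partial derivative, the second by its
  definition.\<close>

lemma symmetric_diagonal_derivative:
  fixes A A1 :: "real \<Rightarrow> real \<Rightarrow> real"
  assumes S: "S = {0<..<R}" and r: "r \<in> S"
    and sym: "\<And>s t. s \<in> S \<Longrightarrow> t \<in> S \<Longrightarrow> A s t = A t s"
    and d: "\<And>s t. s \<in> S \<Longrightarrow> t \<in> S \<Longrightarrow> ((\<lambda>s. A s t) has_real_derivative A1 s t) (at s)"
    and c: "continuous_on (S \<times> S) (\<lambda>(s, t). A1 s t)"
  shows "((\<lambda>r. A r r) has_real_derivative 2 * A1 r r) (at r)"
proof -
  have first: "((\<lambda>x. (A x x - A r x) / (x - r)) \<longlongrightarrow> A1 r r) (at r)"
  proof (rule tendstoI)
    fix e :: real assume e: "e > 0"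
    have "\<exists>d>0. \<forall>p\<in>S \<times> S. dist p (r, r) < d \<longrightarrow> dist ((\<lambda>(s, t). A1 s t) p) ((\<lambda>(s, t). A1 s t) (r, r)) < e"
      using c r e unfolding continuous_on_iff by (metis (no_types, lifting) mem_Sigma_iff)
    then obtain d0 where d0: "d0 > 0" "\<And>s t. s \<in> S \<Longrightarrow> t \<in> S \<Longrightarrow> dist (s, t) (r, r) < d0 \<Longrightarrow> dist (A1 s t) (A1 r r) < e"
      by fastforce
    have "\<forall>\<^sub>F x in at r. x \<in> S" using r unfolding S by (intro eventually_at_in_open') auto
    \<comment> \<open>Half of d0, since the distance of the pair of the intermediate point and x
      from the diagonal point is at most the sum of two such distances.\<close>
    moreover have "\<forall>\<^sub>F x in at r. dist x r < d0 / 2 \<and> x \<noteq> r"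
      using d0 by (auto simp: eventually_at intro!: exI[of _ "d0 / 2"])
    ultimately show "\<forall>\<^sub>F x in at r. dist ((A x x - A r x) / (x - r)) (A1 r r) < e"
    proof eventually_elim
      case (elim x)
      define lo hi where "lo = min x r" and "hi = max x r"
      have lh: "lo < hi" "{lo..hi} \<subseteq> S" using elim r unfolding S lo_def hi_def by auto
      obtain \<xi> where \<xi>: "lo < \<xi>" "\<xi> < hi" "A hi x - A lo x = (hi - lo) * A1 \<xi> x"
        using MVT2[OF lh(1), of "\<lambda>s. A s x" "\<lambda>s. A1 s x"] d[OF subsetD[OF lh(2)]] elim by (metis atLeastAtMost_iff)
      have "A x x - A r x = (x - r) * A1 \<xi> x"
        using \<xi>(3) elim unfolding lo_def hi_def by (cases "x < r") (auto simp: max_def min_def algebra_simps)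
      then have q: "(A x x - A r x) / (x - r) = A1 \<xi> x" using elim by simp
      have "\<bar>\<xi> - r\<bar> < d0 / 2" using \<xi>(1,2) elim unfolding lo_def hi_def dist_real_def
        by (cases "x < r") (auto simp: min_def max_def abs_if split: if_splits)
      then have "dist (\<xi>, x) (r, r) < d0"
        using elim sqrt_sum_squares_le_sum_abs[of "dist \<xi> r" "dist x r"] unfolding dist_Pair_Pair dist_real_def by auto
      moreover have "\<xi> \<in> S" using \<xi>(1,2) by (intro subsetD[OF lh(2)]) auto
      ultimately show ?case using d0(2)[of \<xi> x] elim unfolding q by blast
    qed
  qed
  have "((\<lambda>x. (A x r - A r r) / (x - r)) \<longlongrightarrow> A1 r r) (at r)"
    using d[OF r r] by (simp add: has_field_derivative_iff)
  from tendsto_add[OF first this]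
  have "((\<lambda>x. (A x x - A r x) / (x - r) + (A x r - A r r) / (x - r)) \<longlongrightarrow> 2 * A1 r r) (at r)" by simp
  then have "((\<lambda>x. (A x x - A r r) / (x - r)) \<longlongrightarrow> 2 * A1 r r) (at r)"
  proof (rule Lim_transform_eventually)
    have "\<forall>\<^sub>F x in at r. x \<in> S" using r unfolding S by (intro eventually_at_in_open') auto
    then show "\<forall>\<^sub>F x in at r. (A x x - A r x) / (x - r) + (A x r - A r r) / (x - r) = (A x x - A r r) / (x - r)"
      by eventually_elim (simp add: sym[OF r] add_divide_distrib[symmetric])
  qed
  then show ?thesis by (simp add: has_field_derivative_iff)
qed

text \<open>The quadratic polynomial in \<tau> obtained by integrating (f - \<tau> g)^2 is
  nonnegative; for G > 0 it is evaluated at its minimum \<tau> = I / G.\<close>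

lemma integral_Cauchy_Schwarz:
  fixes f g :: "'a \<Rightarrow> real"
  assumes f: "integrable M (\<lambda>x. (f x)\<^sup>2)" and g: "integrable M (\<lambda>x. (g x)\<^sup>2)" and fg: "integrable M (\<lambda>x. f x * g x)"
  shows "(LINT x|M. f x * g x)\<^sup>2 \<le> (LINT x|M. (f x)\<^sup>2) * (LINT x|M. (g x)\<^sup>2)"
proof -
  define F G I where "F = (LINT x|M. (f x)\<^sup>2)" and "G = (LINT x|M. (g x)\<^sup>2)" and "I = (LINT x|M. f x * g x)"
  have q: "0 \<le> F - 2 * \<tau> * I + \<tau>\<^sup>2 * G" for \<tau>
  proof -
    have "0 \<le> (LINT x|M. (f x - \<tau> * g x)\<^sup>2)" by (rule Bochner_Integration.integral_nonneg) simp
    also have "(\<lambda>x. (f x - \<tau> * g x)\<^sup>2) = (\<lambda>x. (f x)\<^sup>2 - 2 * \<tau> * (f x * g x) + \<tau>\<^sup>2 * (g x)\<^sup>2)"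
      by (auto simp: power2_eq_square algebra_simps)
    finally show ?thesis using f g fg by (simp add: F_def G_def I_def)
  qed
  have "I\<^sup>2 \<le> F * G"
  proof (cases "G = 0")
    case True
    have "I = 0"
    proof (rule ccontr)
      assume "I \<noteq> 0"
      \<comment> \<open>For G = 0 the polynomial is affine in \<tau>, and this value of \<tau> would
        make it -1.\<close>
      with q[of "(F + 1) / (2 * I)"] True show False by simp
    qed
    then show ?thesis using True by simp
  next
    case False
    have "G \<ge> 0" unfolding G_def by (rule Bochner_Integration.integral_nonneg) simp
    with False have G: "G > 0" by simp
    have "0 \<le> F - 2 * (I / G) * I + (I / G)\<^sup>2 * G" by (rule q)
    also have "\<dots> = (F * G - I\<^sup>2) / G" using G by (simp add: field_simps power2_eq_square)
    finally show ?thesis using G by (simp add: zero_le_divide_iff)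
  qed
  then show ?thesis by (simp add: F_def G_def I_def)
qed

lemma powr_pos_part_derivative:
  fixes p :: real
  assumes p: "1 < p"
  shows "((\<lambda>s. max s 0 powr p) has_real_derivative p * max s 0 powr (p - 1)) (at s)"
proof -
  consider "s < 0" | "s > 0" | "s = 0" by linarith
  then show ?thesis
  proof cases
    case 1
    have "((\<lambda>s. 0) has_real_derivative 0) (at s)" by simp
    then have "((\<lambda>s. max s 0 powr p) has_real_derivative 0) (at s)"
      by (rule has_field_derivative_transform_within_open[where S="{..<0}"]) (use 1 in auto)
    then show ?thesis using 1 by simp
  next
    case 2
    then have "((\<lambda>s. s powr p) has_real_derivative p * s powr (p - 1)) (at s)"
      by (rule has_real_derivative_powr)
    then have "((\<lambda>s. max s 0 powr p) has_real_derivative p * s powr (p - 1)) (at s)"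
      by (rule has_field_derivative_transform_within_open[where S="{0<..}"]) (use 2 in auto)
    then show ?thesis using 2 by simp
  next
    case 3
    \<comment> \<open>At 0 the quotient is bounded by |h|^(p-1), which tends to 0 because p >
      1.\<close>
    have "((\<lambda>h. max h 0 powr p / h) \<longlongrightarrow> 0) (at 0)"
    proof (rule Lim_null_comparison)
      show "\<forall>\<^sub>F h::real in at 0. norm (max h 0 powr p / h) \<le> \<bar>h\<bar> powr (p - 1)"
      proof (rule eventually_at_filter[THEN iffD2], rule always_eventually, intro allI impI)
        fix h :: real assume "h \<noteq> 0"
        then show "norm (max h 0 powr p / h) \<le> \<bar>h\<bar> powr (p - 1)"
          by (cases "h > 0") (auto simp: powr_diff divide_le_0_iff)
      qed
      have "((\<lambda>h. \<bar>h\<bar> powr (p - 1)) \<longlongrightarrow> 0) (at (0::real))"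
        using p by (intro tendsto_zero_powrI[where b="p - 1"] tendsto_intros tendsto_rabs_zero) auto
      then show "((\<lambda>h. \<bar>h\<bar> powr (p - 1)) \<longlongrightarrow> 0) (at (0::real))" .
    qed
    then show ?thesis using 3 by (simp add: has_field_derivative_iff)
  qed
qed

section \<open>The energy form and its boundary representation\<close>

context weak_solution_near_0
begin

text \<open>Lebesgue measure on the flat unit disc, pushed into the ambient space so that the lemmas
  on parameter integrals over \<open>half_disc\<close> apply to it as they do to the
  hemisphere.\<close>

definition flat :: "((real^'n) \<times> real) measure" where
  "flat = distr (density lborel (\<lambda>x. ennreal (indicator (ball 0 1) x))) borel (\<lambda>x::real^'n. (x, 0::real))"

lemma sets_flat [measurable_cong, simp]: "sets flat = sets borel"
  by (simp add: flat_def)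

lemma flat_indicator: "(\<lambda>x::real^'n. ennreal (indicator (ball 0 1) x)) \<in> borel_measurable lborel"
  by (intro measurable_compose[OF _ measurable_ennreal] borel_measurable_indicator) simp

lemma flat_map: "(\<lambda>x::real^'n. (x, 0::real)) \<in> density lborel (\<lambda>x. ennreal (indicator (ball 0 1) x)) \<rightarrow>\<^sub>M borel"
  using borel_measurable_pair0 by simp

lemma integral_flat:
  fixes F :: "(real^'n) \<times> real \<Rightarrow> real"
  assumes F: "F \<in> borel_measurable borel"
  shows "(LINT z|flat. F z) = (LINT x:ball 0 1|lborel. F (x, 0))"
proof -
  have "(LINT z|flat. F z) = (LINT x|density lborel (\<lambda>x. ennreal (indicator (ball 0 1) x)). F (x, 0))"
    unfolding flat_def by (rule integral_distr[OF flat_map F])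
  also have "\<dots> = (LINT x|lborel. indicator (ball 0 1) x *\<^sub>R F (x, 0))"
    by (rule integral_density) (use measurable_compose[OF borel_measurable_pair0 F] in \<open>auto intro!: borel_measurable_indicator\<close>)
  finally show ?thesis by (simp add: set_lebesgue_integral_def)
qed

lemma finite_measure_flat: "finite_measure flat"
proof
  have "emeasure flat (space flat) = (\<integral>\<^sup>+x. ennreal (indicator (ball (0::real^'n) 1) x) \<partial>lborel)"
    unfolding flat_def by (simp add: emeasure_distr[OF flat_map] emeasure_density[OF flat_indicator])
  also have "\<dots> = emeasure lborel (ball (0::real^'n) 1)"
    by (simp add: ennreal_indicator)
  finally show "emeasure flat (space flat) \<noteq> \<infinity>" using emeasure_lborel_ball_finite[of "0::real^'n" 1] by simp
qed

lemma AE_flat: "AE z in flat. z \<in> half_disc"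
proof -
  have "AE x in density lborel (\<lambda>x. ennreal (indicator (ball 0 1) x)). (x, 0::real) \<in> (half_disc :: ((real^'n) \<times> real) set)"
    by (subst AE_density[OF flat_indicator]) (rule AE_I2, auto simp: half_disc_def norm_Pair split: split_indicator_asm)
  moreover have "{z \<in> space borel. z \<in> (half_disc :: ((real^'n) \<times> real) set)} \<in> sets borel"
    using borel_closed[OF compact_imp_closed[OF compact_half_disc]] by simp
  ultimately show ?thesis unfolding flat_def by (subst AE_distr_iff[OF flat_map])
qed

text \<open>Defined by the boundary side of Green's formula, on which the derivative in s can be
  taken. The symmetry is visible only in the energy form, to which \<open>A_eq_energy\<close>
  relates it.\<close>

definition A :: "real \<Rightarrow> real \<Rightarrow> real" where
  "A s t = (LINT z|hemisphere a. u0 (s *\<^sub>R z) * q (t *\<^sub>R z)) + t powr (1 - a) * (LINT z|flat. flux (u0 (t *\<^sub>R z)) * u0 (s *\<^sub>R z))"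

definition A1 :: "real \<Rightarrow> real \<Rightarrow> real" where
  "A1 s t = (LINT z|hemisphere a. q (s *\<^sub>R z) / s * q (t *\<^sub>R z)) + t powr (1 - a) * (LINT z|flat. flux (u0 (t *\<^sub>R z)) * (q (s *\<^sub>R z) / s))"

definition I :: "real \<Rightarrow> real" where "I r = (LINT z|hemisphere a. u0 (r *\<^sub>R z) * q (r *\<^sub>R z))"
definition H :: "real \<Rightarrow> real" where "H r = (LINT z|hemisphere a. (u0 (r *\<^sub>R z))\<^sup>2)"
definition Q :: "real \<Rightarrow> real" where "Q r = (LINT z|hemisphere a. (q (r *\<^sub>R z))\<^sup>2)"

text \<open>Minus the primitive of the flux that vanishes at 0; p times it is the integrand of
  G.\<close>

definition potential :: "real \<Rightarrow> real" where
  "potential s = (lm * max (- s) 0 powr p + lp * max s 0 powr p) / p"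

definition P :: "real \<Rightarrow> real" where "P r = r powr (1 - a) * (LINT z|flat. potential (u0 (r *\<^sub>R z)))"

text \<open>Euler's relation for the p-homogeneous potential. It turns the flat boundary term of
  Green's formula on the diagonal into a multiple of G.\<close>

lemma flux_times: "flux s * s = - p * potential s"
proof -
  have powr_times: "x > 0 \<Longrightarrow> x powr (p - 1) * x = x powr p" for x :: real by (simp add: powr_diff)
  consider "s = 0" | "s > 0" | "s < 0" by linarith
  then show ?thesis
  proof cases
    case 2
    then have "flux s * s = - lp * (s powr (p - 1) * s)" by (simp add: flux_def boundary_flux_def)
    then show ?thesis using p 2 by (simp add: powr_times potential_def)
  next
    case 3
    have e: "(- s) powr (p - 1) * (- s) = (- s) powr p" by (rule powr_times) (use 3 in simp)
    have "flux s * s = - lm * ((- s) powr (p - 1) * (- s))" using 3 by (simp add: flux_def boundary_flux_def)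
    then have "flux s * s = - lm * (- s) powr p" unfolding e .
    then show ?thesis using p 3 by (simp add: potential_def)
  qed (use p in \<open>simp add: potential_def\<close>)
qed

lemma potential_nonneg: "0 \<le> potential s"
  using lm lp p by (simp add: potential_def)

lemma potential_deriv: "(potential has_real_derivative - flux s) (at s)"
proof -
  have 1: "((\<lambda>s. max s 0 powr p) has_real_derivative p * max s 0 powr (p - 1)) (at s)" for s
    by (rule powr_pos_part_derivative) (use p in simp)
  have "((\<lambda>s. max (- s) 0 powr p) has_real_derivative (p * max (- s) 0 powr (p - 1)) * (- 1)) (at s)"
    by (rule DERIV_chain2[where f="\<lambda>s. max s 0 powr p", OF 1]) (auto intro!: derivative_eq_intros)
  from DERIV_cdivide[OF DERIV_add[OF DERIV_cmult[OF this, of lm] DERIV_cmult[OF 1, of lp]], of p]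
  show ?thesis unfolding potential_def[abs_def]
    by (rule DERIV_cong) (use p in \<open>simp add: flux_def boundary_flux_def field_simps\<close>)
qed

lemma continuous_on_potential: "continuous_on UNIV potential"
  by (rule DERIV_continuous_on[OF has_field_derivative_at_within[OF potential_deriv]])

lemma potential_measurable [measurable]: "potential \<in> borel_measurable borel"
  by (intro borel_measurable_continuous_onI continuous_on_potential)

lemma integral_flat_scale:
  fixes F :: "(real^'n) \<times> real \<Rightarrow> real"
  assumes [measurable]: "F \<in> borel_measurable borel" and t: "0 < t"
  shows "(LINT x:ball 0 t|lborel. F (x, 0)) = t powr real CARD('n) * (LINT z|flat. F (t *\<^sub>R z))"
proof -
  have "inverse (t ^ DIM(real^'n)) * (LINT x:ball 0 t|lborel. F (x, 0))
      = (LINT x|lborel. indicator (ball 0 t) (t *\<^sub>R x) *\<^sub>R F (t *\<^sub>R x, 0))"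
    unfolding set_lebesgue_integral_def by (rule lborel_integral_scale[OF t, symmetric])
  also have "\<dots> = (LINT x:ball 0 1|lborel. F (t *\<^sub>R (x, 0)))"
    unfolding set_lebesgue_integral_def
    by (intro Bochner_Integration.integral_cong) (use t in \<open>auto split: split_indicator\<close>)
  also have "\<dots> = (LINT z|flat. F (t *\<^sub>R z))" by (rule integral_flat[symmetric]) measurable
  finally show ?thesis using t by (simp add: powr_realpow field_simps)
qed

lemma set_integral_ball_cong:
  assumes "\<And>x. x \<in> ball 0 t \<Longrightarrow> h x = k x"
  shows "(LINT x:ball (0::real^'n) t|lborel. h x) = (LINT x:ball 0 t|lborel. k x :: real)"
  unfolding set_lebesgue_integral_def
  by (intro Bochner_Integration.integral_cong) (use assms in \<open>auto split: split_indicator\<close>)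

lemma u0_flat: "norm x < R \<Longrightarrow> u0 (x, 0) = u (x, 0)"
  by (simp add: u0_def upper_ball_def)

text \<open>The flat integral scales like t^N and the spherical one like t^(N+a-1). The quotient
  t^(1-a) is the factor in front of the flat term in \<open>A\<close>.\<close>

lemma green_ball_A:
  assumes s: "0 < s" "s < R" and t: "0 < t" "t < R"
  shows "(LINT z:half_ball t|lborel. snd z powr a * (V z \<bullet> ((s / t) *\<^sub>R V ((s / t) *\<^sub>R z))))
    = t powr (real CARD('n) + a - 1) * A s t"
proof -
  have "(LINT x:ball 0 t|lborel. flux (u (x, 0)) * u ((s / t) *\<^sub>R x, 0))
      = (LINT x:ball 0 t|lborel. (\<lambda>z. flux (u0 z) * u0 ((s / t) *\<^sub>R z)) (x, 0))"
  proof (rule set_integral_ball_cong)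
    fix x :: "real^'n" assume x: "x \<in> ball 0 t"
    then have "s / t * norm x < s / t * t" using s t by (intro mult_strict_left_mono) auto
    then have "norm ((s / t) *\<^sub>R x) < R" using s t by simp
    from u0_flat[OF this] u0_flat[of x] x t
    show "flux (u (x, 0)) * u ((s / t) *\<^sub>R x, 0) = (\<lambda>z. flux (u0 z) * u0 ((s / t) *\<^sub>R z)) (x, 0)" by simp
  qed
  also have "\<dots> = t powr real CARD('n) * (LINT z|flat. flux (u0 (t *\<^sub>R z)) * u0 (s *\<^sub>R z))"
    using t by (subst integral_flat_scale[OF _ t(1)]) simp_all
  also have "t powr real CARD('n) = t powr (real CARD('n) + a - 1) * t powr (1 - a)"
    by (simp add: powr_add[symmetric])
  finally show ?thesis by (subst green_ball[OF s t]) (simp add: A_def distrib_left mult.assoc)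
qed

text \<open>Rescaling Green's formula from radius t to radius 1 puts the two dilates on an equal
  footing, and the right-hand side becomes symmetric in s and t.\<close>

lemma A_eq_energy:
  assumes s: "0 < s" "s < R" and t: "0 < t" "t < R"
  shows "A s t = (LINT z:half_ball 1|lborel. snd z powr a * ((s *\<^sub>R V (s *\<^sub>R z)) \<bullet> (t *\<^sub>R V (t *\<^sub>R z))))"
    (is "_ = ?E")
proof -
  define c where "c = s / t"
  have ct: "c * t = s" using t by (simp add: c_def)
  define N where "N = real CARD('n) + a - 1"
  define f where "f z = indicator (half_ball t) z *\<^sub>R (snd z powr a * (V z \<bullet> (c *\<^sub>R V (c *\<^sub>R z))))" for z
  \<comment> \<open>The weight gives t^a. Replacing the factor s / t of the dilated gradient by s t,
    as both gradients now carry their radius, gives t^(-2).\<close>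
  have ft: "f (t *\<^sub>R z) = t powr (a - 2) * (indicator (half_ball 1) z *\<^sub>R (snd z powr a * ((s *\<^sub>R V (s *\<^sub>R z)) \<bullet> (t *\<^sub>R V (t *\<^sub>R z)))))" for z
  proof (cases "z \<in> half_ball 1")
    case True
    then have hb: "t *\<^sub>R z \<in> half_ball t" "0 < snd z" using t by (auto simp: half_ball_def)
    have "t powr (a - 2) * (s * t) = t powr a * c"
      using t by (simp add: powr_diff c_def field_simps power2_eq_square)
    moreover have "c *\<^sub>R t *\<^sub>R z = s *\<^sub>R z" by (simp add: ct)
    ultimately show ?thesis using hb True t
      by (simp add: f_def powr_mult ct inner_commute mult.assoc[symmetric]) (simp add: mult_ac ct)
  next
    case False
    then have "t *\<^sub>R z \<notin> half_ball t" using t by (auto simp: half_ball_def zero_less_mult_iff)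
    then show ?thesis using False by (simp add: f_def)
  qed
  have "inverse (t ^ DIM((real^'n) \<times> real)) * (LINT z|lborel. f z) = (LINT z|lborel. f (t *\<^sub>R z))"
    by (rule lborel_integral_scale[OF t(1), symmetric])
  also have "\<dots> = t powr (a - 2) * ?E"
    unfolding ft set_lebesgue_integral_def by (rule integral_mult_right_zero)
  finally have "(LINT z|lborel. f z) = t ^ DIM((real^'n) \<times> real) * (t powr (a - 2) * ?E)"
    using t by (simp add: field_simps)
  moreover have "t ^ DIM((real^'n) \<times> real) = t powr (real CARD('n) + 1)" using t by (simp add: powr_add powr_realpow)
  moreover have "t powr (real CARD('n) + 1) * t powr (a - 2) = t powr N" by (simp add: powr_add[symmetric] N_def algebra_simps)
  moreover have "(LINT z|lborel. f z) = t powr N * A s t"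
    using green_ball_A[OF s t] by (simp add: f_def c_def N_def set_lebesgue_integral_def)
  ultimately have "t powr N * A s t = t powr N * ?E" by (simp add: mult.assoc[symmetric])
  then show ?thesis using t by simp
qed

lemma A_sym: "0 < s \<Longrightarrow> s < R \<Longrightarrow> 0 < t \<Longrightarrow> t < R \<Longrightarrow> A s t = A t s"
  by (simp only: A_eq_energy inner_commute)

lemma D_fun_eq_A:
  assumes r: "0 < r" "r < R"
  shows "D_fun a V r = A r r" and "0 \<le> D_fun a V r"
proof -
  show "0 \<le> D_fun a V r"
    unfolding D_fun_def set_lebesgue_integral_def
    by (intro mult_nonneg_nonneg Bochner_Integration.integral_nonneg) auto
  have "(LINT z:half_ball r|lborel. snd z powr a * (norm (V z))\<^sup>2) = r powr (real CARD('n) + a - 1) * A r r"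
    using green_ball_A[OF r r] r by (simp add: power2_norm_eq_inner)
  then show "D_fun a V r = A r r"
    using r by (simp add: D_fun_def mult.assoc[symmetric] powr_add[symmetric])
qed

lemma G_fun_eq_P:
  assumes r: "0 < r" "r < R"
  shows "G_fun a p lm lp u r = p * P r"
proof -
  have "(LINT x:ball 0 r|lborel. lm * max (- u (x, 0)) 0 powr p + lp * max (u (x, 0)) 0 powr p)
      = (LINT x:ball 0 r|lborel. (\<lambda>z. p * potential (u0 z)) (x, 0))"
    by (rule set_integral_ball_cong) (use r p u0_flat in \<open>simp add: potential_def\<close>)
  also have "\<dots> = r powr real CARD('n) * (LINT z|flat. p * potential (u0 (r *\<^sub>R z)))"
    using integral_flat_scale[of "\<lambda>z. p * potential (u0 z)", OF _ r(1)] by simp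
  also have "r powr real CARD('n) = r powr (real CARD('n) + a - 1) * r powr (1 - a)"
    by (simp add: powr_add[symmetric])
  finally show ?thesis
    using r by (simp add: G_fun_def P_def mult.assoc[symmetric] powr_add[symmetric])
qed


section \<open>Derivatives in the radius\<close>

lemma dilation_in_upper_ball:
  assumes "0 < s" "s < R" "z \<in> half_disc"
  shows "s *\<^sub>R z \<in> upper_ball R"
proof -
  have "s * norm z \<le> s * 1" using assms by (intro mult_left_mono) (auto simp: half_disc_def)
  then have "s * norm z < R" using assms(2) by linarith
  then show ?thesis using assms by (simp add: upper_ball_def half_disc_def)
qed

lemma dilation_image_subset:
  assumes "\<And>x. x \<in> X \<Longrightarrow> 0 < f x \<and> f x < R \<and> h x \<in> half_disc"
  shows "(\<lambda>x. f x *\<^sub>R h x) ` X \<subseteq> upper_ball R"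
  by (rule image_subsetI, rule dilation_in_upper_ball) (use assms in blast)+

lemma u0_deriv:
  assumes s: "0 < s" "s < R" and z: "z \<in> half_disc"
  shows "((\<lambda>s. u0 (s *\<^sub>R z)) has_real_derivative q (s *\<^sub>R z) / s) (at s)"
proof -
  have "norm (s *\<^sub>R z) < R" "0 \<le> snd z" using dilation_in_upper_ball[OF s z] z by (auto simp: upper_ball_def half_disc_def)
  from has_radial_derivative[OF smooth lim less_imp_le[OF R(2)] continuous_on_u cV cq q s(1) this]
  have "((\<lambda>s. u (s *\<^sub>R z)) has_real_derivative q (s *\<^sub>R z) / s) (at s)" by blast
  then show ?thesis
    by (rule has_field_derivative_transform_within_open[where S="{0<..<R}"])
       (use s dilation_in_upper_ball[OF _ _ z] in \<open>auto simp: u0_def\<close>)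
qed

lemma continuous_on_dilation_pair:
  fixes k :: "(real^'a) \<times> real \<Rightarrow> real"
  assumes "continuous_on (upper_ball R) k"
  shows "continuous_on (({0<..<R} \<times> {0<..<R}) \<times> half_disc) (\<lambda>x. k (fst (fst x) *\<^sub>R snd x))"
    and "continuous_on (({0<..<R} \<times> {0<..<R}) \<times> half_disc) (\<lambda>x. k (snd (fst x) *\<^sub>R snd x))"
proof -
  let ?X = "({0<..<R} \<times> {0<..<R}) \<times> (half_disc :: ((real^'a) \<times> real) set)"
  have c: "continuous_on ?X (\<lambda>x. fst (fst x) *\<^sub>R snd x)" "continuous_on ?X (\<lambda>x. snd (fst x) *\<^sub>R snd x)"
    by (intro continuous_intros)+
  have sub1: "(\<lambda>x. fst (fst x) *\<^sub>R snd x) ` ?X \<subseteq> upper_ball R"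
    by (rule dilation_image_subset) auto
  have sub2: "(\<lambda>x. snd (fst x) *\<^sub>R snd x) ` ?X \<subseteq> upper_ball R"
    by (rule dilation_image_subset) auto
  show "continuous_on ?X (\<lambda>x. k (fst (fst x) *\<^sub>R snd x))"
    by (rule continuous_on_compose2[OF assms c(1) sub1])
  show "continuous_on ?X (\<lambda>x. k (snd (fst x) *\<^sub>R snd x))"
    by (rule continuous_on_compose2[OF assms c(2) sub2])
qed

lemma continuous_on_dilation1:
  assumes "continuous_on (upper_ball R) k" "S \<subseteq> {0<..<R}"
  shows "continuous_on (S \<times> half_disc) (\<lambda>x. k (fst x *\<^sub>R snd x))"
proof (rule continuous_on_compose2[OF assms(1)])
  show "continuous_on (S \<times> half_disc) (\<lambda>x. fst x *\<^sub>R snd x)" by (intro continuous_intros)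
  show "(\<lambda>x. fst x *\<^sub>R snd x) ` (S \<times> half_disc) \<subseteq> upper_ball R"
    by (rule dilation_image_subset) (use assms(2) in auto)
qed

lemma continuous_on_flux_u0: "continuous_on (upper_ball R) (\<lambda>z. flux (u0 z))"
  by (rule continuous_on_compose2[OF continuous_on_flux continuous_on_u0]) simp

text \<open>Continuity jointly in both radii, as differentiation along the diagonal demands. It
  rests on q being continuous up to y = 0.\<close>

lemma continuous_on_A1: "continuous_on ({0<..<R} \<times> {0<..<R}) (\<lambda>(s, t). A1 s t)"
proof -
  let ?S = "{0<..<R} \<times> {0<..<R}"
  have "continuous_on ?S (\<lambda>p. LINT z|hemisphere a. q (fst p *\<^sub>R z) / fst p * q (snd p *\<^sub>R z))"
  proof (rule continuous_on_integral_param(1)[OF finite_hemisphere AE_hemisphere_half_disc])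
    show "continuous_on (?S \<times> half_disc) (\<lambda>(p, z). q (fst p *\<^sub>R z) / fst p * q (snd p *\<^sub>R z))"
      unfolding split_beta
      by (intro continuous_on_mult continuous_on_divide continuous_on_dilation_pair cq continuous_intros) auto
  qed measurable
  moreover have "continuous_on ?S (\<lambda>p. LINT z|flat. flux (u0 (snd p *\<^sub>R z)) * (q (fst p *\<^sub>R z) / fst p))"
  proof (rule continuous_on_integral_param(1)[OF finite_measure_flat AE_flat])
    show "continuous_on (?S \<times> half_disc) (\<lambda>(p, z). flux (u0 (snd p *\<^sub>R z)) * (q (fst p *\<^sub>R z) / fst p))"
      unfolding split_beta
      by (intro continuous_on_mult continuous_on_divide continuous_on_dilation_pair(1)[OF cq]
          continuous_on_dilation_pair(2)[OF continuous_on_flux_u0] continuous_intros) auto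
  qed measurable
  moreover have "continuous_on ?S (\<lambda>p. snd p powr (1 - a))"
    by (intro continuous_on_powr' continuous_intros) auto
  ultimately show ?thesis unfolding A1_def split_beta by (intro continuous_on_add continuous_on_mult)
qed

lemma A_deriv:
  assumes s: "s \<in> {0<..<R}" and t: "t \<in> {0<..<R}"
  shows "((\<lambda>s. A s t) has_real_derivative A1 s t) (at s)"
proof -
  \<comment> \<open>A compact interval around s inside (0,R): over it and the compact half disc all
    integrands are bounded.\<close>
  define \<alpha> \<beta> where "\<alpha> = s / 2" and "\<beta> = (s + R) / 2"
  have ab: "\<alpha> < s" "s < \<beta>" "{\<alpha>..\<beta>} \<subseteq> {0<..<R}" using s by (auto simp: \<alpha>_def \<beta>_def)
  let ?X = "{\<alpha>..\<beta>} \<times> (half_disc :: ((real^'n) \<times> real) set)"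
  have ct: "continuous_on ?X (\<lambda>x. t *\<^sub>R snd x)" by (intro continuous_intros)
  have sub: "(\<lambda>x. t *\<^sub>R snd x) ` ?X \<subseteq> upper_ball R"
    by (rule dilation_image_subset) (use t in auto)
  have qt': "continuous_on ?X (\<lambda>x. q (t *\<^sub>R snd x))" "continuous_on ?X (\<lambda>x. flux (u0 (t *\<^sub>R snd x)))"
    by (rule continuous_on_compose2[OF cq ct sub], rule continuous_on_compose2[OF continuous_on_flux_u0 ct sub])
  have c1: "continuous_on ({\<alpha>..\<beta>} \<times> half_disc) (\<lambda>x. u0 (fst x *\<^sub>R snd x))" "continuous_on ({\<alpha>..\<beta>} \<times> half_disc) (\<lambda>x. q (fst x *\<^sub>R snd x) / fst x)"
    using ab by (auto intro!: continuous_on_divide continuous_on_dilation1 continuous_on_u0 cq continuous_intros)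
  have d: "((\<lambda>s. u0 (s *\<^sub>R z)) has_real_derivative q (s *\<^sub>R z) / s) (at s)" if "s \<in> {\<alpha>..\<beta>}" "z \<in> half_disc" for s z
    by (rule u0_deriv) (use ab(3) that in auto)
  have "((\<lambda>s. LINT z|hemisphere a. u0 (s *\<^sub>R z) * q (t *\<^sub>R z)) has_real_derivative (LINT z|hemisphere a. q (s *\<^sub>R z) / s * q (t *\<^sub>R z))) (at s)"
  proof (rule has_real_derivative_integral_param[OF finite_hemisphere AE_hemisphere_half_disc ab(1,2)])
    show "continuous_on ({\<alpha>..\<beta>} \<times> half_disc) (\<lambda>(s, z). u0 (s *\<^sub>R z) * q (t *\<^sub>R z))"
      "continuous_on ({\<alpha>..\<beta>} \<times> half_disc) (\<lambda>(s, z). q (s *\<^sub>R z) / s * q (t *\<^sub>R z))"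
      unfolding split_beta by (intro continuous_on_mult c1 qt')+
    fix s z assume "s \<in> {\<alpha>..\<beta>}" "z \<in> (half_disc :: ((real^'n) \<times> real) set)"
    then show "((\<lambda>s. u0 (s *\<^sub>R z) * q (t *\<^sub>R z)) has_real_derivative q (s *\<^sub>R z) / s * q (t *\<^sub>R z)) (at s)"
      by (intro DERIV_cmult_right d)
  qed measurable
  moreover have "((\<lambda>s. LINT z|flat. flux (u0 (t *\<^sub>R z)) * u0 (s *\<^sub>R z)) has_real_derivative (LINT z|flat. flux (u0 (t *\<^sub>R z)) * (q (s *\<^sub>R z) / s))) (at s)"
  proof (rule has_real_derivative_integral_param[OF finite_measure_flat AE_flat ab(1,2)])
    show "continuous_on ({\<alpha>..\<beta>} \<times> half_disc) (\<lambda>(s, z). flux (u0 (t *\<^sub>R z)) * u0 (s *\<^sub>R z))"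
      "continuous_on ({\<alpha>..\<beta>} \<times> half_disc) (\<lambda>(s, z). flux (u0 (t *\<^sub>R z)) * (q (s *\<^sub>R z) / s))"
      unfolding split_beta by (intro continuous_on_mult c1 qt')+
    fix s z assume "s \<in> {\<alpha>..\<beta>}" "z \<in> (half_disc :: ((real^'n) \<times> real) set)"
    then show "((\<lambda>s. flux (u0 (t *\<^sub>R z)) * u0 (s *\<^sub>R z)) has_real_derivative flux (u0 (t *\<^sub>R z)) * (q (s *\<^sub>R z) / s)) (at s)"
      by (intro DERIV_cmult d)
  qed measurable
  ultimately show ?thesis unfolding A_def A1_def by (intro DERIV_add DERIV_cmult)
qed

lemma continuous_on_hemisphere_integral:
  fixes k :: "(real^'n) \<times> real \<Rightarrow> real"
  assumes "continuous_on (upper_ball R) k" "k \<in> borel_measurable borel"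
  shows "continuous_on {0<..<R} (\<lambda>r. LINT z|hemisphere a. k (r *\<^sub>R z))"
    and "r \<in> {0<..<R} \<Longrightarrow> integrable (hemisphere a) (\<lambda>z. k (r *\<^sub>R z))"
proof -
  note [measurable] = assms(2)
  have c: "continuous_on ({0<..<R} \<times> half_disc) (\<lambda>(r, z). k (r *\<^sub>R z))"
    unfolding split_beta by (rule continuous_on_dilation1[OF assms(1)]) simp
  show "continuous_on {0<..<R} (\<lambda>r. LINT z|hemisphere a. k (r *\<^sub>R z))"
    by (rule continuous_on_integral_param(1)[OF finite_hemisphere AE_hemisphere_half_disc _ c]) measurable
  show "integrable (hemisphere a) (\<lambda>z. k (r *\<^sub>R z))" if "r \<in> {0<..<R}"
    by (rule continuous_on_integral_param(2)[OF finite_hemisphere AE_hemisphere_half_disc _ c that]) measurable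
qed

lemma H_deriv:
  assumes s: "s \<in> {0<..<R}"
  shows "(H has_real_derivative 2 / s * I s) (at s)"
proof -
  define \<alpha> \<beta> where "\<alpha> = s / 2" and "\<beta> = (s + R) / 2"
  have ab: "\<alpha> < s" "s < \<beta>" "{\<alpha>..\<beta>} \<subseteq> {0<..<R}" using s by (auto simp: \<alpha>_def \<beta>_def)
  have c1: "continuous_on ({\<alpha>..\<beta>} \<times> half_disc) (\<lambda>x. u0 (fst x *\<^sub>R snd x))" "continuous_on ({\<alpha>..\<beta>} \<times> half_disc) (\<lambda>x. q (fst x *\<^sub>R snd x))"
    "continuous_on ({\<alpha>..\<beta>} \<times> (half_disc :: ((real^'n) \<times> real) set)) (\<lambda>x. 2 / fst x)"
    using ab by (auto intro!: continuous_on_dilation1 continuous_on_u0 cq continuous_intros)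
  have "(H has_real_derivative (LINT z|hemisphere a. 2 / s * (u0 (s *\<^sub>R z) * q (s *\<^sub>R z)))) (at s)"
    unfolding H_def[abs_def]
  proof (rule has_real_derivative_integral_param[OF finite_hemisphere AE_hemisphere_half_disc ab(1,2)])
    show "continuous_on ({\<alpha>..\<beta>} \<times> half_disc) (\<lambda>(s, z). (u0 (s *\<^sub>R z))\<^sup>2)"
      "continuous_on ({\<alpha>..\<beta>} \<times> half_disc) (\<lambda>(s, z). 2 / s * (u0 (s *\<^sub>R z) * q (s *\<^sub>R z)))"
      unfolding split_beta by (intro continuous_on_mult continuous_on_power c1)+
    fix s z assume sz: "s \<in> {\<alpha>..\<beta>}" "z \<in> (half_disc :: ((real^'n) \<times> real) set)"
    then have "((\<lambda>s. u0 (s *\<^sub>R z)) has_real_derivative q (s *\<^sub>R z) / s) (at s)" using ab(3) by (intro u0_deriv) auto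
    from DERIV_power[OF this, of 2]
    show "((\<lambda>s. (u0 (s *\<^sub>R z))\<^sup>2) has_real_derivative 2 / s * (u0 (s *\<^sub>R z) * q (s *\<^sub>R z))) (at s)"
      by (rule DERIV_cong) simp
  qed measurable
  then show ?thesis by (simp add: I_def)
qed

text \<open>The power r^(1-a) yields the term with P; the flat integral of flux times q appears with
  a minus sign because the potential has derivative minus the flux. It is the integral that occurs
  in \<open>A1_diagonal\<close>.\<close>

lemma P_deriv:
  assumes s: "s \<in> {0<..<R}"
  shows "(P has_real_derivative ((1 - a) * P s - s powr (1 - a) * (LINT z|flat. flux (u0 (s *\<^sub>R z)) * q (s *\<^sub>R z))) / s) (at s)"
proof -
  define \<alpha> \<beta> where "\<alpha> = s / 2" and "\<beta> = (s + R) / 2"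
  have ab: "\<alpha> < s" "s < \<beta>" "{\<alpha>..\<beta>} \<subseteq> {0<..<R}" using s by (auto simp: \<alpha>_def \<beta>_def)
  have cp: "continuous_on (upper_ball R) (\<lambda>z. potential (u0 z))"
    by (rule continuous_on_compose2[OF continuous_on_potential continuous_on_u0]) simp
  have c1: "continuous_on ({\<alpha>..\<beta>} \<times> half_disc) (\<lambda>x. potential (u0 (fst x *\<^sub>R snd x)))"
    "continuous_on ({\<alpha>..\<beta>} \<times> half_disc) (\<lambda>x. flux (u0 (fst x *\<^sub>R snd x)))"
    "continuous_on ({\<alpha>..\<beta>} \<times> half_disc) (\<lambda>x. q (fst x *\<^sub>R snd x))"
    "continuous_on ({\<alpha>..\<beta>} \<times> (half_disc :: ((real^'n) \<times> real) set)) (\<lambda>x. - 1 / fst x)"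
    using ab continuous_on_dilation1[OF cp] continuous_on_dilation1[OF continuous_on_flux_u0] continuous_on_dilation1[OF cq]
    by (auto intro!: continuous_intros)
  let ?B = "\<lambda>s. LINT z|flat. flux (u0 (s *\<^sub>R z)) * q (s *\<^sub>R z)"
  have "((\<lambda>s. LINT z|flat. potential (u0 (s *\<^sub>R z))) has_real_derivative (LINT z|flat. - 1 / s * (flux (u0 (s *\<^sub>R z)) * q (s *\<^sub>R z)))) (at s)"
  proof (rule has_real_derivative_integral_param[OF finite_measure_flat AE_flat ab(1,2)])
    show "continuous_on ({\<alpha>..\<beta>} \<times> half_disc) (\<lambda>(s, z). potential (u0 (s *\<^sub>R z)))"
      "continuous_on ({\<alpha>..\<beta>} \<times> half_disc) (\<lambda>(s, z). - 1 / s * (flux (u0 (s *\<^sub>R z)) * q (s *\<^sub>R z)))"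
      unfolding split_beta by (intro continuous_on_mult c1)+
    fix s z assume sz: "s \<in> {\<alpha>..\<beta>}" "z \<in> (half_disc :: ((real^'n) \<times> real) set)"
    then have "((\<lambda>s. u0 (s *\<^sub>R z)) has_real_derivative q (s *\<^sub>R z) / s) (at s)" using ab(3) by (intro u0_deriv) auto
    from DERIV_chain2[OF potential_deriv this]
    show "((\<lambda>s. potential (u0 (s *\<^sub>R z))) has_real_derivative - 1 / s * (flux (u0 (s *\<^sub>R z)) * q (s *\<^sub>R z))) (at s)"
      by (rule DERIV_cong) simp
  qed measurable
  then have d: "((\<lambda>s. LINT z|flat. potential (u0 (s *\<^sub>R z))) has_real_derivative - 1 / s * ?B s) (at s)"
    by (simp only: integral_mult_right_zero)
  have "((\<lambda>s. s powr (1 - a)) has_real_derivative (1 - a) * s powr (1 - a - 1)) (at s)"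
    using s by (intro has_real_derivative_powr) auto
  from DERIV_mult[OF this d] show ?thesis
    unfolding P_def[abs_def]
  proof (rule DERIV_cong)
    have e: "s powr (1 - a - 1) = s powr (1 - a) / s" using s by (subst powr_diff) simp
    have "(1 - a) * (X / s) * K + - 1 / s * B * X = ((1 - a) * (X * K) - X * B) / s" for X K B :: real
      using s by (simp add: field_simps)
    then show "(1 - a) * s powr (1 - a - 1) * (LINT z|flat. potential (u0 (s *\<^sub>R z))) + - 1 / s * ?B s * s powr (1 - a) =
      ((1 - a) * (s powr (1 - a) * (LINT z|flat. potential (u0 (s *\<^sub>R z)))) - s powr (1 - a) * ?B s) / s"
      unfolding e .
  qed
qed

lemma A1_diagonal:
  assumes r: "r \<in> {0<..<R}"
  shows "A1 r r = (Q r + r powr (1 - a) * (LINT z|flat. flux (u0 (r *\<^sub>R z)) * q (r *\<^sub>R z))) / r"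
proof -
  have "(LINT z|hemisphere a. q (r *\<^sub>R z) / r * q (r *\<^sub>R z)) = Q r / r"
    by (simp add: Q_def power2_eq_square)
  moreover have "(LINT z|flat. flux (u0 (r *\<^sub>R z)) * (q (r *\<^sub>R z) / r)) = (LINT z|flat. flux (u0 (r *\<^sub>R z)) * q (r *\<^sub>R z)) / r"
    by simp
  ultimately show ?thesis by (simp add: A1_def add_divide_distrib)
qed

text \<open>\<open>H_fun\<close> integrates u itself, whose values off the half ball are
  unconstrained. Measurability allows u to be replaced by the truncation, which agrees with it
  almost everywhere on the half sphere.\<close>

lemma H_fun_eq_H:
  assumes m: "(\<lambda>z. snd z powr a * (u z)\<^sup>2) \<in> borel_measurable borel" and r: "0 < r" "r < R"
  shows "H_fun a u r = H r"
proof -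
  have "(LINT z|half_sphere_measure r. snd z powr a * (u z)\<^sup>2) = (LINT z|half_sphere_measure r. snd z powr a * (u0 z)\<^sup>2)"
  proof (rule integral_cong_AE)
    show "(\<lambda>z. snd z powr a * (u z)\<^sup>2) \<in> borel_measurable (half_sphere_measure r)"
      using m by (simp add: measurable_cong_sets[OF sets_half_sphere_measure refl])
    show "AE z in half_sphere_measure r. snd z powr a * (u z)\<^sup>2 = snd z powr a * (u0 z)\<^sup>2"
      using AE_half_sphere_measure[where 'n='n, OF r(1)]
      by eventually_elim (use r in \<open>simp add: u0_def upper_ball_def\<close>)
  qed measurable
  then have "H_fun a u r = H_fun a u0 r" by (simp add: H_fun_def)
  then show ?thesis using H_fun_eq_hemisphere[OF u0_measurable r(1)] by (simp add: H_def)
qed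

lemma frequency_conclusion:
  "W11_loc {0<..<R} (frequency a p lm lp u V) \<and> mono_on {0<..<R} (frequency a p lm lp u V)
    \<and> distr_deriv_nonneg {0<..<R} (frequency a p lm lp u V)
    \<and> (\<exists>k\<ge>0. (frequency a p lm lp u V \<longlongrightarrow> k) (at_right 0))"
proof (cases "(\<lambda>z. snd z powr a * (u z)\<^sup>2) \<in> borel_measurable borel")
  case False
  \<comment> \<open>A junk case: \<open>u\<close> may be non-measurable outside the half ball, and then the integral defining
    \<open>H\<close> is 0 for every radius.\<close>
  have "\<not> integrable (half_sphere_measure r) (\<lambda>z. snd z powr a * (u z)\<^sup>2)" for r
    using False borel_measurable_integrable[of "half_sphere_measure r" "\<lambda>z. snd z powr a * (u z)\<^sup>2"]
    by (auto simp: measurable_cong_sets[OF sets_half_sphere_measure refl])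
  then have "frequency a p lm lp u V = (\<lambda>_. 0)"
    by (simp add: frequency_def H_fun_def not_integrable_integral_eq fun_eq_iff)
  then show ?thesis
    using C1_nonneg_derivative_conclusion[OF R(1), of "\<lambda>_. 0" "\<lambda>_. 0"] by simp
next
  case True
  show ?thesis
  proof (rule frequency_calculus[OF R(1) p a(2), where H=H and D="\<lambda>r. A r r" and P=P and I=I and Q=Q])
    fix r assume r: "r \<in> {0<..<R}"
    then have r': "0 < r" "r < R" by auto
    show "(H has_real_derivative 2 / r * I r) (at r)" by (rule H_deriv[OF r])
    have "((\<lambda>r. A r r) has_real_derivative 2 * A1 r r) (at r)"
      by (rule symmetric_diagonal_derivative[OF refl r A_sym A_deriv continuous_on_A1]) auto
    \<comment> \<open>The flat integrals of flux times q in the derivatives of A(r,r) and of 2 P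
      cancel, leaving only Q and (1 - a) P.\<close>
    from DERIV_add[OF this DERIV_cmult[OF P_deriv[OF r], of 2]]
    show "((\<lambda>r. A r r + 2 * P r) has_real_derivative 2 / r * (Q r + (1 - a) * P r)) (at r)"
      by (rule DERIV_cong) (use r' in \<open>simp add: A1_diagonal[OF r] field_simps\<close>)
    \<comment> \<open>Green's formula on the diagonal: A(r,r) is I plus the flat term, and Euler's
      relation makes the latter equal to -p P.\<close>
    have "(LINT z|flat. flux (u0 (r *\<^sub>R z)) * u0 (r *\<^sub>R z)) = - p * (LINT z|flat. potential (u0 (r *\<^sub>R z)))"
      unfolding flux_times by (rule integral_mult_right_zero)
    then show "I r = A r r + p * P r" by (simp add: A_def I_def P_def)
    show "0 \<le> A r r" using D_fun_eq_A[OF r'] by simp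
    show "0 \<le> P r" unfolding P_def
      by (intro mult_nonneg_nonneg Bochner_Integration.integral_nonneg potential_nonneg) auto
    show "0 \<le> H r" unfolding H_def by (intro Bochner_Integration.integral_nonneg) auto
    show "(I r)\<^sup>2 \<le> H r * Q r"
      unfolding I_def H_def Q_def
      by (rule integral_Cauchy_Schwarz)
         (intro continuous_on_hemisphere_integral(2)[OF _ _ r, where k="\<lambda>z. (u0 z)\<^sup>2"]
            continuous_on_hemisphere_integral(2)[OF _ _ r, where k="\<lambda>z. (q z)\<^sup>2"]
            continuous_on_hemisphere_integral(2)[OF _ _ r, where k="\<lambda>z. u0 z * q z"]
            continuous_intros continuous_on_u0 cq, measurable)+
    show "frequency a p lm lp u V r = (A r r + 2 * P r) / H r"
      using p by (simp add: frequency_def D_fun_eq_A(1)[OF r'] G_fun_eq_P[OF r'] H_fun_eq_H[OF True r'])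
  next
    show "continuous_on {0<..<R} P"
      by (rule DERIV_continuous_on[OF has_field_derivative_at_within[OF P_deriv]])
    show "continuous_on {0<..<R} I" unfolding I_def[abs_def]
      by (intro continuous_on_hemisphere_integral(1)[where k="\<lambda>z. u0 z * q z"] continuous_intros continuous_on_u0 cq) measurable
    show "continuous_on {0<..<R} Q" unfolding Q_def[abs_def]
      by (intro continuous_on_hemisphere_integral(1)[where k="\<lambda>z. (q z)\<^sup>2"] continuous_intros cq) measurable
  qed
qed

end

theorem theorem3p6:
  fixes a p lm lp R0 \<alpha> :: real
    and g u :: "(real^'n) \<times> real \<Rightarrow> real"
    and V :: "(real^'n) \<times> real \<Rightarrow> (real^'n) \<times> real"
  assumes "-1 < a" and "a < 1" and "2 \<le> p" and "0 \<le> lm" and "0 \<le> lp"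
    and "g \<in> H1a a 1" and "continuous_on (closure (half_ball 1)) g"
    and "weak_solution a p lm lp g u"
    and "continuous_on (half_ball 1 \<union> flat_ball 1) u"
    and "\<exists>z\<in>half_ball 1. u z \<noteq> 0"
    and "H1a_grad a 1 u V"
    and "0 < R0" and "R0 < 1/4"
    and "0 < \<alpha>" and "\<alpha> < 1" and "\<alpha> < 1 - a"
    and "hoelder_on \<alpha> (half_ball R0) (\<lambda>z. fst (V z))"
    and "hoelder_on \<alpha> (half_ball R0) (\<lambda>z. snd z powr a * snd (V z))"
  shows "W11_loc {0<..<R0} (frequency a p lm lp u V)
    \<and> mono_on {0<..<R0} (frequency a p lm lp u V)
    \<and> distr_deriv_nonneg {0<..<R0} (frequency a p lm lp u V)
    \<and> (\<exists>k\<ge>0. (frequency a p lm lp u V \<longlongrightarrow> k) (at_right 0))"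
proof -
  obtain \<phi> where \<phi>: "\<And>k. smooth (\<phi> k)" "H1a_lim a 1 \<phi> u V"
    using \<open>H1a_grad a 1 u V\<close> unfolding H1a_grad_def by blast
  obtain Q where Q: "continuous_on (upper_ball R0) Q" "\<And>z. z \<in> half_ball R0 \<Longrightarrow> Q z = V z \<bullet> z"
    and cV: "continuous_on (half_ball R0) V"
    using radial_derivative_extension[OF \<open>0 < \<alpha>\<close> \<open>a < 1\<close> assms(17,18)] by blast
  \<comment> \<open>The extension by 0 fulfils the convention of the locale and changes nothing on
    the upper ball, where continuity is required.\<close>
  define q where "q z = (if z \<in> upper_ball R0 then Q z else 0)" for z
  have sub: "half_ball R0 \<subseteq> upper_ball R0" by (auto simp: half_ball_def upper_ball_def)
  have cq: "continuous_on (upper_ball R0) q" using Q(1) by (rule continuous_on_eq) (simp add: q_def)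
  interpret weak_solution_near_0 a p lm lp R0 g u q V \<phi>
  proof
    show "q z = V z \<bullet> z" if "z \<in> half_ball R0" for z using Q(2)[OF that] sub that by (auto simp: q_def)
  qed (use assms \<phi> cV cq in \<open>auto simp: q_def\<close>)
  show ?thesis by (rule frequency_conclusion)
qed

end
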